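(* Let $u_0\in H^1(\mathbb S)$ with $h:=\int_{\mathbb S}u_{0x}^2\,dx\neq1$. Then the problem $$u_t-u^2u_x=\partial_x^{-1}(u-uu_x^2)-f(t),\qquad u(0,x)=u_0(x),\qquad u(t,x+1)=u(t,x),$$ has a global admissible conservative weak solution, in the sense defined below.
   Context: $\mathbb S=\mathbb R/\mathbb Z$; functions on $\mathbb S$ are identified with 1-periodic functions on $\mathbb R$. For $w$ on $\mathbb S$ write - $\overline w=\int_{\mathbb S}w\,dx$; - $\mathbb Pw=w-\overline w$; - $\partial_x^{-1}w(x)=\int_0^x\mathbb Pw(y)\,dy$. Test functions $\psi\in C_0^\infty(\mathbb R^+;\mathcal D(\mathbb S))$ are smooth, 1-periodic in $x$, and compactly supported in $t\in[0,\infty)$. Also $$f(t)=\frac{1}{1-h}\int_{\mathbb S}(1-u_x^2)\,\partial_x^{-1}(u-uu_x^2)(y)\,dy.$$ A function $u\in L^\infty(\mathbb R^+;H^1(\mathbb S))$ is a global admissible conservative weak solution if all of the following hold. (i) For all test functions $\psi$, $$\int_{\mathbb R^+}\!\int_{\mathbb S}(u\psi_{tx}+u^2u_x\psi_x)\,dx\,dt=\int_{\mathbb R^+}\!\int_{\mathbb S}\big(u-uu_x^2-\overline{u-uu_x^2}\big)\psi\,dx\,dt+\int_{\mathbb S}u_{0x}\psi(0,x)\,dx.$$ (ii) For all test functions $\psi$, $$\int_{\mathbb R^+}\!\int_{\mathbb S}(u\psi_t-\tfrac13u^3\psi_x)\,dx\,dt=-\int_{\mathbb R^+}\!\int_{\mathbb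 S}\big(\partial_x^{-1}(u-uu_x^2)-f(t)\big)\psi\,dx\,dt-\int_{\mathbb S}u_0\psi(0,x)\,dx.$$ (iii) $\int_{\mathbb S}u_x^2\,dx$ and $\int_{\mathbb S}(u-uu_x^2)\,dx$ are constant in time. (iv) For all test functions $\psi$, $$\int_{\mathbb R^+}\!\int_{\mathbb S}(u_x^2\psi_t-u^2u_x^2\psi_x)\,dz\,dt=-\int_{\mathbb R^+}\!\int_{\mathbb S}\big((u^2)_x-2u_x\overline{u-uu_x^2}\big)\psi\,dz\,dt-\int_{\mathbb S}u_{0x}^2\psi(0,z)\,dz.$$ *)

theory Defs
  imports "HOL-Analysis.Analysis"
begin

section \<open>Functions on the circle S = R/Z (as 1-periodic functions on R)\<close>

definition periodic1 :: "(real \<Rightarrow> real) \<Rightarrow> bool" where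
  "periodic1 w \<longleftrightarrow> (\<forall>x. w (x + 1) = w x)"

definition Smean :: "(real \<Rightarrow> real) \<Rightarrow> real" where
  "Smean w = (LINT x:{0..1}|lborel. w x)"

definition Sproj :: "(real \<Rightarrow> real) \<Rightarrow> real \<Rightarrow> real" where
  "Sproj w = (\<lambda>x. w x - Smean w)"

definition Sdxinv :: "(real \<Rightarrow> real) \<Rightarrow> real \<Rightarrow> real" where
  "Sdxinv w x = (LBINT y=0..x. Sproj w y)"

definition smooth1 :: "(real \<Rightarrow> real) \<Rightarrow> bool" where
  "smooth1 \<phi> \<longleftrightarrow> (\<forall>n x. ((deriv ^^ n) \<phi>) differentiable (at x))"

definition H1S :: "(real \<Rightarrow> real) \<Rightarrow> (real \<Rightarrow> real) \<Rightarrow> bool" where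
  "H1S v vx \<longleftrightarrow> periodic1 v \<and> periodic1 vx \<and>
     v \<in> borel_measurable lborel \<and> vx \<in> borel_measurable lborel \<and>
     set_integrable lborel {0..1} (\<lambda>x. (v x)\<^sup>2) \<and>
     set_integrable lborel {0..1} (\<lambda>x. (vx x)\<^sup>2) \<and>
     (\<forall>\<phi>. smooth1 \<phi> \<and> periodic1 \<phi> \<longrightarrow>
        (LINT x:{0..1}|lborel. v x * deriv \<phi> x) = - (LINT x:{0..1}|lborel. vx x * \<phi> x))"

definition pdt :: "(real \<Rightarrow> real \<Rightarrow> real) \<Rightarrow> real \<Rightarrow> real \<Rightarrow> real" where
  "pdt f = (\<lambda>t x. deriv (\<lambda>s. f s x) t)"

definition pdx :: "(real \<Rightarrow> real \<Rightarrow> real) \<Rightarrow> real \<Rightarrow> real \<Rightarrow> real" where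
  "pdx f = (\<lambda>t x. deriv (\<lambda>y. f t y) x)"

fun pd_iter :: "bool list \<Rightarrow> (real \<Rightarrow> real \<Rightarrow> real) \<Rightarrow> real \<Rightarrow> real \<Rightarrow> real" where
  "pd_iter [] f = f"
| "pd_iter (b # bs) f = (if b then pdt else pdx) (pd_iter bs f)"

definition smooth2 :: "(real \<Rightarrow> real \<Rightarrow> real) \<Rightarrow> bool" where
  "smooth2 f \<longleftrightarrow> (\<forall>ds p. (\<lambda>q::real\<times>real. pd_iter ds f (fst q) (snd q)) differentiable (at p))"

definition test_fun :: "(real \<Rightarrow> real \<Rightarrow> real) \<Rightarrow> bool" where
  "test_fun \<psi> \<longleftrightarrow> smooth2 \<psi> \<and> (\<forall>t. periodic1 (\<psi> t)) \<and>
     (\<exists>T. \<forall>t x. T \<le> t \<longrightarrow> \<psi> t x = 0)"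

definition Linf_H1 :: "(real \<Rightarrow> real \<Rightarrow> real) \<Rightarrow> (real \<Rightarrow> real \<Rightarrow> real) \<Rightarrow> bool" where
  "Linf_H1 u ux \<longleftrightarrow>
     (\<lambda>p::real\<times>real. u (fst p) (snd p)) \<in> borel_measurable lebesgue \<and>
     (\<lambda>p::real\<times>real. ux (fst p) (snd p)) \<in> borel_measurable lebesgue \<and>
     (AE t in lborel. 0 \<le> t \<longrightarrow> H1S (u t) (ux t)) \<and>
     (\<exists>C. AE t in lborel. 0 \<le> t \<longrightarrow>
        (LINT x:{0..1}|lborel. (u t x)\<^sup>2 + (ux t x)\<^sup>2) \<le> C)"

definition hval :: "(real \<Rightarrow> real) \<Rightarrow> real" where
  "hval u0x = (LINT x:{0..1}|lborel. (u0x x)\<^sup>2)"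

definition ffun :: "real \<Rightarrow> (real \<Rightarrow> real \<Rightarrow> real) \<Rightarrow> (real \<Rightarrow> real \<Rightarrow> real) \<Rightarrow> real \<Rightarrow> real" where
  "ffun h u ux t = 1 / (1 - h) *
     (LINT y:{0..1}|lborel. (1 - (ux t y)\<^sup>2) *
        Sdxinv (\<lambda>z. u t z - u t z * (ux t z)\<^sup>2) y)"

definition global_acws ::
  "(real \<Rightarrow> real) \<Rightarrow> (real \<Rightarrow> real) \<Rightarrow> (real \<Rightarrow> real \<Rightarrow> real) \<Rightarrow> (real \<Rightarrow> real \<Rightarrow> real) \<Rightarrow> bool" where
  "global_acws u0 u0x u ux \<longleftrightarrow>
     Linf_H1 u ux \<and>
     \<comment> \<open>(i)\<close>
     (\<forall>\<psi>. test_fun \<psi> \<longrightarrow>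
        (LINT t:{0..}|lborel. LINT x:{0..1}|lborel.
            u t x * pdt (pdx \<psi>) t x + (u t x)\<^sup>2 * ux t x * pdx \<psi> t x)
      = (LINT t:{0..}|lborel. LINT x:{0..1}|lborel.
            (u t x - u t x * (ux t x)\<^sup>2
             - Smean (\<lambda>z. u t z - u t z * (ux t z)\<^sup>2)) * \<psi> t x)
        + (LINT x:{0..1}|lborel. u0x x * \<psi> 0 x)) \<and>
     \<comment> \<open>(ii)\<close>
     (\<forall>\<psi>. test_fun \<psi> \<longrightarrow>
        (LINT t:{0..}|lborel. LINT x:{0..1}|lborel.
            u t x * pdt \<psi> t x - 1/3 * (u t x)^3 * pdx \<psi> t x)
      = - (LINT t:{0..}|lborel. LINT x:{0..1}|lborel.
            (Sdxinv (\<lambda>z. u t z - u t z * (ux t z)\<^sup>2) x - ffun (hval u0x) u ux t) * \<psi> t x)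
        - (LINT x:{0..1}|lborel. u0 x * \<psi> 0 x)) \<and>
     \<comment> \<open>(iii)\<close>
     (\<exists>c1 c2. AE t in lborel. 0 \<le> t \<longrightarrow>
        (LINT x:{0..1}|lborel. (ux t x)\<^sup>2) = c1 \<and>
        (LINT x:{0..1}|lborel. u t x - u t x * (ux t x)\<^sup>2) = c2) \<and>
     \<comment> \<open>(iv)\<close>
     (\<forall>\<psi>. test_fun \<psi> \<longrightarrow>
        (LINT t:{0..}|lborel. LINT z:{0..1}|lborel.
            (ux t z)\<^sup>2 * pdt \<psi> t z - (u t z)\<^sup>2 * (ux t z)\<^sup>2 * pdx \<psi> t z)
      = - (LINT t:{0..}|lborel. LINT z:{0..1}|lborel.
            (2 * u t z * ux t z
             - 2 * ux t z * Smean (\<lambda>y. u t y - u t y * (ux t y)\<^sup>2)) * \<psi> t z)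
        - (LINT z:{0..1}|lborel. (u0x z)\<^sup>2 * \<psi> 0 z))"

end

theory Submission
  imports Defs "HOL-Complex_Analysis.Conformal_Mappings" "HOL-Real_Asymp.Real_Asymp"
begin

text \<open>
  Follow the characteristics, with labels measured by \<open>dM = (1 + u_{0x}^2) dx\<close>. The densities \<open>y, v, e\<close>
  of \<open>dx\<close>, \<open>du\<close>, \<open>u_x^2 dx\<close> then start bounded by 1 and solve the system
  \<open>y' = - 2 U v\<close>, \<open>v' = U (y - e) - m y\<close>, \<open>e' = 2 (U - m) v\<close>, where \<open>U\<close> is a nonlocal quadratic function
  of them. The right-hand side is polynomial, so a power series in \<open>t\<close> converges on a time interval depending
  only on \<open>h\<close> and \<open>m\<close>. Hence each \<open>y(., z)\<close> is real analytic with \<open>y(0, z) > 0\<close> and has finitely many zeros,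
  and by Fubini energy concentrates (\<open>y = 0\<close> on a set of positive measure) only at a null set of times.
  At all other times the change of variables \<open>x = Y(t, z)\<close> turns the time derivatives of the integrals of
  \<open>U \<psi> y\<close> and \<open>e \<psi>\<close> into the weak identities. Since \<open>h\<close> and \<open>m\<close> are conserved, restarting from a
  non-exceptional time in the second half of each interval gives a global solution without any growth estimate.
\<close>

section \<open>Power series with function coefficients\<close>

text \<open>A power series is chosen over a fixed-point scheme because analyticity bounds the number
  of zeros of \<open>y\<close>, the times at which energy concentrates at a label. No conservation
  law is built in. The additive constant of \<open>U\<close> is defined through \<open>m\<close>
  with the nominal value \<open>1 - h\<close> of the integral of \<open>y - e\<close>, and the
  defects of the totals of \<open>v\<close>, \<open>y\<close>, \<open>e\<close> are then shown to
  obey a closed differential system that keeps them at 0. Likewise \<open>y * e = v^2\<close> is a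
  first integral, and with \<open>y + e\<close> close to 1 it yields the signs of both densities.
  The labels prefer a moving base point \<open>X\<close> on the circle, whereas
  \<open>\<partial>_x^{-1}\<close> starts at 0. The normalisation \<open>f\<close> makes the two
  choices agree: the discrepancy is constant in space and cancels in the difference of the primitive
  and \<open>f\<close>. The flow map need not be differentiable in the label; spatial integration by
  parts is therefore carried out against the label measure, where the absence of atoms is enough.
  Identity (i) is obtained from (ii) for the space derivative of the test function.\<close>

definition conv :: "(nat \<Rightarrow> 'a \<Rightarrow> real) \<Rightarrow> (nat \<Rightarrow> 'a \<Rightarrow> real) \<Rightarrow> nat \<Rightarrow> 'a \<Rightarrow> real" where
  "conv a b n x = (\<Sum>i\<le>n. a i x * b (n - i) x)"

definition pseries :: "(nat \<Rightarrow> 'a \<Rightarrow> real) \<Rightarrow> real \<Rightarrow> 'a \<Rightarrow> real" where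
  "pseries a t x = (\<Sum>n. a n x * t ^ n)"

definition dcoeff :: "(nat \<Rightarrow> 'a \<Rightarrow> real) \<Rightarrow> nat \<Rightarrow> 'a \<Rightarrow> real" where
  "dcoeff a n x = real (Suc n) * a (Suc n) x"

text \<open>The constant is uniform in the label, so that a series may be integrated over labels
  term by term. It is left existential because only the rate \<open>Q\<close> governs
  convergence.\<close>

definition geom_bdd :: "real \<Rightarrow> (nat \<Rightarrow> real \<Rightarrow> real) \<Rightarrow> bool" where
  "geom_bdd Q a \<longleftrightarrow> (\<forall>n. a n \<in> borel_measurable borel) \<and> (\<exists>A. \<forall>n x. \<bar>a n x\<bar> \<le> A * Q ^ n)"

lemma geom_bddI: "(\<And>n. a n \<in> borel_measurable borel) \<Longrightarrow> (\<And>n x. \<bar>a n x\<bar> \<le> A * Q ^ n) \<Longrightarrow> geom_bdd Q a"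
  unfolding geom_bdd_def by blast

lemma geom_bdd_measurable [measurable_dest]: "geom_bdd Q a \<Longrightarrow> a n \<in> borel_measurable borel"
  unfolding geom_bdd_def by blast

lemma geom_bddE:
  assumes "geom_bdd Q a"
  obtains A where "A \<ge> 0" "\<And>n x. \<bar>a n x\<bar> \<le> A * Q ^ n"
proof -
  obtain A where A: "\<bar>a n x\<bar> \<le> A * Q ^ n" for n x using assms unfolding geom_bdd_def by blast
  from A[of 0 undefined] have "A \<ge> 0" by simp
  then show thesis using A that by blast
qed

lemma geom_bdd_mono:
  assumes "geom_bdd Q a" "0 \<le> Q" "Q \<le> Q'"
  shows "geom_bdd Q' a"
proof -
  obtain A where A: "A \<ge> 0" "\<bar>a n x\<bar> \<le> A * Q ^ n" for n x using geom_bddE[OF assms(1)] by metis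
  have "\<bar>a n x\<bar> \<le> A * Q' ^ n" for n x
    using A(2)[of n x] mult_left_mono[OF power_mono[OF assms(3,2), of n] A(1)] by linarith
  then show ?thesis using assms(1) by (intro geom_bddI) auto
qed

lemma geom_bdd_bound_summable:
  fixes a :: "nat \<Rightarrow> 'a \<Rightarrow> real"
  assumes "\<And>n. \<bar>a n x\<bar> \<le> A * Q ^ n" "0 \<le> Q" "\<bar>t\<bar> * Q < 1"
  shows "summable (\<lambda>n. norm (a n x * t ^ n))"
proof (rule summable_comparison_test')
  show "summable (\<lambda>n. A * (\<bar>t\<bar> * Q) ^ n)"
    using assms by (intro summable_mult summable_geometric) auto
  show "norm (norm (a n x * t ^ n)) \<le> A * (\<bar>t\<bar> * Q) ^ n" for n
    using mult_right_mono[OF assms(1)[of n], of "\<bar>t\<bar> ^ n"]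
    by (simp add: abs_mult power_abs power_mult_distrib mult_ac)
qed

lemma geom_bdd_summable_norm:
  assumes "geom_bdd Q a" "0 \<le> Q" "\<bar>t\<bar> * Q < 1"
  shows "summable (\<lambda>n. norm (a n x * t ^ n))"
proof -
  obtain A where "A \<ge> 0" "\<And>n x. \<bar>a n x\<bar> \<le> A * Q ^ n" using geom_bddE[OF assms(1)] by metis
  then show ?thesis using assms by (intro geom_bdd_bound_summable) auto
qed

lemma geom_bdd_summable:
  assumes "geom_bdd Q a" "0 \<le> Q" "\<bar>t\<bar> * Q < 1"
  shows "summable (\<lambda>n. a n x * t ^ n)"
  using geom_bdd_summable_norm[OF assms] by (rule summable_norm_cancel)

lemma pseries_conv:
  assumes "geom_bdd Q a" "geom_bdd Q b" "0 \<le> Q" "\<bar>t\<bar> * Q < 1"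
  shows "pseries (conv a b) t x = pseries a t x * pseries b t x"
proof -
  have "(\<lambda>k. \<Sum>i\<le>k. (a i x * t ^ i) * (b (k - i) x * t ^ (k - i))) sums (pseries a t x * pseries b t x)"
    unfolding pseries_def by (intro Cauchy_product_sums geom_bdd_summable_norm[OF _ assms(3,4)] assms)
  moreover have "(\<Sum>i\<le>k. (a i x * t ^ i) * (b (k - i) x * t ^ (k - i))) = conv a b k x * t ^ k" for k
    unfolding conv_def sum_distrib_right
    by (intro sum.cong refl) (auto simp: mult_ac simp flip: power_add)
  ultimately show ?thesis unfolding pseries_def by (simp add: sums_iff)
qed

lemma Suc_le_two_power: "real (Suc n) \<le> 2 ^ n"
  by (induction n) auto

text \<open>The n + 1 summands of the Cauchy product are paid for by doubling the rate, via
  \<open>n + 1 \<le> 2^n\<close>. This is harmless for finitely many products; inside the recursion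
  sharper weights take over.\<close>

lemma geom_bdd_conv:
  assumes "geom_bdd Q a" "geom_bdd Q b" "0 \<le> Q"
  shows "geom_bdd (2 * Q) (conv a b)"
proof -
  obtain A where A: "A \<ge> 0" "\<bar>a n x\<bar> \<le> A * Q ^ n" for n x using geom_bddE[OF assms(1)] by metis
  obtain B where B: "B \<ge> 0" "\<bar>b n x\<bar> \<le> B * Q ^ n" for n x using geom_bddE[OF assms(2)] by metis
  have [measurable]: "a n \<in> borel_measurable borel" "b n \<in> borel_measurable borel" for n
    using assms by auto
  show ?thesis
  proof (rule geom_bddI)
    show "conv a b n \<in> borel_measurable borel" for n unfolding conv_def[abs_def] by measurable
    fix n x
    have "\<bar>conv a b n x\<bar> \<le> (\<Sum>i\<le>n. \<bar>a i x\<bar> * \<bar>b (n - i) x\<bar>)"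
      unfolding conv_def abs_mult[symmetric] by (rule sum_abs)
    also have "\<dots> \<le> (\<Sum>i\<le>n. (A * Q ^ i) * (B * Q ^ (n - i)))"
      using A B assms(3) by (intro sum_mono mult_mono) auto
    also have "\<dots> = (\<Sum>i\<le>n. A * B * Q ^ n)"
      by (intro sum.cong refl) (auto simp: mult_ac simp flip: power_add)
    also have "\<dots> = (A * B * Q ^ n) * real (Suc n)" by simp
    also have "\<dots> \<le> (A * B * Q ^ n) * 2 ^ n"
      using A B assms(3) by (intro mult_left_mono Suc_le_two_power) auto
    also have "\<dots> = A * B * (2 * Q) ^ n" by (simp add: power_mult_distrib)
    finally show "\<bar>conv a b n x\<bar> \<le> A * B * (2 * Q) ^ n" .
  qed
qed

lemma geom_bdd_dcoeff:
  assumes "geom_bdd Q a" "0 \<le> Q"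
  shows "geom_bdd (2 * Q) (dcoeff a)"
proof -
  obtain A where A: "A \<ge> 0" "\<bar>a n x\<bar> \<le> A * Q ^ n" for n x using geom_bddE[OF assms(1)] by metis
  have [measurable]: "a n \<in> borel_measurable borel" for n
    using assms by auto
  show ?thesis
  proof (rule geom_bddI)
    show "dcoeff a n \<in> borel_measurable borel" for n unfolding dcoeff_def[abs_def] by measurable
    fix n x
    have "\<bar>dcoeff a n x\<bar> = real (Suc n) * \<bar>a (Suc n) x\<bar>" by (simp add: dcoeff_def abs_mult)
    also have "\<dots> \<le> 2 ^ n * (A * Q ^ Suc n)"
      using A(1) A(2)[of "Suc n" x] by (intro mult_mono Suc_le_two_power) simp_all
    also have "\<dots> = A * Q * (2 * Q) ^ n" by (simp add: power_mult_distrib)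
    finally show "\<bar>dcoeff a n x\<bar> \<le> A * Q * (2 * Q) ^ n" .
  qed
qed

lemma geom_bdd_add:
  assumes "geom_bdd Q a" "geom_bdd Q b"
  shows "geom_bdd Q (\<lambda>n x. a n x + b n x)"
proof -
  obtain A where A: "A \<ge> 0" "\<bar>a n x\<bar> \<le> A * Q ^ n" for n x using geom_bddE[OF assms(1)] by metis
  obtain B where B: "B \<ge> 0" "\<bar>b n x\<bar> \<le> B * Q ^ n" for n x using geom_bddE[OF assms(2)] by metis
  have [measurable]: "a n \<in> borel_measurable borel" "b n \<in> borel_measurable borel" for n
    using assms by auto
  have "\<bar>a n x + b n x\<bar> \<le> (A + B) * Q ^ n" for n x
    using A(2)[of n x] B(2)[of n x] by (simp add: distrib_right)
  then show ?thesis by (intro geom_bddI) auto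
qed

lemma geom_bdd_cmult:
  assumes "geom_bdd Q a"
  shows "geom_bdd Q (\<lambda>n x. c * a n x)"
proof -
  obtain A where A: "A \<ge> 0" "\<bar>a n x\<bar> \<le> A * Q ^ n" for n x using geom_bddE[OF assms(1)] by metis
  have [measurable]: "a n \<in> borel_measurable borel" for n
    using assms by auto
  have "\<bar>c * a n x\<bar> \<le> (\<bar>c\<bar> * A) * Q ^ n" for n x
    using mult_left_mono[OF A(2)[of n x], of "\<bar>c\<bar>"] by (simp add: abs_mult mult_ac)
  then show ?thesis by (intro geom_bddI) auto
qed

lemma geom_bdd_diff:
  assumes "geom_bdd Q a" "geom_bdd Q b"
  shows "geom_bdd Q (\<lambda>n x. a n x - b n x)"
  using geom_bdd_add[OF assms(1) geom_bdd_cmult[OF assms(2), of "-1"]] by simp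

lemma pseries_add:
  assumes "geom_bdd Q a" "geom_bdd Q b" "0 \<le> Q" "\<bar>t\<bar> * Q < 1"
  shows "pseries (\<lambda>n x. a n x + b n x) t x = pseries a t x + pseries b t x"
  unfolding pseries_def distrib_right
  by (intro suminf_add[symmetric] geom_bdd_summable[OF _ assms(3,4)] assms)

lemma pseries_diff:
  assumes "geom_bdd Q a" "geom_bdd Q b" "0 \<le> Q" "\<bar>t\<bar> * Q < 1"
  shows "pseries (\<lambda>n x. a n x - b n x) t x = pseries a t x - pseries b t x"
  unfolding pseries_def left_diff_distrib
  by (intro suminf_diff[symmetric] geom_bdd_summable[OF _ assms(3,4)] assms)

lemma pseries_cmult:
  assumes "geom_bdd Q a" "0 \<le> Q" "\<bar>t\<bar> * Q < 1"
  shows "pseries (\<lambda>n x. c * a n x) t x = c * pseries a t x"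
  unfolding pseries_def mult.assoc
  by (intro suminf_mult geom_bdd_summable[OF _ assms(2,3)] assms)

lemma pseries_0 [simp]: "pseries a 0 x = a 0 x"
  unfolding pseries_def by (rule powser_zero)

text \<open>On half of the disc of convergence the geometric series is at most 2; the second bound
  starts at the linear term and measures the drift from the initial value.\<close>

lemma pseries_bound:
  assumes A: "\<And>n. \<bar>a n x\<bar> \<le> A * Q ^ n" and Q: "0 \<le> Q" "\<bar>t\<bar> * Q \<le> 1/2"
  shows "\<bar>pseries a t x\<bar> \<le> 2 * A" "\<bar>pseries a t x - a 0 x\<bar> \<le> 2 * A * Q * \<bar>t\<bar>"
proof -
  have A0: "A \<ge> 0" using A[of 0] by simp
  have lt: "\<bar>t\<bar> * Q < 1" using Q by simp
  have sn: "summable (\<lambda>n. norm (a n x * t ^ n))"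
    using A Q lt by (intro geom_bdd_bound_summable) auto
  have s: "summable (\<lambda>n. a n x * t ^ n)" using sn by (rule summable_norm_cancel)
  have geo: "(\<lambda>n. (\<bar>t\<bar> * Q) ^ n) sums (1 / (1 - \<bar>t\<bar> * Q))"
    using Q lt by (intro geometric_sums) auto
  have le2: "1 / (1 - \<bar>t\<bar> * Q) \<le> 2" using Q by (simp add: field_simps)
  have tb: "norm (a n x * t ^ n) \<le> A * (\<bar>t\<bar> * Q) ^ n" for n
    using mult_right_mono[OF A[of n], of "\<bar>t\<bar> ^ n"]
    by (simp add: abs_mult power_abs power_mult_distrib mult_ac)
  have "\<bar>pseries a t x\<bar> \<le> (\<Sum>n. norm (a n x * t ^ n))"
    unfolding pseries_def real_norm_def[symmetric] by (rule summable_norm[OF sn])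
  also have "\<dots> \<le> (\<Sum>n. A * (\<bar>t\<bar> * Q) ^ n)"
    using geo by (intro suminf_le tb sn summable_mult) (auto simp: sums_iff)
  also have "\<dots> = A * (1 / (1 - \<bar>t\<bar> * Q))" using geo by (simp add: suminf_mult sums_iff)
  also have "\<dots> \<le> A * 2" using le2 A0 by (intro mult_left_mono)
  finally show "\<bar>pseries a t x\<bar> \<le> 2 * A" by simp
  have "pseries a t x - a 0 x = (\<Sum>n. a (Suc n) x * t ^ Suc n)"
    unfolding pseries_def using suminf_split_head[OF s] by simp
  also have "\<bar>\<dots>\<bar> \<le> (\<Sum>n. norm (a (Suc n) x * t ^ Suc n))"
    unfolding real_norm_def[symmetric]
    by (rule summable_norm) (use sn summable_Suc_iff[of "\<lambda>n. norm (a n x * t ^ n)"] in simp)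
  also have "\<dots> \<le> (\<Sum>n. A * (\<bar>t\<bar> * Q) * (\<bar>t\<bar> * Q) ^ n)"
  proof (intro suminf_le)
    show "norm (a (Suc n) x * t ^ Suc n) \<le> A * (\<bar>t\<bar> * Q) * (\<bar>t\<bar> * Q) ^ n" for n
      using tb[of "Suc n"] by (simp add: mult_ac)
    show "summable (\<lambda>n. norm (a (Suc n) x * t ^ Suc n))"
      using sn summable_Suc_iff[of "\<lambda>n. norm (a n x * t ^ n)"] by simp
    show "summable (\<lambda>n. A * (\<bar>t\<bar> * Q) * (\<bar>t\<bar> * Q) ^ n)"
      using geo by (intro summable_mult) (auto simp: sums_iff)
  qed
  also have "\<dots> = A * (\<bar>t\<bar> * Q) * (1 / (1 - \<bar>t\<bar> * Q))"
    using geo by (subst suminf_mult) (auto simp: sums_iff)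
  also have "\<dots> \<le> A * (\<bar>t\<bar> * Q) * 2" using le2 A0 Q by (intro mult_left_mono) auto
  finally show "\<bar>pseries a t x - a 0 x\<bar> \<le> 2 * A * Q * \<bar>t\<bar>" by (simp add: mult_ac)
qed

lemma pseries_deriv:
  assumes "geom_bdd Q a" "0 < Q" "\<bar>t\<bar> * Q < 1"
  shows "((\<lambda>t. pseries a t x) has_real_derivative pseries (dcoeff a) t x) (at t)"
proof -
  have "((\<lambda>z. \<Sum>n. a n x * z ^ n) has_field_derivative (\<Sum>n. diffs (\<lambda>n. a n x) n * t^n)) (at t)"
  proof (rule termdiffs_strong'[where K = "1 / Q"])
    show "norm t < 1 / Q" using assms by (simp add: field_simps)
    show "summable (\<lambda>n. a n x * z ^ n)" if "norm z < 1 / Q" for z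
      using that assms by (intro geom_bdd_summable[OF assms(1)]) (auto simp: field_simps)
  qed
  then show ?thesis unfolding pseries_def dcoeff_def diffs_def .
qed

lemma measurable_pseries [measurable (raw)]:
  assumes "\<And>n. a n \<in> borel_measurable borel" "f \<in> borel_measurable M" "g \<in> borel_measurable M"
  shows "(\<lambda>w. pseries a (f w) (g w)) \<in> borel_measurable M"
  unfolding pseries_def
proof (rule borel_measurable_suminf)
  fix i
  note [measurable] = assms
  show "(\<lambda>w. a i (g w) * f w ^ i) \<in> borel_measurable M" by measurable
qed

text \<open>Extended to the complex disc of radius \<open>1 / Q\<close> the series is holomorphic.
  The nonzero constant coefficient keeps it from vanishing identically, so a compact subset contains
  only finitely many zeros.\<close>

lemma pseries_zeros_finite:
  assumes "geom_bdd Q a" "0 < Q" "a 0 x \<noteq> 0" "r * Q < 1"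
  shows "finite {t. \<bar>t\<bar> \<le> r \<and> pseries a t x = 0}"
proof -
  define f where "f z = (\<Sum>n. complex_of_real (a n x) * z ^ n)" for z
  let ?S = "ball (0::complex) (1 / Q)"
  have summ: "summable (\<lambda>n. complex_of_real (a n x) * z ^ n)" if "norm z < 1 / Q" for z
  proof (rule summable_norm_cancel)
    have "summable (\<lambda>n. norm (a n x * (norm z) ^ n))"
      using that assms by (intro geom_bdd_summable_norm[OF assms(1)]) (auto simp: field_simps)
    then show "summable (\<lambda>n. norm (complex_of_real (a n x) * z ^ n))"
      by (simp add: norm_mult norm_power abs_mult)
  qed
  have "f field_differentiable (at z)" if "z \<in> ?S" for z
    unfolding f_def[abs_def] field_differentiable_def
    using termdiffs_strong'[where K = "1 / Q", OF summ, of z] that by auto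
  then have hol: "f holomorphic_on ?S"
    by (auto simp: holomorphic_on_def intro: field_differentiable_at_within)
  have of_real: "f (of_real t) = of_real (pseries a t x)" if "\<bar>t\<bar> * Q < 1" for t
  proof -
    have "summable (\<lambda>n. a n x * t ^ n)" using that assms by (intro geom_bdd_summable) auto
    then have "(\<lambda>n. complex_of_real (a n x * t ^ n)) sums of_real (pseries a t x)"
      unfolding pseries_def by (intro sums_of_real summable_sums)
    then show ?thesis unfolding f_def by (simp add: sums_iff)
  qed
  have lt: "\<bar>t\<bar> * Q < 1" if "\<bar>t\<bar> \<le> r" for t
    using assms(2,4) mult_right_mono[OF that, of Q] by linarith
  show ?thesis
  proof (cases "f constant_on ?S")
    \<comment> \<open>The compactness argument needs a nonconstant function; a constant one equals
      its nonzero value at 0 and has no zeros.\<close>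
    case True
    then obtain c where c: "\<And>z. z \<in> ?S \<Longrightarrow> f z = c" unfolding constant_on_def by blast
    have "f 0 = of_real (a 0 x)" using of_real[of 0] by simp
    moreover have "f 0 = c" using assms by (intro c) simp
    ultimately have "c \<noteq> 0" using assms(3) by auto
    have "{t. \<bar>t\<bar> \<le> r \<and> pseries a t x = 0} = {}"
    proof safe
      fix t assume t: "\<bar>t\<bar> \<le> r" "pseries a t x = 0"
      then have "f (of_real t) = c" using assms lt by (intro c) (auto simp: field_simps)
      with of_real[OF lt[OF t(1)]] t(2) \<open>c \<noteq> 0\<close> show "t \<in> {}" by simp
    qed
    then show ?thesis by (simp only: finite.emptyI)
  next
    case False
    have "r < 1 / Q" using assms by (simp add: field_simps)
    then have "finite {z \<in> cball 0 r. f z = 0}"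
      using hol False by (intro holomorphic_compact_finite_zeros[where S = ?S]) auto
    moreover have "complex_of_real ` {t. \<bar>t\<bar> \<le> r \<and> pseries a t x = 0} \<subseteq> {z \<in> cball 0 r. f z = 0}"
      using of_real lt by auto
    ultimately have "finite (complex_of_real ` {t. \<bar>t\<bar> \<le> r \<and> pseries a t x = 0})"
      by (rule finite_subset[rotated])
    then show ?thesis by (rule finite_imageD) (auto simp: inj_on_def)
  qed
qed

section \<open>Integral operators with bounded kernels\<close>

definition kint :: "real measure \<Rightarrow> (real \<Rightarrow> real \<Rightarrow> real) \<Rightarrow> (real \<Rightarrow> real) \<Rightarrow> real \<Rightarrow> real" where
  "kint M k f x = (\<integral>z. k x z * f z \<partial>M)"

text \<open>One class covers both the primitive over labels up to \<open>x\<close> and the total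
  integral, so that measurability, summation and differentiation under the integral are proved
  once.\<close>

definition kernel :: "(real \<Rightarrow> real \<Rightarrow> real) \<Rightarrow> bool" where
  "kernel k \<longleftrightarrow> (\<lambda>(x, z). k x z) \<in> borel_measurable (borel \<Otimes>\<^sub>M borel) \<and> (\<forall>x z. \<bar>k x z\<bar> \<le> 1)"

locale fin_borel = finite_measure M for M :: "real measure" +
  assumes sets_M [measurable_cong, simp]: "sets M = sets borel"
begin

lemma space_M [simp]: "space M = UNIV"
  using sets_eq_imp_space_eq[OF sets_M] by simp

lemma bdd_integrable:
  assumes "f \<in> borel_measurable borel" "\<And>x. \<bar>f x\<bar> \<le> B"
  shows "integrable M (f :: real \<Rightarrow> real)"
  using assms by (intro integrable_const_bound[of _ B]) (auto simp: measurable_cong_sets[OF sets_M refl])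

lemma bdd_integral_le:
  assumes "f \<in> borel_measurable borel" "\<And>x. \<bar>f x\<bar> \<le> B"
  shows "\<bar>\<integral>x. (f x :: real) \<partial>M\<bar> \<le> B * measure M UNIV"
proof -
  have "\<bar>\<integral>x. f x \<partial>M\<bar> \<le> (\<integral>x. \<bar>f x\<bar> \<partial>M)" by (rule integral_abs_bound)
  also have "\<dots> \<le> (\<integral>x. B \<partial>M)"
    using assms bdd_integrable[OF assms] by (intro integral_mono) auto
  finally show ?thesis by (simp add: mult.commute)
qed

lemma kint_bound:
  assumes "kernel k" "f \<in> borel_measurable borel" "\<And>x. \<bar>f x\<bar> \<le> B"
  shows "\<bar>kint M k f x\<bar> \<le> B * measure M UNIV"
  unfolding kint_def
proof (rule bdd_integral_le)
  have [measurable]: "(\<lambda>(x, z). k x z) \<in> borel_measurable (borel \<Otimes>\<^sub>M borel)" "f \<in> borel_measurable borel"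
    using assms unfolding kernel_def by auto
  show "(\<lambda>z. k x z * f z) \<in> borel_measurable borel" by measurable
  show "\<bar>k x z * f z\<bar> \<le> B" for z
    using assms mult_mono[of "\<bar>k x z\<bar>" 1 "\<bar>f z\<bar>" B] unfolding kernel_def by (auto simp: abs_mult)
qed

lemma kint_measurable:
  assumes "kernel k" "f \<in> borel_measurable borel"
  shows "kint M k f \<in> borel_measurable borel"
proof -
  have [measurable]: "(\<lambda>(x, z). k x z) \<in> borel_measurable (borel \<Otimes>\<^sub>M borel)" "f \<in> borel_measurable borel"
    using assms unfolding kernel_def by auto
  show ?thesis unfolding kint_def[abs_def] by measurable
qed

lemma kint_measurable2:
  assumes "kernel k" "(\<lambda>(t, z). f t z) \<in> borel_measurable (borel \<Otimes>\<^sub>M borel)"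
  shows "(\<lambda>(t, x). kint M k (f t) x) \<in> borel_measurable (borel \<Otimes>\<^sub>M borel)"
proof -
  have [measurable]: "(\<lambda>(x, z). k x z) \<in> borel_measurable (borel \<Otimes>\<^sub>M borel)"
     "(\<lambda>(t, z). f t z) \<in> borel_measurable (borel \<Otimes>\<^sub>M borel)"
    using assms unfolding kernel_def by auto
  show ?thesis unfolding kint_def[abs_def] by measurable
qed

lemma geom_bdd_kint:
  assumes "kernel k" "geom_bdd Q a" "0 \<le> Q"
  shows "geom_bdd Q (\<lambda>n. kint M k (a n))"
proof -
  obtain A where A: "A \<ge> 0" "\<bar>a n x\<bar> \<le> A * Q ^ n" for n x using geom_bddE[OF assms(2)] by metis
  show ?thesis
    using kint_bound[OF assms(1) geom_bdd_measurable[OF assms(2)] A(2)]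
    by (intro geom_bddI[where A = "A * measure M UNIV"] kint_measurable assms geom_bdd_measurable[OF assms(2)])
       (auto simp: mult_ac)
qed

lemma pseries_kint:
  assumes "kernel k" "geom_bdd Q a" "0 \<le> Q" "\<bar>t\<bar> * Q < 1"
  shows "pseries (\<lambda>n. kint M k (a n)) t x = kint M k (pseries a t) x"
proof -
  obtain A where A: "A \<ge> 0" "\<bar>a n x\<bar> \<le> A * Q ^ n" for n x using geom_bddE[OF assms(2)] by metis
  have [measurable]: "(\<lambda>(x, z). k x z) \<in> borel_measurable (borel \<Otimes>\<^sub>M borel)" "a n \<in> borel_measurable borel" for n
    using assms unfolding kernel_def by auto
  have b: "\<bar>k x z * (a n z * t ^ n)\<bar> \<le> A * (\<bar>t\<bar> * Q) ^ n" for n z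
  proof -
    have "\<bar>k x z\<bar> * (\<bar>a n z\<bar> * \<bar>t\<bar> ^ n) \<le> 1 * ((A * Q ^ n) * \<bar>t\<bar> ^ n)"
      using assms(1) A assms(3) by (intro mult_mono) (auto simp: kernel_def)
    then show ?thesis by (simp add: abs_mult power_abs power_mult_distrib mult_ac)
  qed
  have int: "integrable M (\<lambda>z. k x z * (a n z * t ^ n))" for n
    by (rule bdd_integrable[OF _ b[of _ n]]) measurable
  have geo: "summable (\<lambda>n. A * (\<bar>t\<bar> * Q) ^ n)"
    using assms by (intro summable_mult summable_geometric) auto
  have sm: "summable (\<lambda>n. norm (k x z * (a n z * t ^ n)))" for z
    by (rule summable_comparison_test'[OF geo]) (use b in simp)
  have "(\<lambda>n. \<integral>z. k x z * (a n z * t ^ n) \<partial>M) sums (\<integral>z. (\<Sum>n. k x z * (a n z * t ^ n)) \<partial>M)"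
  proof (rule sums_integral[OF int])
    show "AE z in M. summable (\<lambda>n. norm (k x z * (a n z * t ^ n)))" using sm by simp
    show "summable (\<lambda>n. \<integral>z. norm (k x z * (a n z * t ^ n)) \<partial>M)"
    proof (rule summable_comparison_test')
      show "summable (\<lambda>n. A * (\<bar>t\<bar> * Q) ^ n * measure M UNIV)" by (intro summable_mult2 geo)
      show "norm (\<integral>z. norm (k x z * (a n z * t ^ n)) \<partial>M) \<le> A * (\<bar>t\<bar> * Q) ^ n * measure M UNIV" for n
        unfolding real_norm_def by (rule bdd_integral_le) (use b[of _ n] in \<open>auto\<close>)
    qed
  qed
  moreover have "(\<Sum>n. k x z * (a n z * t ^ n)) = k x z * pseries a t z" for z
    unfolding pseries_def using geom_bdd_summable[OF assms(2-4)] by (rule suminf_mult)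
  moreover have "(\<integral>z. k x z * (a n z * t ^ n) \<partial>M) = kint M k (a n) x * t ^ n" for n
    unfolding kint_def mult.assoc[symmetric] by simp
  ultimately show ?thesis unfolding pseries_def[of "\<lambda>n. kint M k (a n)"] kint_def[of M k "pseries a t"]
    by (simp add: sums_iff)
qed

text \<open>Differentiation under the integral is done on coefficients: both sides are power series,
  and the differentiated one has rate \<open>2 * Q\<close>, whence the condition on
  \<open>t\<close>.\<close>

lemma kint_pseries_deriv:
  assumes k: "kernel k" and a: "geom_bdd Q a" "0 < Q" "\<bar>t\<bar> * (2 * Q) < 1"
    and D: "\<And>z. ((\<lambda>s. pseries a s z) has_real_derivative D z) (at t)"
  shows "((\<lambda>s. kint M k (pseries a s) x) has_real_derivative kint M k D x) (at t)"
proof -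
  have lt: "\<bar>t\<bar> * Q < 1" using a mult_nonneg_nonneg[of "\<bar>t\<bar>" Q] by simp
  have "D = pseries (dcoeff a) t"
    using DERIV_unique[OF D pseries_deriv[OF a(1,2) lt]] by auto
  then have "kint M k D x = pseries (\<lambda>n. kint M k (dcoeff a n)) t x"
    using pseries_kint[OF k geom_bdd_dcoeff[OF a(1)], of t x] a by simp
  also have "(\<lambda>n. kint M k (dcoeff a n)) = dcoeff (\<lambda>n. kint M k (a n))"
    by (intro ext) (simp only: kint_def dcoeff_def mult.left_commute[of _ "real _"] integral_mult_right_zero)
  finally have *: "kint M k D x = pseries (dcoeff (\<lambda>n. kint M k (a n))) t x" .
  have "((\<lambda>s. pseries (\<lambda>n. kint M k (a n)) s x) has_real_derivative kint M k D x) (at t)"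
    unfolding * by (rule pseries_deriv[OF geom_bdd_kint[OF k a(1) less_imp_le[OF a(2)]] a(2) lt])
  then show ?thesis
  proof (rule has_field_derivative_transform_within_open)
    show "open {s. \<bar>s\<bar> * Q < 1}" by (intro open_Collect_less continuous_intros)
    show "pseries (\<lambda>n. kint M k (a n)) s x = kint M k (pseries a s) x" if "s \<in> {s. \<bar>s\<bar> * Q < 1}" for s
      using that a(2) by (intro pseries_kint[OF k a(1)]) simp_all
  qed (use lt in auto)
qed

end

section \<open>Integration by parts against an atomless measure\<close>

text \<open>A class closed under products and primitives in which every function is integrable
  against a finite measure. The densities at a fixed time live here, so integrability becomes a
  syntactic check.\<close>

definition bdd_meas :: "(real \<Rightarrow> real) \<Rightarrow> bool" where
  "bdd_meas f \<longleftrightarrow> f \<in> borel_measurable borel \<and> (\<exists>B. \<forall>x. \<bar>f x\<bar> \<le> B)"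

named_theorems bdd_meas_intros

lemma bdd_measI: "f \<in> borel_measurable borel \<Longrightarrow> (\<And>x. \<bar>f x\<bar> \<le> B) \<Longrightarrow> bdd_meas f"
  unfolding bdd_meas_def by blast

lemma bdd_meas_measurable [measurable_dest]: "bdd_meas f \<Longrightarrow> f \<in> borel_measurable borel"
  unfolding bdd_meas_def by blast

lemma bdd_measE:
  assumes "bdd_meas f" obtains B where "B \<ge> 0" "\<And>x. \<bar>f x\<bar> \<le> B"
  using assms unfolding bdd_meas_def by (meson abs_ge_zero order_trans)

lemma bdd_meas_const [bdd_meas_intros]: "bdd_meas (\<lambda>_. c)"
  by (rule bdd_measI[where B = "\<bar>c\<bar>"]) auto

lemma bdd_meas_add [bdd_meas_intros]: assumes "bdd_meas f" "bdd_meas g" shows "bdd_meas (\<lambda>x. f x + g x)"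
proof -
  obtain B C where "\<And>x. \<bar>f x\<bar> \<le> B" "\<And>x. \<bar>g x\<bar> \<le> C" using bdd_measE assms by metis
  then have "\<bar>f x + g x\<bar> \<le> B + C" for x by (meson abs_triangle_ineq add_mono order_trans)
  then show ?thesis using assms by (intro bdd_measI) auto
qed

lemma bdd_meas_mult [bdd_meas_intros]: assumes "bdd_meas f" "bdd_meas g" shows "bdd_meas (\<lambda>x. f x * g x)"
proof -
  obtain B C where "B \<ge> 0" "\<And>x. \<bar>f x\<bar> \<le> B" "\<And>x. \<bar>g x\<bar> \<le> C" using bdd_measE assms by metis
  then have "\<bar>f x * g x\<bar> \<le> B * C" for x unfolding abs_mult by (intro mult_mono) auto
  then show ?thesis using assms by (intro bdd_measI) auto
qed

lemma bdd_meas_minus [bdd_meas_intros]: "bdd_meas f \<Longrightarrow> bdd_meas (\<lambda>x. - f x)"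
  using bdd_meas_mult[OF bdd_meas_const[of "-1"], of f] by simp

lemma bdd_meas_diff [bdd_meas_intros]: "bdd_meas f \<Longrightarrow> bdd_meas g \<Longrightarrow> bdd_meas (\<lambda>x. f x - g x)"
  using bdd_meas_add[OF _ bdd_meas_minus, of f g] by simp

lemma bdd_meas_power [bdd_meas_intros]: "bdd_meas f \<Longrightarrow> bdd_meas (\<lambda>x. f x ^ n)"
  by (induction n) (auto intro: bdd_meas_intros)

lemma bdd_meas_indicator [bdd_meas_intros]: "A \<in> sets borel \<Longrightarrow> bdd_meas (indicator A)"
  by (rule bdd_measI[where B = 1]) (auto simp: indicator_def)

lemma pseries_bm:
  assumes "geom_bdd Q a" "0 \<le> Q" "\<bar>t\<bar> * Q \<le> 1/2"
  shows "bdd_meas (pseries a t)"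
proof -
  obtain A where A: "\<bar>a n x\<bar> \<le> A * Q ^ n" for n x using geom_bddE[OF assms(1)] by metis
  have [measurable]: "a n \<in> borel_measurable borel" for n using assms by auto
  show ?thesis
    by (rule bdd_measI[OF _ pseries_bound(1)[where a = a and A = A, OF A assms(2,3)]]) measurable
qed

definition ker_le :: "real \<Rightarrow> real \<Rightarrow> real" where "ker_le x z = indicator {..x} z"
definition K1 :: "real \<Rightarrow> real \<Rightarrow> real" where "K1 x z = 1"

lemma kernel_ker_le: "kernel ker_le"
proof -
  have "(\<lambda>(x::real, z). if z \<le> x then 1 else 0 :: real) \<in> borel_measurable (borel \<Otimes>\<^sub>M borel)"
    by measurable
  moreover have "(\<lambda>(x, z). ker_le x z) = (\<lambda>(x, z). if z \<le> x then 1 else 0)"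
    by (auto simp: ker_le_def indicator_def)
  ultimately have "(\<lambda>(x, z). ker_le x z) \<in> borel_measurable (borel \<Otimes>\<^sub>M borel)" by (simp only:)
  moreover have "\<forall>x z. \<bar>ker_le x z\<bar> \<le> 1" by (simp add: ker_le_def indicator_def)
  ultimately show ?thesis unfolding kernel_def ..
qed

lemma kernel_K1: "kernel K1"
  unfolding kernel_def K1_def by auto

context fin_borel begin

lemma bdd_meas_integrable: "bdd_meas f \<Longrightarrow> integrable M f"
  unfolding bdd_meas_def using bdd_integrable by blast

lemma bdd_meas_kint [bdd_meas_intros]: "kernel k \<Longrightarrow> bdd_meas f \<Longrightarrow> bdd_meas (kint M k f)"
  unfolding bdd_meas_def using kint_bound kint_measurable by meson

lemma kint_K1: "kint M K1 f x = (\<integral>z. f z \<partial>M)"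
  unfolding kint_def K1_def by simp

lemma kint_ker_le: "kint M ker_le f x = (\<integral>z. indicator {..x} z * f z \<partial>M)"
  unfolding kint_def ker_le_def by simp

lemma bdd_Fubini:
  fixes f :: "real \<Rightarrow> real \<Rightarrow> real"
  assumes N: "fin_borel N" and meas: "(\<lambda>(x, z). f x z) \<in> borel_measurable (borel \<Otimes>\<^sub>M borel)"
    and bd: "\<And>x z. \<bar>f x z\<bar> \<le> B"
  shows "(\<integral>x. (\<integral>z. f x z \<partial>N) \<partial>M) = (\<integral>z. (\<integral>x. f x z \<partial>M) \<partial>N)"
proof -
  interpret N: fin_borel N by fact
  interpret P: pair_sigma_finite M N by standard
  interpret finite_measure "M \<Otimes>\<^sub>M N"
    by (intro finite_measure_pair_measure) (auto intro: finite_measure_axioms N.finite_measure_axioms)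
  have s: "sets (M \<Otimes>\<^sub>M N) = sets (borel \<Otimes>\<^sub>M borel)" by (rule sets_pair_measure_cong) auto
  have "integrable (M \<Otimes>\<^sub>M N) (\<lambda>(x, z). f x z)"
    using meas bd by (intro integrable_const_bound[of _ B]) (auto simp: measurable_cong_sets[OF s refl])
  from P.Fubini_integral[OF this] show ?thesis by simp
qed

end

locale noatom = fin_borel +
  assumes noatom: "emeasure M {x} = 0"
begin

text \<open>Fubini on the square of labels: exchanging the order of integration turns the primitive
  of \<open>f\<close> into a tail integral of \<open>g\<close>, and the tail is the total minus the
  primitive because the shared endpoint has no mass.\<close>

lemma parts_base:
  assumes f: "bdd_meas f" and g: "bdd_meas g"
  shows "(\<integral>z. f z * kint M ker_le g z + kint M ker_le f z * g z \<partial>M) = (\<integral>z. f z \<partial>M) * (\<integral>z. g z \<partial>M)"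
proof -
  note [measurable] = bdd_meas_measurable[OF f] bdd_meas_measurable[OF g]
  note km = kernel_ker_le[unfolded kernel_def, THEN conjunct1, measurable]
  note int = bdd_meas_integrable bdd_meas_intros f g kernel_ker_le
  obtain B where B: "B \<ge> 0" "\<And>x. \<bar>f x\<bar> \<le> B" using bdd_measE[OF f] by metis
  obtain C where C: "C \<ge> 0" "\<And>x. \<bar>g x\<bar> \<le> C" using bdd_measE[OF g] by metis
  have "\<bar>ker_le z w * (f w * g z)\<bar> \<le> 1 * (B * C)" for z w
    using B C unfolding abs_mult by (intro mult_mono) (auto simp: ker_le_def indicator_def)
  then have "(\<integral>z. (\<integral>w. ker_le z w * (f w * g z) \<partial>M) \<partial>M) = (\<integral>w. (\<integral>z. ker_le z w * (f w * g z) \<partial>M) \<partial>M)"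
    by (intro bdd_Fubini[OF fin_borel_axioms, of _ "1 * (B * C)"]) measurable
  moreover have "(\<integral>w. ker_le z w * (f w * g z) \<partial>M) = kint M ker_le f z * g z" for z
    unfolding kint_def mult.assoc[symmetric] by simp
  moreover have "(\<integral>z. ker_le z w * (f w * g z) \<partial>M) = f w * (\<integral>z. indicator {w..} z * g z \<partial>M)" for w
  proof -
    have "(\<integral>z. ker_le z w * (f w * g z) \<partial>M) = (\<integral>z. f w * (indicator {w..} z * g z) \<partial>M)"
      by (intro Bochner_Integration.integral_cong refl) (auto simp: ker_le_def indicator_def)
    then show ?thesis by simp
  qed
  ultimately have 1: "(\<integral>z. kint M ker_le f z * g z \<partial>M) = (\<integral>w. f w * (\<integral>z. indicator {w..} z * g z \<partial>M) \<partial>M)"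
    by simp
  have 2: "(\<integral>z. indicator {w..} z * g z \<partial>M) = (\<integral>z. g z \<partial>M) - kint M ker_le g w" for w
  proof -
    \<comment> \<open>The half-lines \<open>{w..}\<close> and \<open>{..w}\<close> overlap in the
      single point \<open>w\<close>; here the absence of atoms enters.\<close>
    have "AE z in M. z \<noteq> w"
      by (rule AE_I[where N = "{w}"]) (auto simp: noatom)
    then have "(\<integral>z. indicator {w..} z * g z \<partial>M) = (\<integral>z. g z - indicator {..w} z * g z \<partial>M)"
    proof (intro integral_cong_AE)
      show "AE z in M. indicator {w..} z * g z = g z - indicator {..w} z * g z"
        by (rule eventually_mono[OF \<open>AE z in M. z \<noteq> w\<close>]) (simp add: indicator_def)
    qed measurable
    also have "\<dots> = (\<integral>z. g z \<partial>M) - kint M ker_le g w"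
      unfolding kint_ker_le by (intro Bochner_Integration.integral_diff int) simp
    finally show ?thesis .
  qed
  have "(\<integral>z. kint M ker_le f z * g z \<partial>M) = (\<integral>w. f w * (\<integral>z. g z \<partial>M) - f w * kint M ker_le g w \<partial>M)"
    unfolding 1 2 by (simp add: right_diff_distrib)
  also have "\<dots> = (\<integral>w. f w \<partial>M) * (\<integral>z. g z \<partial>M) - (\<integral>w. f w * kint M ker_le g w \<partial>M)"
  proof -
    have "integrable M (\<lambda>w. f w * (\<integral>z. g z \<partial>M))" "integrable M (\<lambda>w. f w * kint M ker_le g w)"
      by (intro int)+
    then show ?thesis by simp
  qed
  finally have 3: "(\<integral>z. kint M ker_le f z * g z \<partial>M)
      = (\<integral>w. f w \<partial>M) * (\<integral>z. g z \<partial>M) - (\<integral>w. f w * kint M ker_le g w \<partial>M)" .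
  have "integrable M (\<lambda>w. f w * kint M ker_le g w)" "integrable M (\<lambda>w. kint M ker_le f w * g w)"
    by (intro int)+
  then show ?thesis using 3 by simp
qed

text \<open>Restriction to a down-closed \<open>A\<close> is invisible to primitives at points of
  \<open>A\<close>, so truncated functions reduce the claim to \<open>parts_base\<close>. A
  half-line gives the primitive of a product rule, the whole line its total with boundary
  terms.\<close>

lemma parts_set:
  assumes f: "bdd_meas f" and g: "bdd_meas g" and A: "A \<in> sets borel" "\<And>w z. w \<le> z \<Longrightarrow> z \<in> A \<Longrightarrow> w \<in> A"
  shows "(\<integral>z. indicator A z * (f z * (G0 + kint M ker_le g z) + (F0 + kint M ker_le f z) * g z) \<partial>M)
     = (F0 + (\<integral>z. indicator A z * f z \<partial>M)) * (G0 + (\<integral>z. indicator A z * g z \<partial>M)) - F0 * G0"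
proof -
  note int = bdd_meas_integrable bdd_meas_intros f g kernel_ker_le A(1)
  define f' g' where "f' z = indicator A z * f z" and "g' z = indicator A z * g z" for z
  have fg': "bdd_meas f'" "bdd_meas g'" unfolding f'_def[abs_def] g'_def[abs_def] by (intro int)+
  have k: "kint M ker_le f' z = kint M ker_le f z" "kint M ker_le g' z = kint M ker_le g z" if "z \<in> A" for z
    unfolding kint_ker_le f'_def g'_def
    using A(2)[OF _ that] by (auto intro!: Bochner_Integration.integral_cong simp: indicator_def)
  have "(\<integral>z. indicator A z * (f z * (G0 + kint M ker_le g z) + (F0 + kint M ker_le f z) * g z) \<partial>M)
     = (\<integral>z. G0 * f' z + F0 * g' z + (f' z * kint M ker_le g' z + kint M ker_le f' z * g' z) \<partial>M)"
    by (intro Bochner_Integration.integral_cong refl)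
       (auto simp: f'_def g'_def indicator_def k algebra_simps)
  also have "\<dots> = G0 * (\<integral>z. f' z \<partial>M) + F0 * (\<integral>z. g' z \<partial>M) + (\<integral>z. f' z \<partial>M) * (\<integral>z. g' z \<partial>M)"
  proof -
    have i: "integrable M (\<lambda>z. G0 * f' z)" "integrable M (\<lambda>z. F0 * g' z)"
      "integrable M (\<lambda>z. f' z * kint M ker_le g' z + kint M ker_le f' z * g' z)"
      by (intro int fg')+
    show ?thesis
      unfolding parts_base[OF fg', symmetric]
        Bochner_Integration.integral_add[OF Bochner_Integration.integrable_add[OF i(1,2)] i(3)]
        Bochner_Integration.integral_add[OF i(1,2)] by simp
  qed
  finally show ?thesis unfolding f'_def g'_def by (simp add: algebra_simps)
qed

lemma parts_le:
  assumes "bdd_meas f" "bdd_meas g" "\<And>z. F z = F0 + kint M ker_le f z" "\<And>z. G z = G0 + kint M ker_le g z"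
  shows "kint M ker_le (\<lambda>z. f z * G z + F z * g z) x = F x * G x - F0 * G0"
  using parts_set[OF assms(1,2), of "{..x}" G0 F0] assms(3,4) by (simp add: kint_ker_le)

lemma parts_all:
  assumes "bdd_meas f" "bdd_meas g" "\<And>z. F z = F0 + kint M ker_le f z" "\<And>z. G z = G0 + kint M ker_le g z"
  shows "(\<integral>z. f z * G z + F z * g z \<partial>M)
    = (F0 + (\<integral>z. f z \<partial>M)) * (G0 + (\<integral>z. g z \<partial>M)) - F0 * G0"
  using parts_set[OF assms(1,2), of UNIV G0 F0] assms(3,4) by simp

end

section \<open>Gronwall's inequality, recursion on histories, convolution weights\<close>

lemma gronwall_zero:
  fixes D :: "real \<Rightarrow> real"
  assumes "D 0 = 0" "\<And>t. D t \<ge> 0"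
    and der: "\<And>t. 0 \<le> t \<Longrightarrow> t \<le> s \<Longrightarrow> (D has_real_derivative D' t) (at t)"
    and le: "\<And>t. 0 \<le> t \<Longrightarrow> t \<le> s \<Longrightarrow> D' t \<le> K * D t"
    and t: "0 \<le> t" "t \<le> s"
  shows "D t = 0"
proof -
  have "D t * exp (- K * t) \<le> D 0 * exp (- K * 0)"
  proof (rule DERIV_nonpos_imp_nonincreasing[OF t(1)])
    fix r assume r: "0 \<le> r" "r \<le> t"
    have "((\<lambda>r. D r * exp (- K * r)) has_real_derivative (D' r - K * D r) * exp (- K * r)) (at r)"
      by (rule derivative_eq_intros der refl | use r t in \<open>simp add: algebra_simps\<close>)+
    moreover have "(D' r - K * D r) * exp (- K * r) \<le> 0"
      using le[of r] r t by (intro mult_nonpos_nonneg) auto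
    ultimately show "\<exists>y. ((\<lambda>r. D r * exp (- K * r)) has_real_derivative y) (at r) \<and> y \<le> 0" by blast
  qed
  then have "D t \<le> 0" using assms(1) by (simp add: mult_le_0_iff)
  then show ?thesis using assms(2)[of t] by simp
qed

text \<open>Course-of-values recursion: each step may read all earlier values. It is run on whole
  histories, whose entries beyond the present index hold the filler \<open>z0\<close>; by
  \<open>loc\<close> these are never read.\<close>

lemma history_recursion:
  fixes st :: "nat \<Rightarrow> (nat \<Rightarrow> 'a) \<Rightarrow> 'a"
  assumes loc: "\<And>n f g. (\<And>i. i \<le> n \<Longrightarrow> f i = g i) \<Longrightarrow> st n f = st n g"
  shows "\<exists>Z. Z 0 = z0 \<and> (\<forall>n. Z (Suc n) = st n Z)"
proof -
  define H where "H = rec_nat (\<lambda>_. z0) (\<lambda>n F. F(Suc n := st n F))"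
  have H: "H 0 = (\<lambda>_. z0)" "H (Suc n) = (H n)(Suc n := st n (H n))" for n
    by (simp_all add: H_def)
  have stable: "H (i + k) i = H i i" for i k by (induction k) (auto simp: H)
  then have stable': "H n i = H i i" if "i \<le> n" for n i using that by (metis le_Suc_ex)
  have "H (Suc n) (Suc n) = st n (\<lambda>i. H i i)" for n
    using loc[of n "H n" "\<lambda>i. H i i", OF stable'] by (simp add: H)
  then show ?thesis by (intro exI[of _ "\<lambda>n. H n n"]) (simp add: H)
qed

text \<open>The division by \<open>(n + 1)^2\<close> makes the sequence stable under convolution up
  to a constant. A plain geometric majorant would not close the recursion: the coefficient of
  \<open>U\<close> contains one convolution through its additive constant, a second comes from the
  products, and the single division by \<open>n + 1\<close> absorbs only one of them.\<close>

definition weight :: "real \<Rightarrow> nat \<Rightarrow> real" where "weight R n = R ^ n / (real n + 1)\<^sup>2"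

lemma sum_inverse_squares: "(\<Sum>i\<le>n. 1 / (real i + 1)\<^sup>2) \<le> 2 - 1 / (real n + 1)"
proof (induction n)
  case (Suc n)
  have "1 / (real n + 2)\<^sup>2 \<le> 1 / ((real n + 1) * (real n + 2))"
    by (intro divide_left_mono) (auto simp: power2_eq_square intro!: mult_mono mult_pos_pos)
  also have "\<dots> = 1 / (real n + 1) - 1 / (real n + 2)"
    by (simp add: divide_simps)
  finally have "1 / (real n + 2)\<^sup>2 \<le> 1 / (real n + 1) - 1 / (real n + 2)" .
  with Suc show ?case by (simp add: add_ac)
qed simp

text \<open>From 1/(ab) = (1/a + 1/b)/(a + b) with a = i + 1, b = n - i + 1.\<close>
lemma weight_conv:
  assumes "0 \<le> R"
  shows "(\<Sum>i\<le>n. weight R i * weight R (n - i)) \<le> 8 * weight R n"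
proof -
  have *: "weight R i * weight R (n - i)
     \<le> R ^ n / (real n + 1)\<^sup>2 * (2 * (1 / (real i + 1)\<^sup>2 + 1 / (real (n - i) + 1)\<^sup>2))" if "i \<le> n" for i
  proof -
    define a b where "a = real i + 1" and "b = real (n - i) + 1"
    have ab: "a > 0" "b > 0" "a + b = real n + 2" using that by (auto simp: a_def b_def of_nat_diff)
    have "1 / (a * b) = (1 / a + 1 / b) / (a + b)"
      using ab(1,2) by (simp add: divide_simps)
    then have "(1 / (a * b))\<^sup>2 = ((1 / a + 1 / b) / (a + b))\<^sup>2" by simp
    then have "1 / (a\<^sup>2 * b\<^sup>2) = (1 / a + 1 / b)\<^sup>2 / (a + b)\<^sup>2"
      by (simp add: power_divide power_mult_distrib)
    also have "\<dots> \<le> (2 * (1 / a\<^sup>2 + 1 / b\<^sup>2)) / (real n + 1)\<^sup>2"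
    proof (rule frac_le)
      have "0 \<le> (1 / a - 1 / b)\<^sup>2" by simp
      then show "(1 / a + 1 / b)\<^sup>2 \<le> 2 * (1 / a\<^sup>2 + 1 / b\<^sup>2)"
        by (simp add: power2_eq_square algebra_simps)
      show "(real n + 1)\<^sup>2 \<le> (a + b)\<^sup>2" using ab by (simp add: power_mono)
    qed auto
    finally have "R ^ n * (1 / (a\<^sup>2 * b\<^sup>2)) \<le> R ^ n * ((2 * (1 / a\<^sup>2 + 1 / b\<^sup>2)) / (real n + 1)\<^sup>2)"
      using assms by (intro mult_left_mono) auto
    moreover have "R ^ i * R ^ (n - i) = R ^ n" using that by (simp flip: power_add)
    ultimately show ?thesis unfolding weight_def a_def[symmetric] b_def[symmetric]
      by (simp add: field_simps)
  qed
  have "(\<Sum>i\<le>n. weight R i * weight R (n - i))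
     \<le> (\<Sum>i\<le>n. R ^ n / (real n + 1)\<^sup>2 * (2 * (1 / (real i + 1)\<^sup>2 + 1 / (real (n - i) + 1)\<^sup>2)))"
    by (intro sum_mono *) auto
  also have "\<dots> = R ^ n / (real n + 1)\<^sup>2 * (2 * ((\<Sum>i\<le>n. 1 / (real i + 1)\<^sup>2) + (\<Sum>i\<le>n. 1 / (real (n - i) + 1)\<^sup>2)))"
    by (simp only: sum_distrib_left[symmetric] sum.distrib)
  also have "(\<Sum>i\<le>n. 1 / (real (n - i) + 1)\<^sup>2) = (\<Sum>i\<le>n. 1 / (real i + 1)\<^sup>2)"
    by (rule sum.reindex_bij_witness[of _ "\<lambda>i. n - i" "\<lambda>i. n - i"]) auto
  \<comment> \<open>Each sum is at most 2, so the constant is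
    \<open>2 * (2 + 2) = 8\<close>.\<close>
  also have "R ^ n / (real n + 1)\<^sup>2 * (2 * ((\<Sum>i\<le>n. 1 / (real i + 1)\<^sup>2) + (\<Sum>i\<le>n. 1 / (real i + 1)\<^sup>2)))
     \<le> R ^ n / (real n + 1)\<^sup>2 * 8"
  proof (intro mult_left_mono)
    have "1 / (real n + 1) \<ge> 0" by simp
    then show "2 * ((\<Sum>i\<le>n. 1 / (real i + 1)\<^sup>2) + (\<Sum>i\<le>n. 1 / (real i + 1)\<^sup>2)) \<le> 8"
      using order_trans[OF sum_inverse_squares[of n], of 2] by simp
  qed (use assms in auto)
  finally show ?thesis by (simp add: weight_def mult.commute)
qed

lemma conv_weight:
  assumes "0 \<le> R" "0 \<le> A" "0 \<le> B" "\<And>i. i \<le> n \<Longrightarrow> \<bar>a i x\<bar> \<le> A * weight R i" "\<And>i. i \<le> n \<Longrightarrow> \<bar>b i x\<bar> \<le> B * weight R i"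
  shows "\<bar>conv a b n x\<bar> \<le> 8 * A * B * weight R n"
proof -
  have w: "weight R i \<ge> 0" for i using assms(1) by (simp add: weight_def)
  have "\<bar>conv a b n x\<bar> \<le> (\<Sum>i\<le>n. \<bar>a i x\<bar> * \<bar>b (n - i) x\<bar>)"
    unfolding conv_def abs_mult[symmetric] by (rule sum_abs)
  also have "\<dots> \<le> (\<Sum>i\<le>n. (A * weight R i) * (B * weight R (n - i)))"
    using assms w by (intro sum_mono mult_mono) auto
  also have "\<dots> = A * B * (\<Sum>i\<le>n. weight R i * weight R (n - i))"
    by (simp add: sum_distrib_left mult_ac)
  also have "\<dots> \<le> A * B * (8 * weight R n)"
    using assms by (intro mult_left_mono weight_conv) auto
  finally show ?thesis by (simp add: mult_ac)
qed

text \<open>Passing from n to n + 1 costs the ratio \<open>(n + 2)^2 / (n + 1)^2\<close>, which is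
  at most 4; the factor \<open>1 / (n + 1)\<close> from integrating in time is simply bounded by
  1.\<close>

lemma weight_step:
  assumes "0 \<le> L" "4 * L \<le> R"
  shows "L * weight R n / (real n + 1) \<le> weight R (Suc n)"
proof -
  have R0: "R \<ge> 0" using assms by simp
  have "(real n + 2)\<^sup>2 \<le> 4 * (real n + 1)\<^sup>2" by (simp add: power2_eq_square algebra_simps)
  also have "4 * (real n + 1)\<^sup>2 \<le> 4 * ((real n + 1)\<^sup>2 * (real n + 1))" by (simp add: algebra_simps)
  finally have "L * (real n + 2)\<^sup>2 \<le> L * (4 * ((real n + 1)\<^sup>2 * (real n + 1)))"
    using assms(1) by (intro mult_left_mono) auto
  also have "\<dots> = (4 * L) * ((real n + 1)\<^sup>2 * (real n + 1))" by simp
  also have "\<dots> \<le> R * ((real n + 1)\<^sup>2 * (real n + 1))"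
    using assms by (intro mult_right_mono) auto
  finally have *: "L * (real n + 2)\<^sup>2 \<le> R * ((real n + 1)\<^sup>2 * (real n + 1))" .
  have "L / ((real n + 1)\<^sup>2 * (real n + 1)) \<le> R / (real n + 2)\<^sup>2"
  proof (subst frac_le_eq)
    show "(real n + 1)\<^sup>2 * (real n + 1) \<noteq> 0" "(real n + 2)\<^sup>2 \<noteq> 0" by auto
    show "(L * (real n + 2)\<^sup>2 - R * ((real n + 1)\<^sup>2 * (real n + 1))) / ((real n + 1)\<^sup>2 * (real n + 1) * (real n + 2)\<^sup>2) \<le> 0"
      using * by (intro divide_nonpos_nonneg) auto
  qed
  then have "R ^ n * (L / ((real n + 1)\<^sup>2 * (real n + 1))) \<le> R ^ n * (R / (real n + 2)\<^sup>2)"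
    using R0 by (intro mult_left_mono) auto
  then show ?thesis by (simp add: weight_def mult_ac add_ac)
qed

section \<open>The Lagrangian system\<close>

text \<open>Coefficients of the antiderivative in \<open>t\<close> that vanishes at time 0; it
  produces the base point of the flow.\<close>

definition icoeff :: "(nat \<Rightarrow> 'a \<Rightarrow> real) \<Rightarrow> nat \<Rightarrow> 'a \<Rightarrow> real" where
  "icoeff a n x = (if n = 0 then 0 else a (n - 1) x / real n)"

lemma dcoeff_icoeff [simp]: "dcoeff (icoeff a) = a"
  by (auto simp: fun_eq_iff dcoeff_def icoeff_def)

lemma geom_bdd_icoeff:
  assumes "geom_bdd Q a" "0 < Q"
  shows "geom_bdd Q (icoeff a)"
proof -
  obtain A where A: "A \<ge> 0" "\<bar>a n x\<bar> \<le> A * Q ^ n" for n x using geom_bddE[OF assms(1)] by metis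
  have [measurable]: "a n \<in> borel_measurable borel" for n using assms by auto
  show ?thesis
  proof (rule geom_bddI[where A = "A / Q"])
    show "icoeff a n \<in> borel_measurable borel" for n unfolding icoeff_def[abs_def] by (cases n) simp_all
    show "\<bar>icoeff a n x\<bar> \<le> A / Q * Q ^ n" for n x
    proof (cases n)
      case 0 then show ?thesis using A assms(2) by (simp add: icoeff_def)
    next
      case (Suc k)
      have "\<bar>a k x / (1 + real k)\<bar> \<le> \<bar>a k x\<bar>" by (simp add: divide_le_eq mult_le_cancel_left1)
      also have "\<dots> \<le> A * Q ^ k" by (rule A)
      finally show ?thesis using Suc assms(2) by (simp add: icoeff_def)
    qed
  qed
qed

text \<open>Bound for the coefficients of \<open>U\<close> relative to \<open>weight\<close>. The
  first \<open>1 + h\<close> is the mass of the label measure and bounds the primitive of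
  \<open>v\<close>. The fraction bounds the additive constant: 16 is the 8 of
  \<open>weight_conv\<close> times the 2 that bounds \<open>y - e\<close>, one factor
  \<open>1 + h\<close> comes from the primitive and the other from integrating it.\<close>

definition vel_bound :: "real \<Rightarrow> real \<Rightarrow> real" where
  "vel_bound h m = (1 + h) + (\<bar>m\<bar> + 16 * (1 + h)\<^sup>2) / \<bar>1 - h\<bar>"

text \<open>Along the characteristics \<open>Y_t = - u^2(t, Y)\<close> the densities of \<open>dx\<close>, \<open>du\<close> and \<open>u_x^2 dx\<close>
  with respect to the fixed measure \<open>M\<close> are \<open>y\<close>, \<open>v\<close>, \<open>e\<close>, and \<open>U = u(t, Y)\<close>. Energy concentrates
  where \<open>y = 0\<close>. The constant \<open>m\<close> is the conserved mean of \<open>u - u u_x^2\<close>.\<close>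

locale lagrangian = noatom M for M :: "real measure" +
  fixes s h m B :: real and y v e U Y :: "real \<Rightarrow> real \<Rightarrow> real" and C X :: "real \<Rightarrow> real"
  assumes s: "0 < s" and h: "0 \<le> h" "h \<noteq> 1"
    and meas: "(\<lambda>(t, x). y t x) \<in> borel_measurable (borel \<Otimes>\<^sub>M borel)"
      "(\<lambda>(t, x). v t x) \<in> borel_measurable (borel \<Otimes>\<^sub>M borel)"
      "(\<lambda>(t, x). e t x) \<in> borel_measurable (borel \<Otimes>\<^sub>M borel)"
      "(\<lambda>(t, x). U t x) \<in> borel_measurable (borel \<Otimes>\<^sub>M borel)"
      "(\<lambda>(t, x). Y t x) \<in> borel_measurable (borel \<Otimes>\<^sub>M borel)"
      "X \<in> borel_measurable borel"
    and bd: "\<And>t x. 0 \<le> t \<Longrightarrow> t \<le> s \<Longrightarrow> \<bar>y t x\<bar> \<le> B" "\<And>t x. 0 \<le> t \<Longrightarrow> t \<le> s \<Longrightarrow> \<bar>v t x\<bar> \<le> B"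
      "\<And>t x. 0 \<le> t \<Longrightarrow> t \<le> s \<Longrightarrow> \<bar>e t x\<bar> \<le> B" "\<And>t x. 0 \<le> t \<Longrightarrow> t \<le> s \<Longrightarrow> \<bar>U t x\<bar> \<le> B"
      "\<And>t. 0 \<le> t \<Longrightarrow> t \<le> s \<Longrightarrow> \<bar>X t\<bar> \<le> B"
    and Ub: "\<And>t x. 0 \<le> t \<Longrightarrow> t \<le> s \<Longrightarrow> \<bar>U t x\<bar> \<le> 2 * vel_bound h m"
    and pos: "\<And>t x. 0 \<le> t \<Longrightarrow> t \<le> s \<Longrightarrow> 0 \<le> y t x" "\<And>t x. 0 \<le> t \<Longrightarrow> t \<le> s \<Longrightarrow> 0 \<le> e t x"
    and rel: "\<And>t x. 0 \<le> t \<Longrightarrow> t \<le> s \<Longrightarrow> y t x * e t x = (v t x)\<^sup>2"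
    and U_eq: "\<And>t x. 0 \<le> t \<Longrightarrow> t \<le> s \<Longrightarrow> U t x = C t + kint M ker_le (v t) x"
    and Y_eq: "\<And>t x. 0 \<le> t \<Longrightarrow> t \<le> s \<Longrightarrow> Y t x = X t + kint M ker_le (y t) x"
    and tot: "\<And>t. 0 \<le> t \<Longrightarrow> t \<le> s \<Longrightarrow> (\<integral>z. v t z \<partial>M) = 0" "\<And>t. 0 \<le> t \<Longrightarrow> t \<le> s \<Longrightarrow> (\<integral>z. y t z \<partial>M) = 1"
      "\<And>t. 0 \<le> t \<Longrightarrow> t \<le> s \<Longrightarrow> (\<integral>z. e t z \<partial>M) = h"
      "\<And>t. 0 \<le> t \<Longrightarrow> t \<le> s \<Longrightarrow> (\<integral>z. U t z * (y t z - e t z) \<partial>M) = m"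
    and der: "\<And>t x. 0 \<le> t \<Longrightarrow> t \<le> s \<Longrightarrow> ((\<lambda>t. y t x) has_real_derivative - 2 * (U t x * v t x)) (at t)"
      "\<And>t x. 0 \<le> t \<Longrightarrow> t \<le> s \<Longrightarrow> ((\<lambda>t. v t x) has_real_derivative U t x * (y t x - e t x) - m * y t x) (at t)"
      "\<And>t x. 0 \<le> t \<Longrightarrow> t \<le> s \<Longrightarrow> ((\<lambda>t. e t x) has_real_derivative 2 * (U t x * v t x - m * v t x)) (at t)"
      "\<And>t x. 0 \<le> t \<Longrightarrow> t \<le> s \<Longrightarrow> ((\<lambda>t. Y t x) has_real_derivative - (U t x)\<^sup>2) (at t)"
      "\<And>t x. 0 \<le> t \<Longrightarrow> t \<le> s \<Longrightarrow> ((\<lambda>t. U t x) has_real_derivative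
          kint M ker_le (\<lambda>z. U t z * (y t z - e t z) - m * y t z) x
          - (\<integral>z. kint M ker_le (\<lambda>z. U t z * (y t z - e t z) - m * y t z) z * (y t z - e t z) \<partial>M) / (1 - h)) (at t)"
    and aepos: "AE t in lborel. 0 \<le> t \<and> t \<le> s \<longrightarrow> (AE x in M. 0 < y t x)"

definition coeff_diff :: "(nat \<Rightarrow> real \<Rightarrow> real) \<Rightarrow> (nat \<Rightarrow> real \<Rightarrow> real) \<Rightarrow> nat \<Rightarrow> real \<Rightarrow> real" where
  "coeff_diff y e n x = y n x - e n x"

definition vint :: "real measure \<Rightarrow> (nat \<Rightarrow> real \<Rightarrow> real) \<Rightarrow> nat \<Rightarrow> real \<Rightarrow> real" where
  "vint M v n = kint M ker_le (v n)"

text \<open>The additive constant of \<open>U\<close> is not evolved by an equation of its own but read off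
  from conservation of the integral of \<open>U (y - e)\<close>; this is where \<open>h \<noteq> 1\<close> enters.\<close>

definition ccoef where
  "ccoef M h m y v e n =
     ((if n = 0 then m else 0) - (\<integral>z. conv (vint M v) (coeff_diff y e) n z \<partial>M)) / (1 - h)"

definition ucoef where
  "ucoef M h m y v e n x = ccoef M h m y v e n + vint M v n x"

text \<open>\<open>16 * vel_bound h m + 2 * \<bar>m\<bar>\<close> dominates the right-hand sides of
  the three recursions, and 4 is the loss in \<open>weight_step\<close>.\<close>

definition conv_rate :: "real \<Rightarrow> real \<Rightarrow> real" where
  "conv_rate h m = 4 * (16 * vel_bound h m + 2 * \<bar>m\<bar>) + 1"

text \<open>Depends on \<open>h\<close> and \<open>m\<close> only, so that the construction can be restarted indefinitely.\<close>

definition time_step :: "real \<Rightarrow> real \<Rightarrow> real" where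
  "time_step h m = 1 / (16 * conv_rate h m)"

text \<open>The recursion is the differential system read off coefficient by coefficient. Totals and
  the quadratic relation are assumed for the initial coefficients alone; their persistence is
  proved.\<close>

locale lagrangian_series = noatom M for M :: "real measure" +
  fixes h m :: real and y v e :: "nat \<Rightarrow> real \<Rightarrow> real"
  assumes h: "0 \<le> h" "h \<noteq> 1"
    and meas0: "y 0 \<in> borel_measurable borel" "v 0 \<in> borel_measurable borel" "e 0 \<in> borel_measurable borel"
    and pos0: "\<And>x. 0 < y 0 x" "\<And>x. 0 \<le> e 0 x"
    and rel0: "\<And>x. y 0 x + e 0 x = 1" "\<And>x. y 0 x * e 0 x = (v 0 x)\<^sup>2"
    and tot0: "(\<integral>z. v 0 z \<partial>M) = 0" "(\<integral>z. y 0 z \<partial>M) = 1" "(\<integral>z. e 0 z \<partial>M) = h"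
    and rec: "\<And>n x. y (Suc n) x = - 2 * conv (ucoef M h m y v e) v n x / (real n + 1)"
      "\<And>n x. v (Suc n) x = (conv (ucoef M h m y v e) (coeff_diff y e) n x - m * y n x) / (real n + 1)"
      "\<And>n x. e (Suc n) x = 2 * (conv (ucoef M h m y v e) v n x - m * v n x) / (real n + 1)"
begin

section \<open>Convergence of the coefficient recursion\<close>

abbreviation "c \<equiv> ccoef M h m y v e"
abbreviation "u \<equiv> ucoef M h m y v e"
abbreviation "V \<equiv> vint M v"
abbreviation "d \<equiv> coeff_diff y e"
abbreviation "R \<equiv> conv_rate h m"

lemma vel_bound_pos: "1 \<le> vel_bound h m" and R0: "0 < R"
proof -
  have "0 \<le> (\<bar>m\<bar> + 16 * (1 + h)\<^sup>2) / \<bar>1 - h\<bar>" by simp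
  then show "1 \<le> vel_bound h m" using h unfolding vel_bound_def by linarith
  then have "0 \<le> 4 * (16 * vel_bound h m + 2 * \<bar>m\<bar>)"
    by (intro mult_nonneg_nonneg add_nonneg_nonneg) auto
  then show "0 < R" unfolding conv_rate_def by simp
qed

lemma init_bounds: "\<bar>y 0 x\<bar> \<le> 1" "\<bar>v 0 x\<bar> \<le> 1" "\<bar>e 0 x\<bar> \<le> 1"
proof -
  show "\<bar>y 0 x\<bar> \<le> 1" "\<bar>e 0 x\<bar> \<le> 1" using pos0[of x] rel0(1)[of x] by auto
  then have "\<bar>y 0 x\<bar> * \<bar>e 0 x\<bar> \<le> 1 * 1" by (intro mult_mono) auto
  then have "(v 0 x)\<^sup>2 \<le> 1\<^sup>2" using rel0(2)[of x] by (simp flip: abs_mult)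
  then show "\<bar>v 0 x\<bar> \<le> 1" using abs_le_square_iff[of "v 0 x" 1] by simp
qed

lemma measure_M: "measure M UNIV = 1 + h"
proof -
  have "integrable M (y 0)" "integrable M (e 0)" by (rule bdd_integrable meas0 init_bounds)+
  then have "(\<integral>z. y 0 z + e 0 z \<partial>M) = 1 + h" using tot0 by simp
  then show ?thesis unfolding rel0 by simp
qed

lemma weight_nonneg: "0 \<le> weight R n"
  using R0 by (simp add: weight_def)

text \<open>Invariant of the induction on the index. Measurability is carried along because later
  coefficients contain integrals of earlier ones.\<close>

definition okn :: "nat \<Rightarrow> bool" where
  "okn n \<longleftrightarrow> y n \<in> borel_measurable borel \<and> v n \<in> borel_measurable borel \<and> e n \<in> borel_measurable borel \<and>
     (\<forall>x. \<bar>y n x\<bar> \<le> weight R n \<and> \<bar>v n x\<bar> \<le> weight R n \<and> \<bar>e n x\<bar> \<le> weight R n)"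

lemma V_ok: "okn n \<Longrightarrow> V n \<in> borel_measurable borel \<and> \<bar>V n x\<bar> \<le> (1 + h) * weight R n"
  unfolding okn_def vint_def using kint_bound[OF kernel_ker_le, of "v n" "weight R n"] kint_measurable[OF kernel_ker_le]
  by (auto simp: measure_M mult.commute)

lemma d_ok: "okn n \<Longrightarrow> d n \<in> borel_measurable borel \<and> \<bar>d n x\<bar> \<le> 2 * weight R n"
proof -
  assume "okn n"
  then have "y n \<in> borel_measurable borel" "e n \<in> borel_measurable borel"
    "\<bar>y n x\<bar> \<le> weight R n" "\<bar>e n x\<bar> \<le> weight R n" unfolding okn_def by auto
  then show ?thesis unfolding coeff_diff_def[abs_def] by auto
qed

lemma conv_meas:
  assumes "\<And>i. i \<le> n \<Longrightarrow> a i \<in> borel_measurable borel" "\<And>i. i \<le> n \<Longrightarrow> b i \<in> borel_measurable borel"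
  shows "conv a b n \<in> borel_measurable borel"
  unfolding conv_def[abs_def] using assms by (intro borel_measurable_sum borel_measurable_times) auto

lemma c_ok:
  assumes "\<And>i. i \<le> n \<Longrightarrow> okn i"
  shows "\<bar>c n\<bar> \<le> (\<bar>m\<bar> + 16 * (1 + h)\<^sup>2) / \<bar>1 - h\<bar> * weight R n"
proof -
  have cv: "\<bar>conv V d n x\<bar> \<le> 8 * (1 + h) * 2 * weight R n" for x
    using V_ok[OF assms] d_ok[OF assms] h R0 by (intro conv_weight) auto
  have cm: "conv V d n \<in> borel_measurable borel"
    using V_ok[OF assms] d_ok[OF assms] by (intro conv_meas) auto
  have 1: "\<bar>\<integral>z. conv V d n z \<partial>M\<bar> \<le> 16 * (1 + h)\<^sup>2 * weight R n"
    using bdd_integral_le[OF cm cv] by (simp add: measure_M power2_eq_square mult_ac)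
  have 2: "\<bar>if n = 0 then m else 0\<bar> \<le> \<bar>m\<bar> * weight R n"
    using weight_nonneg[of n] mult_nonneg_nonneg[of "\<bar>m\<bar>" "weight R n"] by (cases "n = 0") (simp add: weight_def, simp)
  have "\<bar>(if n = 0 then m else 0) - (\<integral>z. conv V d n z \<partial>M)\<bar> \<le> (\<bar>m\<bar> + 16 * (1 + h)\<^sup>2) * weight R n"
    using 1 2 by (simp add: distrib_right)
  then show ?thesis using h by (simp add: ccoef_def abs_divide divide_right_mono)
qed

lemma u_ok:
  assumes "\<And>i. i \<le> n \<Longrightarrow> okn i"
  shows "u n \<in> borel_measurable borel" "\<bar>u n x\<bar> \<le> vel_bound h m * weight R n"
  proof -
  have V: "V n \<in> borel_measurable borel" "\<bar>V n x\<bar> \<le> (1 + h) * weight R n"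
    using V_ok[OF assms[OF order_refl], of x] by auto
  show "u n \<in> borel_measurable borel" unfolding ucoef_def[abs_def] using V(1) by simp
  have "\<bar>c n\<bar> \<le> (\<bar>m\<bar> + 16 * (1 + h)\<^sup>2) / \<bar>1 - h\<bar> * weight R n"
    using assms by (rule c_ok)
  with V(2) show "\<bar>u n x\<bar> \<le> vel_bound h m * weight R n"
    unfolding ucoef_def vel_bound_def distrib_right[of _ _ "weight R n"] by linarith
qed

lemma all_ok: "okn n"
proof (induction n rule: less_induct)
  case (less n)
  show ?case
  proof (cases n)
    case 0
    then show ?thesis unfolding okn_def using meas0 init_bounds by (auto simp: weight_def)
  next
    case (Suc k)
    have ok: "\<And>i. i \<le> k \<Longrightarrow> okn i" using less Suc by simp
    have ok': "\<And>j i. i \<le> k \<Longrightarrow> j \<le> i \<Longrightarrow> okn j" using ok by simp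
    have vk: "\<And>i x. i \<le> k \<Longrightarrow> \<bar>v i x\<bar> \<le> 1 * weight R i" "\<And>i x. i \<le> k \<Longrightarrow> \<bar>y i x\<bar> \<le> 1 * weight R i"
      "\<And>i. i \<le> k \<Longrightarrow> v i \<in> borel_measurable borel" "\<And>i. i \<le> k \<Longrightarrow> y i \<in> borel_measurable borel"
      using ok unfolding okn_def by auto
    have uv: "\<bar>conv u v k x\<bar> \<le> 8 * vel_bound h m * 1 * weight R k" for x
      using R0 vel_bound_pos u_ok(2)[OF ok'] vk by (intro conv_weight) auto
    have ud: "\<bar>conv u d k x\<bar> \<le> 8 * vel_bound h m * 2 * weight R k" for x
      using R0 vel_bound_pos u_ok(2)[OF ok'] d_ok[OF ok] by (intro conv_weight) auto
    have [measurable]: "conv u v k \<in> borel_measurable borel" "conv u d k \<in> borel_measurable borel"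
      using u_ok(1)[OF ok'] vk d_ok[OF ok] by (auto intro!: conv_meas)
    have [measurable]: "v k \<in> borel_measurable borel" "y k \<in> borel_measurable borel" using vk by auto
    have mk: "\<bar>m * v k x\<bar> \<le> \<bar>m\<bar> * weight R k" "\<bar>m * y k x\<bar> \<le> \<bar>m\<bar> * weight R k" for x
      using vk(1)[of k x] vk(2)[of k x] by (auto simp: abs_mult intro!: mult_left_mono)
    \<comment> \<open>All three right-hand sides fit: \<open>y\<close> needs \<open>2 * 8\<close>,
      \<open>v\<close> needs \<open>8 * 2\<close> plus one \<open>\<bar>m\<bar>\<close>,
      \<open>e\<close> needs \<open>2 * 8\<close> plus \<open>2 * \<bar>m\<bar>\<close>.\<close>
    define L where "L = 16 * vel_bound h m + 2 * \<bar>m\<bar>"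
    have L: "0 \<le> L" "4 * L \<le> R" using vel_bound_pos by (auto simp: L_def conv_rate_def)
    have step: "\<bar>w / (real k + 1)\<bar> \<le> weight R (Suc k)" if "\<bar>w\<bar> \<le> L * weight R k" for w
    proof -
      have "\<bar>w / (real k + 1)\<bar> \<le> L * weight R k / (real k + 1)"
        using that by (simp add: abs_divide divide_right_mono)
      also have "\<dots> \<le> weight R (Suc k)" using L by (rule weight_step)
      finally show ?thesis .
    qed
    have Lw: "L * weight R k = 16 * vel_bound h m * weight R k + 2 * (\<bar>m\<bar> * weight R k)"
      by (simp add: L_def algebra_simps)
    have nn: "0 \<le> \<bar>m\<bar> * weight R k" "0 \<le> vel_bound h m * weight R k" using weight_nonneg[of k] vel_bound_pos by auto
    have "\<bar>y (Suc k) x\<bar> \<le> weight R (Suc k)" for x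
      unfolding rec using uv[of x] nn by (intro step) (simp add: Lw abs_mult)
    moreover have "\<bar>v (Suc k) x\<bar> \<le> weight R (Suc k)" for x
      unfolding rec using ud[of x] mk(2)[of x] nn by (intro step) (simp add: Lw)
    moreover have "\<bar>e (Suc k) x\<bar> \<le> weight R (Suc k)" for x
      unfolding rec using uv[of x] mk(1)[of x] nn by (intro step) (simp add: Lw abs_le_iff)
    moreover have "y (Suc k) \<in> borel_measurable borel"
      unfolding rec[abs_def] by measurable
    moreover have "v (Suc k) \<in> borel_measurable borel" unfolding rec[abs_def] by measurable
    moreover have "e (Suc k) \<in> borel_measurable borel" unfolding rec[abs_def] by measurable
    ultimately show ?thesis unfolding okn_def Suc by blast
  qed
qed

lemma weight_le: "weight R n \<le> R ^ n"
  using R0 by (simp add: weight_def divide_le_eq mult_le_cancel_left1)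

lemma pbound:
  "\<bar>y n x\<bar> \<le> 1 * R ^ n" "\<bar>v n x\<bar> \<le> 1 * R ^ n" "\<bar>e n x\<bar> \<le> 1 * R ^ n"
  "\<bar>u n x\<bar> \<le> vel_bound h m * R ^ n" "\<bar>c n\<bar> \<le> vel_bound h m * R ^ n"
proof -
  show "\<bar>y n x\<bar> \<le> 1 * R ^ n" "\<bar>v n x\<bar> \<le> 1 * R ^ n" "\<bar>e n x\<bar> \<le> 1 * R ^ n"
    using all_ok[of n] weight_le[of n] unfolding okn_def by (auto intro: order_trans)
  have "vel_bound h m * weight R n \<le> vel_bound h m * R ^ n" using vel_bound_pos by (intro mult_left_mono weight_le) auto
  then show "\<bar>u n x\<bar> \<le> vel_bound h m * R ^ n" using u_ok(2)[OF all_ok, of n x] by linarith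
  have "\<bar>c n\<bar> \<le> (\<bar>m\<bar> + 16 * (1 + h)\<^sup>2) / \<bar>1 - h\<bar> * weight R n" by (rule c_ok[OF all_ok])
  also have "\<dots> \<le> vel_bound h m * weight R n"
    using h weight_nonneg[of n] by (intro mult_right_mono) (auto simp: vel_bound_def)
  finally show "\<bar>c n\<bar> \<le> vel_bound h m * R ^ n"
    using \<open>vel_bound h m * weight R n \<le> vel_bound h m * R ^ n\<close> by linarith
qed

lemma gy: "geom_bdd R y" and gv: "geom_bdd R v" and ge: "geom_bdd R e" and gu: "geom_bdd R u" and gc: "geom_bdd R (\<lambda>n _. c n)"
proof -
  have "y n \<in> borel_measurable borel" "v n \<in> borel_measurable borel" "e n \<in> borel_measurable borel" for n
    using all_ok[of n] unfolding okn_def by auto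
  then show "geom_bdd R y" "geom_bdd R v" "geom_bdd R e" using pbound by (blast intro: geom_bddI)+
  show "geom_bdd R u" using pbound u_ok(1)[OF all_ok] by (blast intro: geom_bddI)
  show "geom_bdd R (\<lambda>n _. c n)" using pbound by (intro geom_bddI) auto
qed

lemma regular: "geom_bdd R d"
  unfolding coeff_diff_def[abs_def] by (intro geom_bdd_diff gy ge)

lemma gV: "geom_bdd R V"
  unfolding vint_def[abs_def] using geom_bdd_kint[OF kernel_ker_le gv] R0 by simp

section \<open>The sums of the series and their differential equations\<close>

definition "yt = pseries y"
definition "vt = pseries v"
definition "et = pseries e"
definition "ut = pseries u"
text \<open>The coefficients do not depend on the label, so the evaluation point 0 is a
  dummy.\<close>

definition "ct t = pseries (\<lambda>n _. c n) t (0::real)"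
definition "Wt t = kint M ker_le (vt t)"
definition "Gt t = kint M ker_le (\<lambda>z. ut t z * (yt t z - et t z) - m * yt t z)"

text \<open>Products of two of the series have rate \<open>2 * R\<close> and their time derivatives
  \<open>4 * R\<close>; this disc accommodates all of them.\<close>

abbreviation "okt t \<equiv> \<bar>t\<bar> * (4 * R) < 1"

lemma okt_le: assumes "okt t" shows "\<bar>t\<bar> * R < 1" "\<bar>t\<bar> * R \<le> 1/2" "\<bar>t\<bar> * (2 * R) < 1"
    "\<bar>t\<bar> * (2 * R) \<le> 1/2" "\<bar>t\<bar> * (2 * (2 * R)) < 1" "0 \<le> R" "0 \<le> 2 * R" "0 < R" "0 < 2 * R"
proof -
  have "0 \<le> \<bar>t\<bar> * R" using R0 by simp
  then show "\<bar>t\<bar> * R < 1" "\<bar>t\<bar> * R \<le> 1/2" "\<bar>t\<bar> * (2 * R) < 1"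
    "\<bar>t\<bar> * (2 * R) \<le> 1/2" "\<bar>t\<bar> * (2 * (2 * R)) < 1" "0 \<le> R" "0 \<le> 2 * R" "0 < R" "0 < 2 * R"
    using assms R0 by auto
qed

lemma open_okt: "open {t. okt t}"
  by (intro open_Collect_less continuous_intros)

lemma Wt_pseries: "okt t \<Longrightarrow> pseries V t x = Wt t x"
  unfolding vint_def[abs_def] Wt_def vt_def
  using okt_le[of t] by (intro pseries_kint[OF kernel_ker_le gv]) simp_all

lemma ut_eq: assumes "okt t" shows "ut t x = ct t + Wt t x"
proof -
  have "ut t x = pseries (\<lambda>n _. c n) t x + pseries V t x"
    unfolding ut_def ucoef_def[abs_def] using okt_le[OF assms]
    by (intro pseries_add[where Q = R] gc gV) auto
  then show ?thesis using Wt_pseries[OF assms] by (simp add: ct_def pseries_def)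
qed

lemma dt_eq: assumes "okt t" shows "pseries d t x = yt t x - et t x"
  unfolding coeff_diff_def[abs_def] yt_def et_def using okt_le[OF assms] by (intro pseries_diff[where Q = R] gy ge) auto

lemma bms: assumes "okt t" shows "bdd_meas (yt t)" "bdd_meas (vt t)" "bdd_meas (et t)" "bdd_meas (ut t)"
  unfolding yt_def vt_def et_def ut_def
  using okt_le[OF assms] by (auto intro!: pseries_bm gy gv ge gu)

lemma bmW: assumes "okt t" shows "bdd_meas (Wt t)" "bdd_meas (Gt t)"
  unfolding Wt_def Gt_def using bms[OF assms] by (auto intro!: bdd_meas_intros kernel_ker_le)

text \<open>The definition of \<open>ccoef\<close> summed up: the term present only at index 0 gives
  \<open>m\<close>, the convolution gives the product of the functions. The factor
  \<open>1 - h\<close> is the nominal integral of \<open>y - e\<close>, not yet known to be the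
  actual one.\<close>

lemma ct_eq: assumes t: "okt t"
  shows "(1 - h) * ct t = m - (\<integral>z. Wt t z * (yt t z - et t z) \<partial>M)"
proof -
  let ?d0 = "\<lambda>n (x::real). if n = 0 then m else 0 :: real"
  let ?k = "\<lambda>n. kint M K1 (conv V d n)"
  have g0: "geom_bdd (2 * R) ?d0"
  proof (rule geom_bddI[where A = "\<bar>m\<bar>"])
    show "\<bar>?d0 n x\<bar> \<le> \<bar>m\<bar> * (2 * R) ^ n" for n x using R0 by auto
  qed simp
  have gk: "geom_bdd (2 * R) ?k" using R0 by (intro geom_bdd_kint geom_bdd_conv gV regular kernel_K1) auto
  have "(1 - h) * ct t = pseries (\<lambda>n x. (1 - h) * c n) t (0::real)"
    unfolding ct_def using okt_le[OF t] by (intro pseries_cmult[symmetric, where Q = R] gc) auto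
  also have "(\<lambda>n (x::real). (1 - h) * c n) = (\<lambda>n x. ?d0 n x - ?k n x)"
    using h by (auto simp: fun_eq_iff ccoef_def kint_K1)
  also have "pseries \<dots> t 0 = pseries ?d0 t 0 - pseries ?k t 0"
    using okt_le[OF t] by (intro pseries_diff[where Q = "2 * R"] g0 gk) auto
  also have "pseries ?d0 t 0 = m"
  proof -
    have "(\<lambda>n. ?d0 n 0 * t ^ n) = (\<lambda>n. if n = 0 then m else 0)" by auto
    then show ?thesis unfolding pseries_def using sums_unique[OF sums_single[of 0 "\<lambda>_. m"]] by simp
  qed
  also have "pseries ?k t 0 = (\<integral>z. pseries (conv V d) t z \<partial>M)"
    using okt_le[OF t] R0 by (subst pseries_kint[OF kernel_K1 geom_bdd_conv[OF gV regular]]) (auto simp: kint_K1)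
  also have "(\<integral>z. pseries (conv V d) t z \<partial>M) = (\<integral>z. Wt t z * (yt t z - et t z) \<partial>M)"
    using okt_le[OF t] by (intro Bochner_Integration.integral_cong refl)
      (simp add: pseries_conv[OF gV regular] Wt_pseries[OF t] dt_eq[OF t])
  finally show ?thesis .
qed

lemma pseries_prod: assumes "okt t"
  shows "pseries (conv u v) t x = ut t x * vt t x" "pseries (conv u d) t x = ut t x * (yt t x - et t x)"
  using okt_le[OF assms] by (simp_all add: pseries_conv[OF gu gv] pseries_conv[OF gu regular] dt_eq[OF assms] ut_def vt_def)

lemma der_y: assumes t: "okt t"
  shows "((\<lambda>t. yt t x) has_real_derivative - 2 * (ut t x * vt t x)) (at t)"
proof -
  have "dcoeff y = (\<lambda>n x. - 2 * conv u v n x)" by (auto simp: fun_eq_iff dcoeff_def rec field_simps)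
  moreover have "pseries (\<lambda>n x. - 2 * conv u v n x) t x = - 2 * pseries (conv u v) t x"
    using okt_le[OF t] by (intro pseries_cmult[where Q = "2 * R"] geom_bdd_conv gu gv) auto
  ultimately show ?thesis
    using pseries_deriv[OF gy R0, of t x] okt_le[OF t] pseries_prod[OF t] unfolding yt_def by simp
qed

lemma der_v: assumes t: "okt t"
  shows "((\<lambda>t. vt t x) has_real_derivative ut t x * (yt t x - et t x) - m * yt t x) (at t)"
proof -
  have "dcoeff v = (\<lambda>n x. conv u d n x - m * y n x)" by (auto simp: fun_eq_iff dcoeff_def rec field_simps)
  moreover have "pseries (\<lambda>n x. conv u d n x - m * y n x) t x = pseries (conv u d) t x - pseries (\<lambda>n x. m * y n x) t x"
    using okt_le[OF t] by (intro pseries_diff[where Q = "2 * R"] geom_bdd_conv gu regular geom_bdd_cmult geom_bdd_mono[OF gy]) auto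
  moreover have "pseries (\<lambda>n x. m * y n x) t x = m * yt t x"
    unfolding yt_def using okt_le[OF t] by (intro pseries_cmult[where Q = R] gy) auto
  ultimately show ?thesis
    using pseries_deriv[OF gv R0, of t x] okt_le[OF t] pseries_prod[OF t] unfolding vt_def by simp
qed

lemma der_e: assumes t: "okt t"
  shows "((\<lambda>t. et t x) has_real_derivative 2 * (ut t x * vt t x - m * vt t x)) (at t)"
proof -
  have g: "geom_bdd (2 * R) (\<lambda>n x. conv u v n x - m * v n x)"
    using okt_le[OF t] by (intro geom_bdd_diff geom_bdd_conv gu gv geom_bdd_cmult geom_bdd_mono[OF gv]) auto
  have "dcoeff e = (\<lambda>n x. 2 * (conv u v n x - m * v n x))" by (auto simp: fun_eq_iff dcoeff_def rec field_simps)
  moreover have "pseries (\<lambda>n x. 2 * (conv u v n x - m * v n x)) t x = 2 * pseries (\<lambda>n x. conv u v n x - m * v n x) t x"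
    using okt_le[OF t] by (intro pseries_cmult[where Q = "2 * R"] g) auto
  moreover have "pseries (\<lambda>n x. conv u v n x - m * v n x) t x = pseries (conv u v) t x - pseries (\<lambda>n x. m * v n x) t x"
    using okt_le[OF t] by (intro pseries_diff[where Q = "2 * R"] geom_bdd_conv gu gv geom_bdd_cmult geom_bdd_mono[OF gv]) auto
  moreover have "pseries (\<lambda>n x. m * v n x) t x = m * vt t x"
    unfolding vt_def using okt_le[OF t] by (intro pseries_cmult[where Q = R] gv) auto
  ultimately show ?thesis
    using pseries_deriv[OF ge R0, of t x] okt_le[OF t] pseries_prod[OF t] unfolding et_def by simp
qed

lemma der_kint_y: "kernel k \<Longrightarrow> okt t \<Longrightarrow>
    ((\<lambda>t. kint M k (yt t) x) has_real_derivative kint M k (\<lambda>z. - 2 * (ut t z * vt t z)) x) (at t)"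
  using kint_pseries_deriv[OF _ gy R0 _ der_y[of t, unfolded yt_def]] okt_le[of t] unfolding yt_def by simp

lemma der_kint_v: "kernel k \<Longrightarrow> okt t \<Longrightarrow>
    ((\<lambda>t. kint M k (vt t) x) has_real_derivative kint M k (\<lambda>z. ut t z * (yt t z - et t z) - m * yt t z) x) (at t)"
  using kint_pseries_deriv[OF _ gv R0 _ der_v[of t, unfolded vt_def]] okt_le[of t] unfolding vt_def by simp

lemma der_kint_e: "kernel k \<Longrightarrow> okt t \<Longrightarrow>
    ((\<lambda>t. kint M k (et t) x) has_real_derivative kint M k (\<lambda>z. 2 * (ut t z * vt t z - m * vt t z)) x) (at t)"
  using kint_pseries_deriv[OF _ ge R0 _ der_e[of t, unfolded et_def]] okt_le[of t] unfolding et_def by simp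

lemma der_W: "okt t \<Longrightarrow> ((\<lambda>t. Wt t x) has_real_derivative Gt t x) (at t)"
  unfolding Wt_def Gt_def by (rule der_kint_v[OF kernel_ker_le])

text \<open>The relation \<open>ct_eq\<close> differentiated under the integral. The terms with the
  factor \<open>Wt\<close> come from the time derivative of \<open>y - e\<close>; they drop out in
  \<open>der_u\<close>, once the total of \<open>v\<close> is known to be zero.\<close>

lemma der_c: assumes t: "okt t"
  shows "(ct has_real_derivative
     - (\<integral>z. Gt t z * (yt t z - et t z) + Wt t z * (- 4 * (ut t z * vt t z) + 2 * m * vt t z) \<partial>M) / (1 - h)) (at t)"
    (is "(_ has_real_derivative - ?D / (1 - h)) _")
proof -
  have g: "geom_bdd (2 * R) (conv V d)" using R0 by (intro geom_bdd_conv gV regular) auto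
  have eq: "pseries (conv V d) s z = Wt s z * (yt s z - et s z)" if "okt s" for s z
    using okt_le[OF that] by (simp add: pseries_conv[OF gV regular] Wt_pseries[OF that] dt_eq[OF that])
  have dz: "((\<lambda>s. pseries (conv V d) s z) has_real_derivative
     Gt t z * (yt t z - et t z) + Wt t z * (- 4 * (ut t z * vt t z) + 2 * m * vt t z)) (at t)" for z
  proof (rule has_field_derivative_transform_within_open[OF _ open_okt])
    show "((\<lambda>s. Wt s z * (yt s z - et s z)) has_real_derivative
     Gt t z * (yt t z - et t z) + Wt t z * (- 4 * (ut t z * vt t z) + 2 * m * vt t z)) (at t)"
      by (rule DERIV_cong[OF DERIV_mult[OF der_W[OF t] DERIV_diff[OF der_y[OF t] der_e[OF t]]]])
        (simp add: algebra_simps)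
    show "t \<in> {t. okt t}" using t by simp
    show "Wt s z * (yt s z - et s z) = pseries (conv V d) s z" if "s \<in> {t. okt t}" for s
      using eq[of s z] that by simp
  qed
  have k: "((\<lambda>s. kint M K1 (pseries (conv V d) s) 0) has_real_derivative ?D) (at t)"
    using kint_pseries_deriv[OF kernel_K1 g _ _ dz, of 0] okt_le[OF t] by (simp add: kint_K1)
  show ?thesis
  proof (rule has_field_derivative_transform_within_open[OF _ open_okt])
    show "((\<lambda>s. (m - kint M K1 (pseries (conv V d) s) 0) / (1 - h)) has_real_derivative - ?D / (1 - h)) (at t)"
      unfolding minus_divide_left[symmetric] minus_diff_eq
      using DERIV_cdivide[OF DERIV_diff[OF DERIV_const[of m] k], of "1 - h"] by simp
    show "t \<in> {t. okt t}" using t by simp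
    show "(m - kint M K1 (pseries (conv V d) s) 0) / (1 - h) = ct s" if "s \<in> {t. okt t}" for s
    proof -
      have "pseries (conv V d) s = (\<lambda>z. Wt s z * (yt s z - et s z))" using eq that by auto
      then have "m - kint M K1 (pseries (conv V d) s) 0 = (1 - h) * ct s"
        using ct_eq[of s] that by (simp add: kint_K1)
      then show ?thesis using h by simp
    qed
  qed
qed

lemma time_step_ok: assumes "0 \<le> t" "t \<le> time_step h m" shows "okt t"
proof -
  have "t * (4 * R) \<le> time_step h m * (4 * R)" using assms R0 by (intro mult_right_mono) auto
  also have "\<dots> = 1 / 4" using R0 by (simp add: time_step_def)
  finally show ?thesis using assms by simp
qed

lemma time_step_pos: "0 < time_step h m"
  using R0 by (simp add: time_step_def)

lemma pbounds: assumes t: "okt t"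
  shows "\<bar>yt t x\<bar> \<le> 2" "\<bar>vt t x\<bar> \<le> 2" "\<bar>et t x\<bar> \<le> 2" "\<bar>ut t x\<bar> \<le> 2 * vel_bound h m" "\<bar>ct t\<bar> \<le> 2 * vel_bound h m"
proof -
  note b = pseries_bound(1)[where Q = R and t = t, OF _ okt_le(6,2)[OF t]]
  show "\<bar>yt t x\<bar> \<le> 2" using b[of y x 1] pbound unfolding yt_def by simp
  show "\<bar>vt t x\<bar> \<le> 2" using b[of v x 1] pbound unfolding vt_def by simp
  show "\<bar>et t x\<bar> \<le> 2" using b[of e x 1] pbound unfolding et_def by simp
  show "\<bar>ut t x\<bar> \<le> 2 * vel_bound h m" using b[of u x "vel_bound h m"] pbound unfolding ut_def by simp
  show "\<bar>ct t\<bar> \<le> 2 * vel_bound h m" using b[of "\<lambda>n _. c n" "0::real" "vel_bound h m"] pbound unfolding ct_def by simp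
qed

text \<open>The coefficients of the sum are at most \<open>2 * R ^ n\<close>, so on the time step it
  moves from its initial value 1 by at most \<open>4 * R * t \<le> 1/4\<close>.\<close>

lemma sum_near_1:
  assumes "0 \<le> t" "t \<le> time_step h m"
  shows "1/2 \<le> yt t x + et t x"
proof -
  note t = time_step_ok[OF assms]
  have "yt t x + et t x = pseries (\<lambda>n x. y n x + e n x) t x"
    unfolding yt_def et_def using okt_le[OF t] by (intro pseries_add[symmetric, where Q = R] gy ge) auto
  moreover have "\<bar>pseries (\<lambda>n x. y n x + e n x) t x - (y 0 x + e 0 x)\<bar> \<le> 2 * 2 * R * \<bar>t\<bar>"
  proof (rule pseries_bound(2))
    show "\<bar>y n x + e n x\<bar> \<le> 2 * R ^ n" for n using pbound(1)[of n x] pbound(3)[of n x] by linarith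
  qed (use okt_le[OF t] in auto)
  moreover have "R * t \<le> R * time_step h m" using assms R0 by (intro mult_left_mono) auto
  then have "R * t \<le> 1/16" using R0 by (simp add: time_step_def)
  ultimately show ?thesis using rel0(1)[of x] assms(1) by (simp add: abs_le_iff)
qed

text \<open>\<open>y * e - v^2\<close> is a first integral: its derivative cancels identically,
  whatever \<open>U\<close> is. It is squared because \<open>gronwall_zero\<close> asks for a
  nonnegative function.\<close>

lemma rel_t:
  assumes "0 \<le> t" "t \<le> time_step h m"
  shows "yt t x * et t x = (vt t x)\<^sup>2"
proof -
  have "(yt t x * et t x - (vt t x)\<^sup>2)\<^sup>2 = 0"
  proof (rule gronwall_zero[where D' = "\<lambda>_. 0" and K = 0, OF _ _ _ _ assms])
    show "(yt 0 x * et 0 x - (vt 0 x)\<^sup>2)\<^sup>2 = 0"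
      using rel0(2)[of x] by (simp add: yt_def et_def vt_def)
    fix r assume r: "0 \<le> r" "r \<le> time_step h m"
    note r = time_step_ok[OF r]
    show "((\<lambda>t. (yt t x * et t x - (vt t x)\<^sup>2)\<^sup>2) has_real_derivative 0) (at r)"
      unfolding power2_eq_square[of "vt _ _"]
      by (rule DERIV_cong[OF DERIV_power[OF DERIV_diff[OF DERIV_mult[OF der_y[OF r] der_e[OF r]]
           DERIV_mult[OF der_v[OF r] der_v[OF r]]]]])
        (simp add: algebra_simps)
  qed auto
  then show ?thesis by simp
qed

text \<open>The product is a square and the sum is at least 1/2; a nonnegative product with a
  positive sum forces both factors to be nonnegative.\<close>

lemma pos_t:
  assumes "0 \<le> t" "t \<le> time_step h m"
  shows "0 \<le> yt t x" "0 \<le> et t x"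
proof -
  have "0 \<le> yt t x * et t x" using rel_t[OF assms] by simp
  then show "0 \<le> yt t x" "0 \<le> et t x"
    using sum_near_1[OF assms, of x] by (auto simp: zero_le_mult_iff)
qed

lemma int_bms: "okt t \<Longrightarrow> integrable M (\<lambda>z. ut t z * (yt t z - et t z))" "okt t \<Longrightarrow> integrable M (yt t)"
    "okt t \<Longrightarrow> integrable M (\<lambda>z. ut t z * vt t z)" "okt t \<Longrightarrow> integrable M (vt t)" "okt t \<Longrightarrow> integrable M (et t)"
    "okt t \<Longrightarrow> integrable M (\<lambda>z. Wt t z * (yt t z - et t z))" "okt t \<Longrightarrow> integrable M (\<lambda>z. Wt t z * vt t z)"
    "okt t \<Longrightarrow> integrable M (\<lambda>z. (Wt t z)\<^sup>2 * vt t z)" "okt t \<Longrightarrow> integrable M (\<lambda>z. Gt t z * (yt t z - et t z))"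
  by (intro bdd_meas_integrable bdd_meas_intros bms bmW; assumption)+

section \<open>Conservation of the totals\<close>

lemma W_eq: "Wt t z = 0 + kint M ker_le (vt t) z"
  by (simp add: Wt_def)

lemma int_Wv: assumes t: "okt t" shows "2 * (\<integral>z. Wt t z * vt t z \<partial>M) = (\<integral>z. vt t z \<partial>M)\<^sup>2"
  using parts_all[OF bms(2)[OF t] bms(2)[OF t] W_eq W_eq] by (simp add: mult.commute power2_eq_square)

text \<open>The integrand is a third of the differential of the cube of the primitive
  \<open>Wt\<close>; the chain rule is integration by parts used twice.\<close>

lemma int_WWv: assumes t: "okt t" shows "3 * (\<integral>z. (Wt t z)\<^sup>2 * vt t z \<partial>M) = (\<integral>z. vt t z \<partial>M) ^ 3"
proof -
  let ?f = "\<lambda>z. vt t z * Wt t z + Wt t z * vt t z"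
  have f: "bdd_meas ?f" by (intro bdd_meas_intros bms bmW t)
  have sq: "(Wt t z)\<^sup>2 = 0 + kint M ker_le ?f z" for z
    using parts_le[OF bms(2)[OF t] bms(2)[OF t] W_eq W_eq, of z] by (simp add: power2_eq_square)
  have "(\<integral>z. ?f z * Wt t z + (Wt t z)\<^sup>2 * vt t z \<partial>M) = (0 + (\<integral>z. ?f z \<partial>M)) * (0 + (\<integral>z. vt t z \<partial>M)) - 0 * 0"
    by (rule parts_all[OF f bms(2)[OF t] sq W_eq])
  moreover have "(\<integral>z. ?f z \<partial>M) = (\<integral>z. vt t z \<partial>M)\<^sup>2"
    using parts_all[OF bms(2)[OF t] bms(2)[OF t] W_eq W_eq] by (simp add: power2_eq_square)
  moreover have "?f z * Wt t z + (Wt t z)\<^sup>2 * vt t z = 3 * ((Wt t z)\<^sup>2 * vt t z)" for z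
    by (simp add: power2_eq_square algebra_simps)
  ultimately show ?thesis by (simp add: power2_eq_square power3_eq_cube mult_ac)
qed

lemma int_uv: assumes t: "okt t"
  shows "(\<integral>z. ut t z * vt t z \<partial>M) = ct t * (\<integral>z. vt t z \<partial>M) + (\<integral>z. vt t z \<partial>M)\<^sup>2 / 2"
proof -
  have "(\<integral>z. ut t z * vt t z \<partial>M) = (\<integral>z. ct t * vt t z + Wt t z * vt t z \<partial>M)"
    by (simp add: ut_eq[OF t] distrib_right)
  also have "\<dots> = ct t * (\<integral>z. vt t z \<partial>M) + (\<integral>z. Wt t z * vt t z \<partial>M)"
    using int_bms[OF t] by simp
  finally show ?thesis using int_Wv[OF t] by simp
qed

text \<open>\<open>pp\<close>, \<open>qq\<close> and \<open>rr\<close> are the defects of the totals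
  that ought to be 0, 1 and \<open>h\<close>.\<close>

definition "pp t = (\<integral>z. vt t z \<partial>M)"
definition "qq t = (\<integral>z. yt t z \<partial>M) - 1"
definition "rr t = (\<integral>z. et t z \<partial>M) - h"

text \<open>The additive constant was fixed with \<open>1 - h\<close> in place of the true integral
  of \<open>y - e\<close>; the error is the constant times the defect of that integral.\<close>

lemma int_uydiff: assumes t: "okt t"
  shows "(\<integral>z. ut t z * (yt t z - et t z) \<partial>M) = m + ct t * (qq t - rr t)"
proof -
  have "(\<integral>z. ut t z * (yt t z - et t z) \<partial>M) = (\<integral>z. ct t * (yt t z - et t z) + Wt t z * (yt t z - et t z) \<partial>M)"
    by (simp add: ut_eq[OF t] distrib_right)
  also have "\<dots> = ct t * (\<integral>z. yt t z - et t z \<partial>M) + (\<integral>z. Wt t z * (yt t z - et t z) \<partial>M)"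
    using int_bms[OF t] by simp
  also have "(\<integral>z. yt t z - et t z \<partial>M) = (1 - h) + (qq t - rr t)"
    using int_bms[OF t] by (simp add: qq_def rr_def)
  also have "(\<integral>z. Wt t z * (yt t z - et t z) \<partial>M) = m - (1 - h) * ct t" using ct_eq[OF t] by simp
  finally show ?thesis by (simp add: algebra_simps)
qed

lemma der_pqr: assumes t: "okt t"
  shows "(pp has_real_derivative ct t * (qq t - rr t) - m * qq t) (at t)"
    "(qq has_real_derivative - 2 * (ct t * pp t + (pp t)\<^sup>2 / 2)) (at t)"
    "(rr has_real_derivative 2 * (ct t * pp t + (pp t)\<^sup>2 / 2 - m * pp t)) (at t)"
proof -
  show "(pp has_real_derivative ct t * (qq t - rr t) - m * qq t) (at t)"
    unfolding pp_def[abs_def]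
  proof (rule DERIV_cong[OF der_kint_v[OF kernel_K1 t, unfolded kint_K1]])
    have "(\<integral>z. ut t z * (yt t z - et t z) - m * yt t z \<partial>M)
        = (\<integral>z. ut t z * (yt t z - et t z) \<partial>M) - m * (\<integral>z. yt t z \<partial>M)"
      using int_bms[OF t] by simp
    also have "(\<integral>z. yt t z \<partial>M) = qq t + 1" by (simp add: qq_def)
    finally show "(\<integral>z. ut t z * (yt t z - et t z) - m * yt t z \<partial>M) = ct t * (qq t - rr t) - m * qq t"
      using int_uydiff[OF t] by (simp add: algebra_simps)
  qed
  show "(qq has_real_derivative - 2 * (ct t * pp t + (pp t)\<^sup>2 / 2)) (at t)"
    unfolding qq_def[abs_def]
    by (rule DERIV_cong[OF DERIV_diff[OF der_kint_y[OF kernel_K1 t, unfolded kint_K1] DERIV_const]])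
      (use int_bms[OF t] int_uv[OF t] in \<open>simp add: pp_def\<close>)
  show "(rr has_real_derivative 2 * (ct t * pp t + (pp t)\<^sup>2 / 2 - m * pp t)) (at t)"
    unfolding rr_def[abs_def]
    by (rule DERIV_cong[OF DERIV_diff[OF der_kint_e[OF kernel_K1 t, unfolded kint_K1] DERIV_const]])
      (use int_bms[OF t] int_uv[OF t] in \<open>simp add: pp_def\<close>)
qed

lemma prod_le_sum_squares:
  fixes a b k :: real assumes "\<bar>k\<bar> \<le> K"
  shows "k * (a * b) \<le> K * (a\<^sup>2 + b\<^sup>2)"
proof -
  have "0 \<le> (\<bar>a\<bar> - \<bar>b\<bar>)\<^sup>2" by simp
  then have "2 * \<bar>a * b\<bar> \<le> a\<^sup>2 + b\<^sup>2" by (simp add: power2_eq_square abs_mult algebra_simps)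
  then have ab: "\<bar>a * b\<bar> \<le> a\<^sup>2 + b\<^sup>2" using abs_ge_zero[of "a * b"] by linarith
  have "k * (a * b) \<le> \<bar>k\<bar> * \<bar>a * b\<bar>" by (simp flip: abs_mult)
  also have "\<dots> \<le> K * (a\<^sup>2 + b\<^sup>2)" using assms ab by (intro mult_mono) auto
  finally show ?thesis .
qed

text \<open>By \<open>der_pqr\<close> the defects solve a system with bounded coefficients whose
  right-hand sides vanish at zero; Gronwall's inequality for the sum of squares keeps them at their
  initial value 0.\<close>

lemma pqr_zero:
  assumes "0 \<le> t" "t \<le> time_step h m"
  shows "pp t = 0" "qq t = 0" "rr t = 0"
proof -
  \<comment> \<open>A common bound for the total of \<open>v\<close> (2 times the mass
    \<open>1 + h\<close>), for the additive constant and for \<open>m\<close>. The value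
    \<open>10 * N\<close> used below is a crude bound for the coefficient of either mixed
    product.\<close>
  define N where "N = 2 * vel_bound h m + 2 * (1 + h) + \<bar>m\<bar>"
  have N0: "0 \<le> N" using vel_bound_pos h by (simp add: N_def)
  have pN: "\<bar>pp r\<bar> \<le> N" "\<bar>ct r\<bar> \<le> N" "\<bar>m\<bar> \<le> N" if "okt r" for r
  proof -
    have "\<bar>pp r\<bar> \<le> 2 * (1 + h)"
      unfolding pp_def using bdd_integral_le[of "vt r" 2] bms(2)[OF that] pbounds(2)[OF that]
      by (auto simp: measure_M)
    then show "\<bar>pp r\<bar> \<le> N" using vel_bound_pos by (simp add: N_def)
    show "\<bar>ct r\<bar> \<le> N" using pbounds(5)[OF that] h by (simp add: N_def)
    show "\<bar>m\<bar> \<le> N" using vel_bound_pos h by (simp add: N_def)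
  qed
  have "(pp t)\<^sup>2 + (qq t)\<^sup>2 + (rr t)\<^sup>2 = 0"
  proof (rule gronwall_zero[where K = "20 * N" and D' = "\<lambda>t. (2 * ct t - 2 * m - 4 * ct t - 2 * pp t) * (pp t * qq t)
       + (- 2 * ct t + 4 * ct t + 2 * pp t - 4 * m) * (pp t * rr t)", OF _ _ _ _ assms])
    show "(pp 0)\<^sup>2 + (qq 0)\<^sup>2 + (rr 0)\<^sup>2 = 0"
      using tot0 by (simp add: pp_def qq_def rr_def vt_def yt_def et_def)
    show "0 \<le> (pp t)\<^sup>2 + (qq t)\<^sup>2 + (rr t)\<^sup>2" for t by simp
    fix r assume r: "0 \<le> r" "r \<le> time_step h m"
    note r = time_step_ok[OF r]
    show "((\<lambda>t. (pp t)\<^sup>2 + (qq t)\<^sup>2 + (rr t)\<^sup>2) has_real_derivative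
       (2 * ct r - 2 * m - 4 * ct r - 2 * pp r) * (pp r * qq r)
       + (- 2 * ct r + 4 * ct r + 2 * pp r - 4 * m) * (pp r * rr r)) (at r)"
      by (rule DERIV_cong[OF DERIV_add[OF DERIV_add[OF DERIV_power[OF der_pqr(1)[OF r]]
           DERIV_power[OF der_pqr(2)[OF r]]] DERIV_power[OF der_pqr(3)[OF r]]]])
        (simp add: algebra_simps power2_eq_square)
    have "(2 * ct r - 2 * m - 4 * ct r - 2 * pp r) * (pp r * qq r) \<le> (10 * N) * ((pp r)\<^sup>2 + (qq r)\<^sup>2)"
      using pN[OF r] by (intro prod_le_sum_squares) linarith
    moreover have "(- 2 * ct r + 4 * ct r + 2 * pp r - 4 * m) * (pp r * rr r) \<le> (10 * N) * ((pp r)\<^sup>2 + (rr r)\<^sup>2)"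
      using pN[OF r] by (intro prod_le_sum_squares) linarith
    moreover have "(10 * N) * ((pp r)\<^sup>2 + (qq r)\<^sup>2) \<le> (10 * N) * ((pp r)\<^sup>2 + (qq r)\<^sup>2 + (rr r)\<^sup>2)"
      using N0 by (intro mult_left_mono) auto
    moreover have "(10 * N) * ((pp r)\<^sup>2 + (rr r)\<^sup>2) \<le> (10 * N) * ((pp r)\<^sup>2 + (qq r)\<^sup>2 + (rr r)\<^sup>2)"
      using N0 by (intro mult_left_mono) auto
    ultimately show "(2 * ct r - 2 * m - 4 * ct r - 2 * pp r) * (pp r * qq r)
       + (- 2 * ct r + 4 * ct r + 2 * pp r - 4 * m) * (pp r * rr r) \<le> 20 * N * ((pp r)\<^sup>2 + (qq r)\<^sup>2 + (rr r)\<^sup>2)"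
      by linarith
  qed
  then show "pp t = 0" "qq t = 0" "rr t = 0" by (simp_all add: add_nonneg_eq_0_iff)
qed

text \<open>Once the total of \<open>v\<close> is zero, the integrals of \<open>W v\<close> and
  \<open>W^2 v\<close> vanish, being its square and cube up to a factor. This reduces the derivative
  of the additive constant to a single integral.\<close>

lemma der_u:
  assumes "0 \<le> t" "t \<le> time_step h m"
  shows "((\<lambda>t. ut t x) has_real_derivative Gt t x - (\<integral>z. Gt t z * (yt t z - et t z) \<partial>M) / (1 - h)) (at t)"
proof -
  note t = time_step_ok[OF assms]
  have pz: "(\<integral>z. vt t z \<partial>M) = 0" using pqr_zero[OF assms] by (simp add: pp_def)
  have z: "(\<integral>z. Wt t z * vt t z \<partial>M) = 0" "(\<integral>z. (Wt t z)\<^sup>2 * vt t z \<partial>M) = 0"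
    using int_Wv[OF t] int_WWv[OF t] pz by auto
  have "(\<integral>z. Gt t z * (yt t z - et t z) + Wt t z * (- 4 * (ut t z * vt t z) + 2 * m * vt t z) \<partial>M)
     = (\<integral>z. Gt t z * (yt t z - et t z) + ((2 * m - 4 * ct t) * (Wt t z * vt t z) - 4 * ((Wt t z)\<^sup>2 * vt t z)) \<partial>M)"
    by (intro Bochner_Integration.integral_cong refl) (simp add: ut_eq[OF t] algebra_simps power2_eq_square)
  also have "\<dots> = (\<integral>z. Gt t z * (yt t z - et t z) \<partial>M)"
    using int_bms[OF t] z by simp
  finally have eq: "(\<integral>z. Gt t z * (yt t z - et t z) + Wt t z * (- 4 * (ut t z * vt t z) + 2 * m * vt t z) \<partial>M)
     = (\<integral>z. Gt t z * (yt t z - et t z) \<partial>M)" .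
  show ?thesis
  proof (rule has_field_derivative_transform_within_open[OF _ open_okt])
    show "((\<lambda>t. ct t + Wt t x) has_real_derivative Gt t x - (\<integral>z. Gt t z * (yt t z - et t z) \<partial>M) / (1 - h)) (at t)"
      by (rule DERIV_cong[OF DERIV_add[OF der_c[OF t] der_W[OF t]]]) (subst eq, simp)
    show "t \<in> {t. okt t}" using t by simp
    show "ct r + Wt r x = ut r x" if "r \<in> {t. okt t}" for r using ut_eq[of r x] that by simp
  qed
qed

section \<open>Positions of the characteristics\<close>

definition "xc = icoeff (\<lambda>n x. - 1 * conv (\<lambda>n _. c n) (\<lambda>n _. c n) n (x::real))"
text \<open>Position before any mass is passed, where \<open>U\<close> equals its additive constant
  \<open>ct\<close>; hence the velocity \<open>- ct^2\<close> built into \<open>xc\<close>.\<close>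

definition "Xt t = pseries xc t (0::real)"
definition "Yt t x = Xt t + kint M ker_le (yt t) x"

lemma gxc: "geom_bdd (2 * R) xc"
  unfolding xc_def using R0 by (intro geom_bdd_icoeff geom_bdd_cmult geom_bdd_conv gc) auto

lemma der_X: assumes t: "okt t" shows "(Xt has_real_derivative - (ct t)\<^sup>2) (at t)"
proof -
  have "pseries (dcoeff xc) t (0::real) = - 1 * pseries (conv (\<lambda>n _. c n) (\<lambda>n _. c n)) t (0::real)"
    unfolding xc_def dcoeff_icoeff using okt_le[OF t]
    by (intro pseries_cmult[where Q = "2 * R"] geom_bdd_conv gc) auto
  also have "\<dots> = - (ct t)\<^sup>2"
    using okt_le[OF t] by (simp add: pseries_conv[OF gc gc] ct_def power2_eq_square)
  finally show ?thesis using pseries_deriv[OF gxc, of t 0] okt_le[OF t] unfolding Xt_def[abs_def] by simp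
qed

text \<open>Since \<open>v\<close> is the density of \<open>U\<close>, integrating
  \<open>- 2 U v\<close> over labels gives minus the increment of \<open>U^2\<close>; adding the
  motion of \<open>Xt\<close> leaves \<open>- U^2\<close>.\<close>

lemma der_Y: assumes t: "okt t" shows "((\<lambda>t. Yt t x) has_real_derivative - (ut t x)\<^sup>2) (at t)"
proof -
  have ue: "ut t z = ct t + kint M ker_le (vt t) z" for z using ut_eq[OF t] by (simp add: Wt_def)
  have "kint M ker_le (\<lambda>z. vt t z * ut t z + ut t z * vt t z) x = ut t x * ut t x - ct t * ct t"
    by (rule parts_le[OF bms(2)[OF t] bms(2)[OF t] ue ue])
  moreover have "kint M ker_le (\<lambda>z. - 2 * (ut t z * vt t z)) x = - kint M ker_le (\<lambda>z. vt t z * ut t z + ut t z * vt t z) x"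
    unfolding kint_def by (subst Bochner_Integration.integral_minus[symmetric])
      (intro Bochner_Integration.integral_cong refl, simp add: algebra_simps)
  ultimately show ?thesis
    unfolding Yt_def[abs_def]
    by (intro DERIV_cong[OF DERIV_add[OF der_X[OF t] der_kint_y[OF kernel_ker_le t]]])
      (simp add: power2_eq_square)
qed

lemma X_bound: obtains A where "\<And>t. okt t \<Longrightarrow> \<bar>Xt t\<bar> \<le> A"
proof -
  obtain A where A: "\<bar>xc n x\<bar> \<le> A * (2 * R) ^ n" for n x using geom_bddE[OF gxc] by metis
  have "\<bar>Xt t\<bar> \<le> 2 * A" if "okt t" for t
    unfolding Xt_def using okt_le[OF that] by (intro pseries_bound(1)[where Q = "2 * R"] A) auto
  then show thesis by (rule that)
qed

lemma meas_t:
  "(\<lambda>(t, x). yt t x) \<in> borel_measurable (borel \<Otimes>\<^sub>M borel)" "(\<lambda>(t, x). vt t x) \<in> borel_measurable (borel \<Otimes>\<^sub>M borel)"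
  "(\<lambda>(t, x). et t x) \<in> borel_measurable (borel \<Otimes>\<^sub>M borel)" "(\<lambda>(t, x). ut t x) \<in> borel_measurable (borel \<Otimes>\<^sub>M borel)"
  "Xt \<in> borel_measurable borel" "(\<lambda>(t, x). Yt t x) \<in> borel_measurable (borel \<Otimes>\<^sub>M borel)"
proof -
  have [measurable]: "y n \<in> borel_measurable borel" "v n \<in> borel_measurable borel" "e n \<in> borel_measurable borel"
    "u n \<in> borel_measurable borel" "xc n \<in> borel_measurable borel" for n
    using gy gv ge gu gxc by auto
  show [measurable]: "(\<lambda>(t, x). yt t x) \<in> borel_measurable (borel \<Otimes>\<^sub>M borel)"
    unfolding yt_def by measurable
  show "(\<lambda>(t, x). vt t x) \<in> borel_measurable (borel \<Otimes>\<^sub>M borel)"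
    unfolding vt_def by measurable
  show "(\<lambda>(t, x). et t x) \<in> borel_measurable (borel \<Otimes>\<^sub>M borel)"
    unfolding et_def by measurable
  show "(\<lambda>(t, x). ut t x) \<in> borel_measurable (borel \<Otimes>\<^sub>M borel)"
    unfolding ut_def by measurable
  show [measurable]: "Xt \<in> borel_measurable borel" unfolding Xt_def[abs_def] by measurable
  have [measurable]: "(\<lambda>(t, x). kint M ker_le (yt t) x) \<in> borel_measurable (borel \<Otimes>\<^sub>M borel)"
    by (rule kint_measurable2[OF kernel_ker_le]) measurable
  show "(\<lambda>(t, x). Yt t x) \<in> borel_measurable (borel \<Otimes>\<^sub>M borel)"
    unfolding Yt_def by measurable
qed

lemma ae_pos: "AE t in lborel. 0 \<le> t \<and> t \<le> time_step h m \<longrightarrow> (AE x in M. 0 < yt t x)"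
proof -
  interpret P: pair_sigma_finite lborel M by standard
  note [measurable] = meas_t(1)
  have "AE t in lborel. 0 \<le> t \<and> t \<le> time_step h m \<longrightarrow> 0 < yt t x" for x
  proof -
    have "time_step h m * R < 1" using R0 by (simp add: time_step_def)
    then have "finite {t. \<bar>t\<bar> \<le> time_step h m \<and> yt t x = 0}"
      unfolding yt_def using pos0(1)[of x] R0 by (intro pseries_zeros_finite[OF gy]) auto
    then have "{t. \<bar>t\<bar> \<le> time_step h m \<and> yt t x = 0} \<in> null_sets lborel"
      by (simp add: finite_imp_null_set_lborel)
    then show ?thesis
    proof (rule AE_I')
      show "{t \<in> space lborel. \<not> (0 \<le> t \<and> t \<le> time_step h m \<longrightarrow> 0 < yt t x)} \<subseteq> {t. \<bar>t\<bar> \<le> time_step h m \<and> yt t x = 0}"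
      proof safe
        fix t assume t: "0 \<le> t" "t \<le> time_step h m" "\<not> 0 < yt t x"
        then show "\<bar>t\<bar> \<le> time_step h m" "yt t x = 0" using pos_t(1)[of t x] by auto
      qed
    qed
  qed
  then have "AE x in M. AE t in lborel. 0 \<le> t \<and> t \<le> time_step h m \<longrightarrow> 0 < yt t x" by simp
  then have "AE t in lborel. AE x in M. 0 \<le> t \<and> t \<le> time_step h m \<longrightarrow> 0 < yt t x"
    by (subst P.AE_commute) measurable
  then show ?thesis by simp
qed

theorem lagrangian_solution:
  obtains B where "lagrangian M (time_step h m) h m B yt vt et ut Yt ct Xt"
proof -
  obtain A where A: "\<And>t. okt t \<Longrightarrow> \<bar>Xt t\<bar> \<le> A" by (rule X_bound) auto
  define B where "B = 2 + 2 * vel_bound h m + \<bar>A\<bar>"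
  have "lagrangian M (time_step h m) h m B yt vt et ut Yt ct Xt"
  proof
    fix t x assume t: "0 \<le> t" "t \<le> time_step h m"
    note ok = time_step_ok[OF t]
    show "\<bar>yt t x\<bar> \<le> B" "\<bar>vt t x\<bar> \<le> B" "\<bar>et t x\<bar> \<le> B" "\<bar>ut t x\<bar> \<le> B"
      using pbounds(1-4)[OF ok, of x] vel_bound_pos by (simp_all add: B_def)
    show "\<bar>ut t x\<bar> \<le> 2 * vel_bound h m" by (rule pbounds(4)[OF ok])
    show "\<bar>Xt t\<bar> \<le> B" using A[OF ok] vel_bound_pos by (simp add: B_def)
    show "((\<lambda>t. yt t x) has_real_derivative - 2 * (ut t x * vt t x)) (at t)" by (rule der_y[OF ok])
    show "((\<lambda>t. vt t x) has_real_derivative ut t x * (yt t x - et t x) - m * yt t x) (at t)" by (rule der_v[OF ok])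
    show "((\<lambda>t. et t x) has_real_derivative 2 * (ut t x * vt t x - m * vt t x)) (at t)" by (rule der_e[OF ok])
    show "((\<lambda>t. Yt t x) has_real_derivative - (ut t x)\<^sup>2) (at t)" by (rule der_Y[OF ok])
    show "0 \<le> yt t x" "0 \<le> et t x" by (rule pos_t[OF t])+
    show "yt t x * et t x = (vt t x)\<^sup>2" by (rule rel_t[OF t])
    show "ut t x = ct t + kint M ker_le (vt t) x" using ut_eq[OF ok] by (simp add: Wt_def)
    show "Yt t x = Xt t + kint M ker_le (yt t) x" by (rule Yt_def)
    show "(\<integral>z. vt t z \<partial>M) = 0" "(\<integral>z. yt t z \<partial>M) = 1" "(\<integral>z. et t z \<partial>M) = h"
      using pqr_zero[OF t] by (auto simp: pp_def qq_def rr_def)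
    show "(\<integral>z. ut t z * (yt t z - et t z) \<partial>M) = m"
      using pqr_zero[OF t] int_uydiff[OF ok] by simp
    show "((\<lambda>t. ut t x) has_real_derivative
          kint M ker_le (\<lambda>z. ut t z * (yt t z - et t z) - m * yt t z) x
          - (\<integral>z. kint M ker_le (\<lambda>z. ut t z * (yt t z - et t z) - m * yt t z) z * (yt t z - et t z) \<partial>M) / (1 - h)) (at t)"
      using der_u[OF t, of x] unfolding Gt_def .
  qed (use h time_step_pos meas_t ae_pos in simp_all)
  then show thesis by (rule that)
qed

end

section \<open>Solving the coefficient recursion\<close>

lemma conv_cong:
  assumes "\<And>i. i \<le> n \<Longrightarrow> a i = a' i" "\<And>i. i \<le> n \<Longrightarrow> b i = b' i"
  shows "conv a b n = conv a' b' n"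
  unfolding conv_def[abs_def] using assms by (intro ext sum.cong) auto

lemma ucoef_cong:
  assumes "\<And>i. i \<le> n \<Longrightarrow> y i = y' i" "\<And>i. i \<le> n \<Longrightarrow> v i = v' i" "\<And>i. i \<le> n \<Longrightarrow> e i = e' i"
  shows "ucoef M h m y v e n = ucoef M h m y' v' e' n"
proof -
  have "conv (vint M v) (coeff_diff y e) n = conv (vint M v') (coeff_diff y' e') n"
    using assms by (intro conv_cong) (simp_all add: vint_def coeff_diff_def[abs_def])
  then show ?thesis using assms(2)[of n] by (simp add: ucoef_def[abs_def] ccoef_def vint_def)
qed

text \<open>Coefficient n + 1 depends only on coefficients up to n, also through the integrals in
  \<open>ccoef\<close>; this is what the congruence lemmas provide for the recursion on histories.
  The initial values of \<open>C\<close> and \<open>X\<close> are recorded because they decide which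
  function of \<open>x\<close> is recovered at time 0.\<close>

theorem lagrangian_flow:
  fixes y0 v0 e0 :: "real \<Rightarrow> real"
  assumes M: "noatom M" and h: "0 \<le> h" "h \<noteq> 1"
    and meas0: "y0 \<in> borel_measurable borel" "v0 \<in> borel_measurable borel" "e0 \<in> borel_measurable borel"
    and pos0: "\<And>x. 0 < y0 x" "\<And>x. 0 \<le> e0 x"
    and rel0: "\<And>x. y0 x + e0 x = 1" "\<And>x. y0 x * e0 x = (v0 x)\<^sup>2"
    and tot0: "(\<integral>z. v0 z \<partial>M) = 0" "(\<integral>z. y0 z \<partial>M) = 1" "(\<integral>z. e0 z \<partial>M) = h"
  obtains B y v e U Y C X where "lagrangian M (time_step h m) h m B y v e U Y C X"
    "y 0 = y0" "v 0 = v0" "e 0 = e0"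
    "C 0 = (m - (\<integral>z. kint M ker_le v0 z * (y0 z - e0 z) \<partial>M)) / (1 - h)" "X 0 = 0"
proof -
  define st where "st n Z =
    (let y = (\<lambda>i. fst (Z i)); v = (\<lambda>i. fst (snd (Z i))); e = (\<lambda>i. snd (snd (Z i))); u = ucoef M h m y v e in
     (\<lambda>x. - 2 * conv u v n x / (real n + 1),
      \<lambda>x. (conv u (coeff_diff y e) n x - m * y n x) / (real n + 1),
      \<lambda>x. 2 * (conv u v n x - m * v n x) / (real n + 1)))"
    for n and Z :: "nat \<Rightarrow> (real \<Rightarrow> real) \<times> (real \<Rightarrow> real) \<times> (real \<Rightarrow> real)"
  have "st n f = st n g" if "\<And>i. i \<le> n \<Longrightarrow> f i = g i" for n f g
  proof -
    let ?y = "\<lambda>Z i. fst (Z i)" and ?v = "\<lambda>Z i. fst (snd (Z i))" and ?e = "\<lambda>Z i. snd (snd (Z i))"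
    let ?u = "\<lambda>Z. ucoef M h m (?y Z) (?v Z) (?e Z)"
    have "conv (?u f) (?v f) n = conv (?u g) (?v g) n"
      using that by (intro conv_cong ucoef_cong) auto
    moreover have "conv (?u f) (coeff_diff (?y f) (?e f)) n = conv (?u g) (coeff_diff (?y g) (?e g)) n"
      using that by (intro conv_cong ucoef_cong) (auto simp: coeff_diff_def fun_eq_iff)
    ultimately show ?thesis unfolding st_def Let_def using that[of n] by simp
  qed
  from history_recursion[of st "(y0, v0, e0)", OF this] obtain Z
    where Z: "Z 0 = (y0, v0, e0)" "\<And>n. Z (Suc n) = st n Z" by auto
  define y v e where "y i = fst (Z i)" and "v i = fst (snd (Z i))" and "e i = snd (snd (Z i))" for i
  have zero: "y 0 = y0" "v 0 = v0" "e 0 = e0" using Z by (auto simp: y_def v_def e_def)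
  interpret noatom M by fact
  interpret lagrangian_series M h m y v e
  proof
    fix n x
    have eq: "(\<lambda>i. fst (Z i)) = y" "(\<lambda>i. fst (snd (Z i))) = v" "(\<lambda>i. snd (snd (Z i))) = e"
      by (auto simp: y_def v_def e_def)
    show "y (Suc n) x = - 2 * conv (ucoef M h m y v e) v n x / (real n + 1)"
      "v (Suc n) x = (conv (ucoef M h m y v e) (coeff_diff y e) n x - m * y n x) / (real n + 1)"
      "e (Suc n) x = 2 * (conv (ucoef M h m y v e) v n x - m * v n x) / (real n + 1)"
      unfolding y_def[of "Suc n"] v_def[of "Suc n"] e_def[of "Suc n"] Z(2)
      by (simp_all add: st_def Let_def eq)
  qed (use zero assms in auto)
  obtain B where L: "lagrangian M (time_step h m) h m B yt vt et ut Yt ct Xt" by (rule lagrangian_solution)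
  have "yt 0 = y0" "vt 0 = v0" "et 0 = e0" using zero by (auto simp: yt_def vt_def et_def fun_eq_iff)
  moreover have "Xt 0 = 0" by (simp add: Xt_def xc_def icoeff_def)
  moreover have "ct 0 = (m - (\<integral>z. kint M ker_le v0 z * (y0 z - e0 z) \<partial>M)) / (1 - h)"
    by (simp add: ct_def ccoef_def conv_def vint_def coeff_diff_def zero)
  ultimately show thesis using that[OF L] by blast
qed

section \<open>Change of variables to the circle\<close>

lemma frac_measurable [measurable]: "(frac :: real \<Rightarrow> real) \<in> borel_measurable borel"
  unfolding frac_def[abs_def] by measurable

lemma emeasure_unit_tail:
  "emeasure (density lborel (indicator {0..1})) {z<..} = ennreal (1 - max 0 (min 1 z))" for z :: real
proof -
  have "emeasure (density lborel (indicator {0..1})) {z<..} = emeasure lborel ({0..1} \<inter> {z<..})"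
    by (simp add: emeasure_density flip: indicator_inter_arith)
  also consider "z < 0" | "0 \<le> z" "z \<le> 1" | "1 < z" by linarith
  then have "emeasure lborel ({0..1} \<inter> {z<..}) = ennreal (1 - max 0 (min 1 z))"
  proof cases
    case 1 then have "{0..1} \<inter> {z<..} = {0..1}" by auto
    then show ?thesis using 1 by simp
  next
    case 2 then have "{0..1} \<inter> {z<..} = {z<..1}" by auto
    then show ?thesis using 2 by simp
  next
    case 3 then have "{0..1} \<inter> {z<..} = {}" by auto
    then show ?thesis using 3 by simp
  qed
  finally show ?thesis .
qed

text \<open>Both measures are finite and are compared on right half-lines. The interval is cut at
  the first integer \<open>n\<close> above \<open>a\<close>: \<open>frac\<close> subtracts
  \<open>n - 1\<close> before the cut and \<open>n\<close> after it, and the two images tile the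
  unit interval.\<close>

lemma distr_frac:
  fixes a :: real
  shows "distr (density lborel (indicator {a..a + 1})) borel frac = density lborel (indicator {0..1})"
proof (rule measure_eqI_lessThan)
  define n where "n = of_int \<lfloor>a\<rfloor> + (1::real)"
  have n: "n - 1 \<le> a" "a < n" unfolding n_def by linarith+
  have fr: "frac x = x - (n - 1)" if "a \<le> x" "x < n" for x
  proof -
    have "\<lfloor>x\<rfloor> = \<lfloor>a\<rfloor>" using that unfolding n_def by (intro floor_unique) linarith+
    then show ?thesis by (simp add: frac_def n_def)
  qed
  have fr': "frac x = x - n" if "n \<le> x" "x < a + 1" for x
  proof -
    have "\<lfloor>x\<rfloor> = \<lfloor>a\<rfloor> + 1"
    proof (rule floor_unique)
      show "of_int (\<lfloor>a\<rfloor> + 1) \<le> x" using that(1) by (simp add: n_def)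
      show "x < of_int (\<lfloor>a\<rfloor> + 1) + 1"
        using that(2) n(2) unfolding n_def of_int_add of_int_1 by linarith
    qed
    then show ?thesis by (simp add: frac_def n_def)
  qed
  show "emeasure (distr (density lborel (indicator {a..a + 1})) borel frac) {z<..}
      = emeasure (density lborel (indicator {0..1})) {z<..}" for z
  proof -
    let ?A = "frac -` {z<..} \<inter> {a..<a + 1}"
    have m: "frac -` {z<..} \<in> sets borel" using measurable_sets_borel[OF frac_measurable, of "{z<..}"] by simp
    have "emeasure (distr (density lborel (indicator {a..a + 1})) borel frac) {z<..}
       = emeasure (density lborel (indicator {a..a + 1})) (frac -` {z<..})"
      by (subst emeasure_distr) auto
    also have "\<dots> = emeasure lborel ({a..a + 1} \<inter> frac -` {z<..})"
      using m by (simp add: emeasure_density flip: indicator_inter_arith)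
    also have "\<dots> = emeasure lborel ?A"
    proof (rule emeasure_eq_AE)
      show "AE x in lborel. x \<in> {a..a + 1} \<inter> frac -` {z<..} \<longleftrightarrow> x \<in> ?A"
        using AE_lborel_singleton[of "a + 1"] by eventually_elim auto
    qed (use m in auto)
    also have "\<dots> = ennreal (1 - max 0 (min 1 z))"
    proof -
      consider "z < 0" | "1 \<le> z" | "0 \<le> z" "z < 1" "a \<le> z + n - 1" | "0 \<le> z" "z < 1" "z + n - 1 < a" by linarith
      then show ?thesis
      proof cases
        case 1
        have "?A = {a..<a + 1}" using 1 by (auto intro: less_le_trans[OF _ frac_ge_0])
        then show ?thesis using 1 by simp
      next
        case 2
        have "\<not> z < frac x" for x using frac_lt_1[of x] 2 by linarith
        then have "?A = {}" by auto
        then show ?thesis using 2 by simp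
      next
        case 3
        have "?A = {z + n - 1<..<n}"
        proof (intro set_eqI)
          fix x show "x \<in> ?A \<longleftrightarrow> x \<in> {z + n - 1<..<n}"
            using 3 n fr[of x] fr'[of x] by (cases "x < n") auto
        qed
        then show ?thesis using 3 by simp
      next
        case 4
        have "?A = {a..<n} \<union> {z + n<..<a + 1}"
        proof (intro set_eqI)
          fix x show "x \<in> ?A \<longleftrightarrow> x \<in> {a..<n} \<union> {z + n<..<a + 1}"
            using 4 n fr[of x] fr'[of x] by (cases "x < n") auto
        qed
        moreover have "{a..<n} \<inter> {z + n<..<a + 1} = {}" using 4 by auto
        ultimately have "emeasure lborel ?A = emeasure lborel {a..<n} + emeasure lborel {z + n<..<a + 1}"
          by (simp add: plus_emeasure)
        also have "\<dots> = ennreal (n - a) + ennreal (a + 1 - (z + n))" using 4 n by simp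
        also have "\<dots> = ennreal (1 - z)" using 4 n by (subst ennreal_plus[symmetric]) auto
        finally show ?thesis using 4 by simp
      qed
    qed
    finally show ?thesis by (simp only: emeasure_unit_tail)
  qed
  show "emeasure (distr (density lborel (indicator {a..a + 1})) borel frac) {z<..} < \<infinity>" for z
    unfolding \<open>\<And>z. emeasure (distr (density lborel (indicator {a..a + 1})) borel frac) {z<..}
      = emeasure (density lborel (indicator {0..1})) {z<..}\<close> emeasure_unit_tail by simp
qed simp_all

lemma periodic1_frac: assumes "periodic1 g" shows "g (frac x) = g x"
proof -
  have 1: "g (x + real n) = g x" for x n
  proof (induction n)
    case (Suc n)
    have "g (x + real (Suc n)) = g ((x + real n) + 1)" by (simp add: add_ac)
    also have "\<dots> = g (x + real n)" using assms unfolding periodic1_def by blast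
    finally show ?case using Suc by simp
  qed simp
  have "g (x + of_int k) = g x" for x k
  proof (cases "k \<ge> 0")
    case True then show ?thesis using 1[of x "nat k"] by simp
  next
    case False then show ?thesis using 1[of "x + of_int k" "nat (-k)"] by simp
  qed
  from this[of x "- \<lfloor>x\<rfloor>"] show ?thesis by (simp add: frac_def)
qed

text \<open>Dominated convergence: the indicators of the half-lines converge everywhere except at
  the limit point, which carries no mass.\<close>

lemma (in noatom) kint_ker_le_continuous:
  assumes "bdd_meas f" shows "continuous_on UNIV (kint M ker_le f)"
proof -
  obtain B where B: "B \<ge> 0" "\<And>x. \<bar>f x\<bar> \<le> B" using bdd_measE[OF assms] by metis
  note [measurable] = bdd_meas_measurable[OF assms]
  have "(\<lambda>n. kint M ker_le f (r n)) \<longlonglongrightarrow> kint M ker_le f x" if "r \<longlonglongrightarrow> x" for r :: "nat \<Rightarrow> real" and x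
    unfolding kint_ker_le
  proof (rule integral_dominated_convergence[where w = "\<lambda>_. B"])
    have "AE z in M. z \<noteq> x" by (rule AE_I[where N = "{x}"]) (auto simp: noatom)
    then show "AE z in M. (\<lambda>n. indicator {..r n} z * f z) \<longlonglongrightarrow> indicator {..x} z * f z"
    proof eventually_elim
      case (elim z)
      have "eventually (\<lambda>n. indicator {..r n} z = (indicator {..x} z :: real)) sequentially"
      proof (cases "z < x")
        case True
        then have "eventually (\<lambda>n. z < r n) sequentially" by (rule order_tendstoD(1)[OF that])
        then show ?thesis by eventually_elim (use True in auto)
      next
        case False
        then have "x < z" using elim by simp
        then have "eventually (\<lambda>n. r n < z) sequentially" by (rule order_tendstoD(2)[OF that])
        then show ?thesis by eventually_elim (use \<open>x < z\<close> in auto)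
      qed
      then have "eventually (\<lambda>n. indicator {..r n} z * f z = indicator {..x} z * f z) sequentially"
        by eventually_elim simp
      then show ?case by (rule tendsto_eventually)
    qed
    show "AE z in M. norm (indicator {..r n} z * f z) \<le> B" for n
      using B by (auto simp: indicator_def)
  qed (auto intro: bdd_meas_integrable bdd_meas_intros)
  then show ?thesis by (auto simp: continuous_on_sequentially o_def)
qed

lemma bdd_meas_slice:
  assumes "(\<lambda>(t, x). f t x) \<in> borel_measurable (borel \<Otimes>\<^sub>M borel)" "\<And>x. \<bar>f t x\<bar> \<le> B"
  shows "bdd_meas (f t)"
proof (rule bdd_measI[OF _ assms(2)])
  note [measurable] = assms(1)
  show "f t \<in> borel_measurable borel" by measurable
qed

text \<open>The labels fill the open unit interval without gaps: by \<open>supp\<close> the labels 0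
  and 1 stand for the same point of the circle, and by \<open>pint\<close> the flow map is injective
  between them whenever \<open>y\<close> is positive almost everywhere.\<close>

locale eulerian = lagrangian M s h m B y v e U Y C X
  for M :: "real measure" and s h m B :: real and y v e U Y :: "real \<Rightarrow> real \<Rightarrow> real" and C X :: "real \<Rightarrow> real" +
  assumes supp: "AE x in M. x \<in> {0<..<1}"
    and pint: "\<And>a b. 0 \<le> a \<Longrightarrow> a < b \<Longrightarrow> b \<le> 1 \<Longrightarrow> emeasure M {a<..<b} \<noteq> 0"
begin

definition "rng t \<longleftrightarrow> 0 \<le> t \<and> t \<le> s"
definition "nondeg t \<longleftrightarrow> rng t \<and> (AE x in M. 0 < y t x)"

lemma bdd_meas_t: assumes "rng t" shows "bdd_meas (y t)" "bdd_meas (v t)" "bdd_meas (e t)" "bdd_meas (U t)"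
  using meas bd assms unfolding rng_def by (auto intro!: bdd_meas_slice)

text \<open>In Eulerian terms \<open>W\<close> is the label density of
  \<open>u - u u_x^2 - m\<close>, \<open>G\<close> its primitive started at label 0,
  \<open>F\<close> the counterpart of \<open>f\<close> for that primitive, and \<open>P\<close> is
  \<open>u_t - u^2 u_x\<close> along the flow.\<close>

definition "W t z = U t z * (y t z - e t z) - m * y t z"
definition "G t = kint M ker_le (W t)"
definition "F t = (\<integral>z. G t z * (y t z - e t z) \<partial>M) / (1 - h)"
definition "P t z = G t z - F t"

lemma bdd_meas_W: assumes "rng t" shows "bdd_meas (W t)" "bdd_meas (G t)" "bdd_meas (P t)"
proof -
  show w: "bdd_meas (W t)" unfolding W_def[abs_def] by (intro bdd_meas_intros bdd_meas_t assms)
  then show g: "bdd_meas (G t)" unfolding G_def by (intro bdd_meas_intros kernel_ker_le)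
  then show "bdd_meas (P t)" unfolding P_def[abs_def] by (intro bdd_meas_intros)
qed

lemma Y_eq': "rng t \<Longrightarrow> Y t x = X t + kint M ker_le (y t) x"
  using Y_eq unfolding rng_def by auto

lemma U_eq': "rng t \<Longrightarrow> U t x = C t + kint M ker_le (v t) x"
  using U_eq unfolding rng_def by auto

lemma y_nonneg: "rng t \<Longrightarrow> 0 \<le> y t x" using pos unfolding rng_def by auto

lemma Y_cont: "rng t \<Longrightarrow> continuous_on UNIV (Y t)"
  using kint_ker_le_continuous[OF bdd_meas_t(1)] Y_eq'[of t]
  by (simp add: continuous_on_add[OF continuous_on_const] cong: continuous_on_cong)

lemma Y_diff: assumes "rng t" "a \<le> b" shows "Y t b - Y t a = (\<integral>z. indicator {a<..b} z * y t z \<partial>M)"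
proof -
  have i: "integrable M (\<lambda>z. indicator {..b} z * y t z)" "integrable M (\<lambda>z. indicator {..a} z * y t z)"
    by (intro bdd_meas_integrable bdd_meas_intros bdd_meas_t assms; simp)+
  have "Y t b - Y t a = (\<integral>z. indicator {..b} z * y t z - indicator {..a} z * y t z \<partial>M)"
    using i assms by (simp add: Y_eq' kint_ker_le)
  also have "\<dots> = (\<integral>z. indicator {a<..b} z * y t z \<partial>M)"
    using assms by (intro Bochner_Integration.integral_cong refl) (auto simp: indicator_def)
  finally show ?thesis .
qed

lemma Y_mono: "rng t \<Longrightarrow> a \<le> b \<Longrightarrow> Y t a \<le> Y t b"
proof -
  assume "rng t" "a \<le> b"
  moreover from this have "0 \<le> (\<integral>z. indicator {a<..b} z * y t z \<partial>M)"
    by (intro Bochner_Integration.integral_nonneg mult_nonneg_nonneg y_nonneg) auto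
  ultimately show ?thesis using Y_diff[of t a b] by simp
qed

lemma kint_0: assumes "a \<le> 0" "bdd_meas f" shows "kint M ker_le f a = 0"
proof -
  note [measurable] = bdd_meas_measurable[OF assms(2)]
  have "kint M ker_le f a = (\<integral>z. 0 \<partial>M)" unfolding kint_ker_le
  proof (rule integral_cong_AE)
    show "AE z in M. indicator {..a} z * f z = 0"
      using supp by eventually_elim (use assms in \<open>auto simp: indicator_def\<close>)
  qed measurable
  then show ?thesis by simp
qed

lemma kint_1: assumes "1 \<le> a" "bdd_meas f" shows "kint M ker_le f a = (\<integral>z. f z \<partial>M)"
proof -
  note [measurable] = bdd_meas_measurable[OF assms(2)]
  show ?thesis unfolding kint_ker_le
  proof (rule integral_cong_AE)
    show "AE z in M. indicator {..a} z * f z = f z"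
      using supp by eventually_elim (use assms in \<open>auto simp: indicator_def\<close>)
  qed measurable
qed

lemma Y_0: "rng t \<Longrightarrow> a \<le> 0 \<Longrightarrow> Y t a = X t"
  by (simp add: Y_eq' kint_0 bdd_meas_t)

lemma Y_1: "rng t \<Longrightarrow> 1 \<le> a \<Longrightarrow> Y t a = X t + 1"
  using tot(2)[of t] by (simp add: Y_eq' kint_1 bdd_meas_t rng_def)

lemma Y_range: "rng t \<Longrightarrow> X t \<le> Y t a \<and> Y t a \<le> X t + 1"
  using Y_mono[of t "min a 0" a] Y_mono[of t a "max a 1"] Y_0[of t "min a 0"] Y_1[of t "max a 1"] by auto

lemma Y_strict:
  assumes g: "nondeg t" and ab: "0 \<le> a" "a < b" "b \<le> 1"
  shows "Y t a < Y t b"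
proof -
  have r: "rng t" using g by (simp add: nondeg_def)
  note [measurable] = bdd_meas_measurable[OF bdd_meas_t(1)[OF r]]
  have "(\<integral>z. indicator {a<..b} z * y t z \<partial>M) \<noteq> 0"
  proof
    assume "(\<integral>z. indicator {a<..b} z * y t z \<partial>M) = 0"
    moreover have "integrable M (\<lambda>z. indicator {a<..b} z * y t z)"
      by (intro bdd_meas_integrable bdd_meas_intros bdd_meas_t r; simp)
    ultimately have "AE z in M. indicator {a<..b} z * y t z = 0"
      using y_nonneg[OF r] by (subst (asm) integral_nonneg_eq_0_iff_AE) auto
    moreover have "AE z in M. 0 < y t z" using g by (simp add: nondeg_def)
    ultimately have "AE z in M. z \<notin> {a<..<b}"
      by eventually_elim (auto simp: indicator_def split: if_splits)
    then have "emeasure M {z \<in> space M. \<not> z \<notin> {a<..<b}} = 0"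
      by (subst (asm) AE_iff_measurable[OF _ refl]) auto
    then show False using pint[OF ab] by (simp add: greaterThanLessThan_def greaterThan_def lessThan_def Int_def)
  qed
  then show ?thesis using Y_diff[OF r, of a b] Y_mono[OF r, of a b] ab by auto
qed

text \<open>Because \<open>Y t\<close> is continuous and monotone, the superlevel set of an interior
  height \<open>x\<close> is a half-line \<open>{c<..}\<close> with \<open>Y t c = x\<close>, and
  its mass is the increment of \<open>Y t\<close> to the right of \<open>c\<close>. Stretches of
  labels where \<open>y\<close> vanishes collapse to a point and carry no mass.\<close>

lemma distr_Y:
  assumes r: "rng t"
  shows "distr (density M (\<lambda>z. ennreal (y t z))) borel (Y t) = density lborel (indicator {X t..X t + 1})"
proof (rule measure_eqI_lessThan)
  note [measurable] = bdd_meas_measurable[OF bdd_meas_t(1)[OF r]]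
  have [measurable]: "Y t \<in> borel_measurable borel" using Y_cont[OF r] by (rule borel_measurable_continuous_onI)
  have em: "emeasure (distr (density M (\<lambda>z. ennreal (y t z))) borel (Y t)) {x<..}
     = ennreal (\<integral>z. indicator {z. x < Y t z} z * y t z \<partial>M)" for x
  proof -
    have s: "{z. x < Y t z} \<in> sets borel" by measurable
    have "emeasure (distr (density M (\<lambda>z. ennreal (y t z))) borel (Y t)) {x<..}
      = emeasure (density M (\<lambda>z. ennreal (y t z))) {z. x < Y t z}"
      by (subst emeasure_distr) (auto simp: vimage_def)
    also have "\<dots> = (\<integral>\<^sup>+z. ennreal (y t z) * indicator {z. x < Y t z} z \<partial>M)"
      using s by (subst emeasure_density) auto
    also have "\<dots> = (\<integral>\<^sup>+z. ennreal (indicator {z. x < Y t z} z * y t z) \<partial>M)"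
      by (intro nn_integral_cong) (auto simp: indicator_def)
    also have "\<dots> = ennreal (\<integral>z. indicator {z. x < Y t z} z * y t z \<partial>M)"
      using y_nonneg[OF r] s by (intro nn_integral_eq_integral bdd_meas_integrable bdd_meas_intros bdd_meas_t r) auto
    finally show ?thesis .
  qed
  have em2: "emeasure (density lborel (indicator {X t..X t + 1})) {x<..} = emeasure lborel ({X t..X t + 1} \<inter> {x<..})" for x
    by (simp add: emeasure_density flip: indicator_inter_arith)
  show "emeasure (distr (density M (\<lambda>z. ennreal (y t z))) borel (Y t)) {x<..}
      = emeasure (density lborel (indicator {X t..X t + 1})) {x<..}" for x
  proof -
    consider "x < X t" | "X t + 1 \<le> x" | "X t \<le> x" "x < X t + 1" by linarith
    then show ?thesis
    proof cases
      case 1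
      then have "{z. x < Y t z} = UNIV" using Y_range[OF r] by (auto intro: less_le_trans)
      moreover have "{X t..X t + 1} \<inter> {x<..} = {X t..X t + 1}" using 1 by auto
      ultimately show ?thesis unfolding em em2 using tot(2)[of t] r by (simp add: rng_def)
    next
      case 2
      have "Y t z \<le> x" for z using Y_range[OF r, of z] 2 by linarith
      then have "{z. x < Y t z} = {}" by (auto simp: not_less)
      moreover have "{X t..X t + 1} \<inter> {x<..} = {}" using 2 by auto
      ultimately show ?thesis unfolding em em2 by simp
    next
      case 3
      \<comment> \<open>The last label in [0, 1] with \<open>Y t z \<le> x\<close> is wanted; taking
        the last one passes over any plateau of \<open>Y t\<close> at height
        \<open>x\<close>.\<close>
      define S where "S = {z \<in> {0..1}. Y t z \<le> x}"
      have ne: "0 \<in> S" using 3 Y_0[OF r, of 0] by (auto simp: S_def)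
      have cl: "compact S"
      proof -
        have "S = {0..1} \<inter> (Y t -` {..x})" by (auto simp: S_def)
        moreover have "closed (Y t -` {..x})" using Y_cont[OF r] by (intro closed_vimage) auto
        ultimately show ?thesis by (simp add: compact_Int_closed)
      qed
      then obtain c where c: "c \<in> S" "\<And>z. z \<in> S \<Longrightarrow> z \<le> c" using compact_attains_sup[of S] ne by blast
      have Yc: "Y t c = x"
      proof (rule ccontr)
        assume "Y t c \<noteq> x"
        then have lt: "Y t c < x" using c by (auto simp: S_def)
        have "\<exists>z\<ge>c. z \<le> 1 \<and> Y t z = x"
        proof (rule IVT')
          show "Y t c \<le> x" using lt by simp
          show "x \<le> Y t 1" using 3 Y_1[OF r, of 1] by simp
          show "c \<le> 1" using c by (simp add: S_def)
          show "continuous_on {c..1} (Y t)" using Y_cont[OF r] continuous_on_subset by blast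
        qed
        then obtain z where "c \<le> z" "z \<le> 1" "Y t z = x" by blast
        moreover from this have "z \<in> S" using c(1) by (auto simp: S_def)
        ultimately show False using c(2)[of z] lt by auto
      qed
      have set: "x < Y t z \<longleftrightarrow> c < z" for z
      proof
        assume "x < Y t z" then show "c < z" using Y_mono[OF r, of z c] Yc by (cases "c < z") auto
      next
        assume "c < z"
        show "x < Y t z"
        proof (rule ccontr)
          assume "\<not> x < Y t z"
          moreover have "z < 1 \<or> 1 \<le> z" by linarith
          ultimately have "z \<in> S" using 3 Y_1[OF r, of z] \<open>c < z\<close> c(1) by (auto simp: S_def)
          then show False using c(2)[of z] \<open>c < z\<close> by simp
        qed
      qed
      then have "{z. x < Y t z} = {c<..}" by auto
      then have "(\<integral>z. indicator {z. x < Y t z} z * y t z \<partial>M) = (\<integral>z. indicator {c<..} z * y t z \<partial>M)" by simp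
      also have "\<dots> = (\<integral>z. y t z - indicator {..c} z * y t z \<partial>M)"
        by (intro Bochner_Integration.integral_cong refl) (auto simp: indicator_def)
      also have "\<dots> = (\<integral>z. y t z \<partial>M) - (\<integral>z. indicator {..c} z * y t z \<partial>M)"
        by (intro Bochner_Integration.integral_diff bdd_meas_integrable bdd_meas_intros bdd_meas_t r) auto
      also have "\<dots> = X t + 1 - x"
        using tot(2)[of t] r Y_eq'[OF r, of c] Yc by (simp add: rng_def kint_ker_le)
      finally have "emeasure (distr (density M (\<lambda>z. ennreal (y t z))) borel (Y t)) {x<..} = ennreal (X t + 1 - x)"
        unfolding em by simp
      moreover have "{X t..X t + 1} \<inter> {x<..} = {x<..X t + 1}" using 3 by auto
      ultimately show ?thesis unfolding em2 using 3 by simp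
    qed
  qed
  show "emeasure (distr (density M (\<lambda>z. ennreal (y t z))) borel (Y t)) {x<..} < \<infinity>" for x
    unfolding em by simp
qed simp_all

lemma distr_frac_Y:
  assumes r: "rng t"
  shows "distr (density M (\<lambda>z. ennreal (y t z))) borel (\<lambda>z. frac (Y t z)) = density lborel (indicator {0..1})"
proof -
  have [measurable]: "Y t \<in> borel_measurable borel" using Y_cont[OF r] by (rule borel_measurable_continuous_onI)
  have "distr (density M (\<lambda>z. ennreal (y t z))) borel (\<lambda>z. frac (Y t z))
     = distr (distr (density M (\<lambda>z. ennreal (y t z))) borel (Y t)) borel frac"
    by (subst distr_distr) (auto simp: comp_def)
  also have "\<dots> = density lborel (indicator {0..1})" unfolding distr_Y[OF r] by (rule distr_frac)
  finally show ?thesis .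
qed

text \<open>The flow map covers one period starting at the moving point \<open>X t\<close>, with
  density \<open>y\<close>; for periodic integrands the starting point of the period is
  irrelevant.\<close>

lemma circle_cv:
  fixes g :: "real \<Rightarrow> real"
  assumes r: "rng t" and g: "g \<in> borel_measurable borel" "periodic1 g"
  shows "(LINT x:{0..1}|lborel. g x) = (\<integral>z. y t z * g (Y t z) \<partial>M)"
    "set_integrable lborel {0..1} g \<longleftrightarrow> integrable M (\<lambda>z. y t z * g (Y t z))"
proof -
  note [measurable] = bdd_meas_measurable[OF bdd_meas_t(1)[OF r]] g(1)
  have [measurable]: "Y t \<in> borel_measurable borel" using Y_cont[OF r] by (rule borel_measurable_continuous_onI)
  let ?D = "density M (\<lambda>z. ennreal (y t z))" and ?I = "density lborel (\<lambda>x. ennreal (indicator {0..1} x))"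
  have I: "?I = distr ?D borel (\<lambda>z. frac (Y t z))"
    using distr_frac_Y[OF r] by (simp add: ennreal_indicator)
  have "(LINT x:{0..1}|lborel. g x) = (\<integral>x. g x \<partial>?I)"
    unfolding set_lebesgue_integral_def by (subst integral_density) auto
  also have "\<dots> = (\<integral>z. g (frac (Y t z)) \<partial>?D)" unfolding I by (subst integral_distr) auto
  also have "\<dots> = (\<integral>z. y t z * g (Y t z) \<partial>M)"
    using y_nonneg[OF r] by (subst integral_density) (auto simp: periodic1_frac[OF g(2)])
  finally show "(LINT x:{0..1}|lborel. g x) = (\<integral>z. y t z * g (Y t z) \<partial>M)" .
  have "set_integrable lborel {0..1} g \<longleftrightarrow> integrable ?I g"
    unfolding set_integrable_def by (subst integrable_density) auto
  also have "\<dots> \<longleftrightarrow> integrable ?D (\<lambda>z. g (frac (Y t z)))" unfolding I by (subst integrable_distr_eq) auto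
  also have "\<dots> \<longleftrightarrow> integrable M (\<lambda>z. y t z * g (Y t z))"
    using y_nonneg[OF r] by (subst integrable_density) (auto simp: periodic1_frac[OF g(2)])
  finally show "set_integrable lborel {0..1} g \<longleftrightarrow> integrable M (\<lambda>z. y t z * g (Y t z))" .
qed

end

section \<open>The Eulerian solution and its weak identities\<close>

text \<open>One total derivative with continuous partials is all that the weak identities use.
  Carrying the partials as data keeps \<open>deriv\<close> out of the computations and makes the
  class stable under time shifts.\<close>

definition test_triple :: "(real \<Rightarrow> real \<Rightarrow> real) \<Rightarrow> (real \<Rightarrow> real \<Rightarrow> real) \<Rightarrow> (real \<Rightarrow> real \<Rightarrow> real) \<Rightarrow> bool" where
  "test_triple p pt px \<longleftrightarrow>
     (\<forall>t x. ((\<lambda>q. p (fst q) (snd q)) has_derivative (\<lambda>d. pt t x * fst d + px t x * snd d)) (at (t, x))) \<and>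
     continuous_on UNIV (\<lambda>q. pt (fst q) (snd q)) \<and> continuous_on UNIV (\<lambda>q. px (fst q) (snd q)) \<and>
     (\<forall>t. periodic1 (p t)) \<and> (\<forall>t. periodic1 (pt t)) \<and> (\<forall>t. periodic1 (px t))"

lemma test_triple_cont: assumes "test_triple p pt px"
  shows "continuous_on UNIV (\<lambda>q. p (fst q) (snd q))" "continuous_on UNIV (\<lambda>q. pt (fst q) (snd q))"
    "continuous_on UNIV (\<lambda>q. px (fst q) (snd q))"
proof -
  show "continuous_on UNIV (\<lambda>q. p (fst q) (snd q))"
  proof (intro continuous_at_imp_continuous_on ballI)
    fix q :: "real \<times> real"
    have "((\<lambda>q. p (fst q) (snd q)) has_derivative (\<lambda>d. pt (fst q) (snd q) * fst d + px (fst q) (snd q) * snd d))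
       (at (fst q, snd q))"
      using assms unfolding test_triple_def by blast
    then show "isCont (\<lambda>q. p (fst q) (snd q)) q" using has_derivative_continuous by fastforce
  qed
qed (use assms in \<open>auto simp: test_triple_def\<close>)

lemma cont2_measurable:
  fixes f :: "real \<Rightarrow> real \<Rightarrow> real"
  assumes "continuous_on UNIV (\<lambda>q. f (fst q) (snd q))"
  shows "(\<lambda>(t, x). f t x) \<in> borel_measurable (borel \<Otimes>\<^sub>M borel)"
proof -
  have "(\<lambda>q. f (fst q) (snd q)) \<in> borel_measurable borel"
    using assms by (rule borel_measurable_continuous_onI)
  then show ?thesis by (simp add: borel_prod split_beta)
qed

lemma test_triple_measurable: assumes "test_triple p pt px"
  shows "(\<lambda>(t, x). p t x) \<in> borel_measurable (borel \<Otimes>\<^sub>M borel)"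
    "(\<lambda>(t, x). pt t x) \<in> borel_measurable (borel \<Otimes>\<^sub>M borel)"
    "(\<lambda>(t, x). px t x) \<in> borel_measurable (borel \<Otimes>\<^sub>M borel)"
  by (intro cont2_measurable test_triple_cont[OF assms])+

lemma periodic_bounded:
  fixes f :: "real \<Rightarrow> real \<Rightarrow> real"
  assumes "continuous_on UNIV (\<lambda>q. f (fst q) (snd q))" "\<And>t. periodic1 (f t)"
  shows "\<exists>K. \<forall>t x. 0 \<le> t \<and> t \<le> b \<longrightarrow> \<bar>f t x\<bar> \<le> K"
proof -
  have "compact ((\<lambda>q. f (fst q) (snd q)) ` ({0..b} \<times> {0..1}))"
    using assms(1) by (intro compact_continuous_image compact_Times) (auto intro: continuous_on_subset)
  then have "bounded ((\<lambda>q. f (fst q) (snd q)) ` ({0..b} \<times> {0..1}))" by (rule compact_imp_bounded)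
  then obtain K where K': "\<forall>x \<in> (\<lambda>q. f (fst q) (snd q)) ` ({0..b} \<times> {0..1}). norm x \<le> K"
    unfolding bounded_iff by blast
  have K: "\<bar>f (fst q) (snd q)\<bar> \<le> K" if "q \<in> {0..b} \<times> {0..1}" for q
    using K'[rule_format, OF imageI[OF that]] by simp
  have "\<bar>f t x\<bar> \<le> K" if "0 \<le> t" "t \<le> b" for t x
    using K[of "(t, frac x)"] that periodic1_frac[OF assms(2), of t x] frac_lt_1[of x] by simp
  then show ?thesis by blast
qed

lemma test_triple_bounded: assumes "test_triple p pt px"
  obtains K where "\<And>t x. 0 \<le> t \<Longrightarrow> t \<le> b \<Longrightarrow> \<bar>p t x\<bar> \<le> K" "\<And>t x. 0 \<le> t \<Longrightarrow> t \<le> b \<Longrightarrow> \<bar>pt t x\<bar> \<le> K"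
    "\<And>t x. 0 \<le> t \<Longrightarrow> t \<le> b \<Longrightarrow> \<bar>px t x\<bar> \<le> K"
proof -
  have "\<And>t. periodic1 (p t)" "\<And>t. periodic1 (pt t)" "\<And>t. periodic1 (px t)" using assms by (auto simp: test_triple_def)
  note per = this
  obtain K1 where 1: "\<And>t x. 0 \<le> t \<Longrightarrow> t \<le> b \<Longrightarrow> \<bar>p t x\<bar> \<le> K1"
    using periodic_bounded[OF test_triple_cont(1)[OF assms] per(1), of b] by blast
  obtain K2 where 2: "\<And>t x. 0 \<le> t \<Longrightarrow> t \<le> b \<Longrightarrow> \<bar>pt t x\<bar> \<le> K2"
    using periodic_bounded[OF test_triple_cont(2)[OF assms] per(2), of b] by blast
  obtain K3 where 3: "\<And>t x. 0 \<le> t \<Longrightarrow> t \<le> b \<Longrightarrow> \<bar>px t x\<bar> \<le> K3"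
    using periodic_bounded[OF test_triple_cont(3)[OF assms] per(3), of b] by blast
  show thesis
  proof (rule that[of "max K1 (max K2 K3)"])
    show "\<bar>p t x\<bar> \<le> max K1 (max K2 K3)" if "0 \<le> t" "t \<le> b" for t x using 1[OF that, of x] by linarith
    show "\<bar>pt t x\<bar> \<le> max K1 (max K2 K3)" if "0 \<le> t" "t \<le> b" for t x using 2[OF that, of x] by linarith
    show "\<bar>px t x\<bar> \<le> max K1 (max K2 K3)" if "0 \<le> t" "t \<le> b" for t x using 3[OF that, of x] by linarith
  qed
qed

lemma test_triple_x_deriv: assumes "test_triple p pt px" shows "(p t has_real_derivative px t x) (at x)"
proof -
  have "((\<lambda>x. (t, x)) has_derivative (\<lambda>d. (0, d))) (at x)" by (auto intro!: derivative_eq_intros)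
  moreover have "((\<lambda>q. p (fst q) (snd q)) has_derivative (\<lambda>d. pt t x * fst d + px t x * snd d)) (at (t, x))"
    using assms by (simp add: test_triple_def)
  ultimately have "((\<lambda>x. p (fst (t, x)) (snd (t, x))) has_derivative (\<lambda>d. pt t x * fst (0, d) + px t x * snd (0::real, d))) (at x)"
    by (rule has_derivative_compose)
  then show ?thesis by (simp add: has_field_derivative_def mult.commute[of _ "px t x"])
qed

lemma test_triple_curve_deriv:
  assumes "test_triple p pt px" "(\<gamma> has_real_derivative g) (at t)"
  shows "((\<lambda>t. p t (\<gamma> t)) has_real_derivative pt t (\<gamma> t) + px t (\<gamma> t) * g) (at t)"
proof -
  have "((\<lambda>t. (t, \<gamma> t)) has_derivative (\<lambda>d. (d, g * d))) (at t)"
    using assms(2) by (auto intro!: derivative_eq_intros simp: has_field_derivative_def)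
  moreover have "((\<lambda>q. p (fst q) (snd q)) has_derivative (\<lambda>d. pt t (\<gamma> t) * fst d + px t (\<gamma> t) * snd d)) (at (t, \<gamma> t))"
    using assms(1) by (simp add: test_triple_def)
  ultimately have "((\<lambda>t. p (fst (t, \<gamma> t)) (snd (t, \<gamma> t))) has_derivative
      (\<lambda>d. pt t (\<gamma> t) * fst (d, g * d) + px t (\<gamma> t) * snd (d, g * d))) (at t)"
    by (rule has_derivative_compose)
  then have "((\<lambda>t. p t (\<gamma> t)) has_derivative (\<lambda>d. pt t (\<gamma> t) * d + px t (\<gamma> t) * (g * d))) (at t)" by simp
  then show ?thesis unfolding has_field_derivative_def
    by (rule has_derivative_eq_rhs) (simp add: fun_eq_iff algebra_simps)
qed

lemma fin_borel_interval: "fin_borel (density lborel (indicator {a..b::real}))"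
proof -
  have "emeasure (density lborel (indicator {a..b})) UNIV = emeasure lborel {a..b}"
    by (subst emeasure_density) auto
  then interpret finite_measure "density lborel (indicator {a..b})"
    by (intro finite_measureI) (simp add: emeasure_lborel_Icc_eq)
  show ?thesis by unfold_locales simp
qed

text \<open>Fubini moves the time integral inside, where the fundamental theorem of calculus applies
  for each fixed label.\<close>

lemma (in fin_borel) time_FTC:
  assumes b: "0 \<le> b"
    and der: "\<And>t z. 0 \<le> t \<Longrightarrow> t \<le> b \<Longrightarrow> ((\<lambda>t. f t z) has_real_derivative D t z) (at t)"
    and meas: "(\<lambda>(t, z). D t z) \<in> borel_measurable (borel \<Otimes>\<^sub>M borel)"
    and bd: "\<And>t z. 0 \<le> t \<Longrightarrow> t \<le> b \<Longrightarrow> \<bar>D t z\<bar> \<le> K"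
    and bdd_meas: "bdd_meas (f 0)" "bdd_meas (f b)"
  shows "(LINT t:{0..b}|lborel. (\<integral>z. D t z \<partial>M)) = (\<integral>z. f b z \<partial>M) - (\<integral>z. f 0 z \<partial>M)"
proof -
  note [measurable] = meas
  let ?N = "density lborel (\<lambda>x. ennreal (indicator {0..b} x))"
  have N: "?N = density lborel (indicator {0..b})" by (simp add: ennreal_indicator)
  interpret N: fin_borel ?N unfolding N by (rule fin_borel_interval)
  have meas_ind: "(\<lambda>(t, z). indicator {0..b} t * D t z) \<in> borel_measurable (borel \<Otimes>\<^sub>M borel)"
    by measurable
  have K0: "0 \<le> K" using bd[of 0 undefined] b by (meson abs_ge_zero order_trans order_refl)
  have "(LINT t:{0..b}|lborel. (\<integral>z. D t z \<partial>M)) = (\<integral>t. (\<integral>z. indicator {0..b} t * D t z \<partial>M) \<partial>?N)"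
    unfolding set_lebesgue_integral_def
    by (subst integral_density) (auto intro!: Bochner_Integration.integral_cong simp: indicator_def)
  also have "\<dots> = (\<integral>z. (\<integral>t. indicator {0..b} t * D t z \<partial>?N) \<partial>M)"
    by (rule N.bdd_Fubini[OF fin_borel_axioms meas_ind, of K]) (use bd K0 in \<open>auto simp: indicator_def\<close>)
  also have "\<dots> = (\<integral>z. f b z - f 0 z \<partial>M)"
  proof (rule Bochner_Integration.integral_cong[OF refl])
    fix z
    have [measurable]: "(\<lambda>t. D t z) \<in> borel_measurable borel" by measurable
    have "(\<integral>t. indicator {0..b} t * D t z \<partial>?N) = (LINT t:{0..b}|lborel. D t z)"
      unfolding set_lebesgue_integral_def
      by (subst integral_density) (auto intro!: Bochner_Integration.integral_cong simp: indicator_def)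
    also have "\<dots> = integral {0..b} (\<lambda>t. D t z)"
    proof (rule set_borel_integral_eq_integral)
      have "integrable ?N (\<lambda>t. indicator {0..b} t * D t z)"
        by (rule N.bdd_integrable[of _ K]) (measurable, use bd K0 in \<open>auto simp: indicator_def\<close>)
      then have "integrable lborel (\<lambda>t. indicator {0..b} t *\<^sub>R (indicator {0..b} t * D t z))"
        by (subst (asm) integrable_density) auto
      then show "set_integrable lborel {0..b} (\<lambda>t. D t z)"
      proof -
        have "(\<lambda>t. indicator {0..b} t *\<^sub>R (indicator {0..b} t * D t z)) = (\<lambda>t. indicator {0..b} t *\<^sub>R D t z)"
          by (auto simp: indicator_def)
        then show ?thesis
          using \<open>integrable lborel (\<lambda>t. indicator {0..b} t *\<^sub>R (indicator {0..b} t * D t z))\<close>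
          unfolding set_integrable_def by (simp only:)
      qed
    qed
    also have "\<dots> = f b z - f 0 z"
      using b der by (intro integral_unique fundamental_theorem_of_calculus)
        (auto simp flip: has_real_derivative_iff_has_vector_derivative intro: has_field_derivative_at_within)
    finally show "(\<integral>t. indicator {0..b} t * D t z \<partial>?N) = f b z - f 0 z" .
  qed
  also have "\<dots> = (\<integral>z. f b z \<partial>M) - (\<integral>z. f 0 z \<partial>M)"
    using bdd_meas by (intro Bochner_Integration.integral_diff bdd_meas_integrable)
  finally show ?thesis .
qed

section \<open>Integration by parts along the flow map\<close>

context eulerian begin

lemma Y_le_iff:
  assumes g: "nondeg t" and z: "0 < z" "z < 1"
  shows "Y t z \<le> Y t w \<longleftrightarrow> z \<le> w"
proof -
  have r: "rng t" using g by (simp add: nondeg_def)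
  consider "w < 0" | "0 \<le> w" "w < z" | "z \<le> w" by linarith
  then show ?thesis
  proof cases
    case 1
    then show ?thesis using Y_strict[OF g, of 0 z] Y_0[OF r, of w] Y_0[OF r, of 0] z by auto
  next
    case 2
    then show ?thesis using Y_strict[OF g, of w z] z by auto
  next
    case 3
    then show ?thesis using Y_mono[OF r] by auto
  qed
qed

text \<open>\<open>Y t\<close> need not be differentiable in the label, so the chain rule is
  obtained by pushing forward: the integral over labels up to \<open>z\<close> becomes that of
  \<open>\<phi>'\<close> over \<open>[X t, Y t z]\<close>. Nondegeneracy enters through
  \<open>Y_le_iff\<close>, which matches the two half-lines.\<close>

lemma chain_Y:
  assumes g: "nondeg t" and d: "\<And>x. (\<phi> has_real_derivative \<phi>' x) (at x)" and c: "continuous_on UNIV \<phi>'"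
  shows "\<phi> (Y t z) = \<phi> (X t) + kint M ker_le (\<lambda>w. \<phi>' (Y t w) * y t w) z"
proof -
  have r: "rng t" using g by (simp add: nondeg_def)
  note [measurable] = bdd_meas_measurable[OF bdd_meas_t(1)[OF r]] borel_measurable_continuous_onI[OF c]
  have [measurable]: "Y t \<in> borel_measurable borel" using Y_cont[OF r] by (rule borel_measurable_continuous_onI)
  let ?D = "density M (\<lambda>z. ennreal (y t z))" and ?I = "density lborel (\<lambda>x. ennreal (indicator {X t..X t + 1} x))"
  have I: "?I = distr ?D borel (Y t)" using distr_Y[OF r] by (simp add: ennreal_indicator)
  have "kint M ker_le (\<lambda>w. \<phi>' (Y t w) * y t w) z = (\<integral>w. y t w * (indicator {..Y t z} (Y t w) * \<phi>' (Y t w)) \<partial>M)"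
    unfolding kint_ker_le
  proof (rule integral_cong_AE)
    show "AE w in M. indicator {..z} w * (\<phi>' (Y t w) * y t w) = y t w * (indicator {..Y t z} (Y t w) * \<phi>' (Y t w))"
      using supp by eventually_elim (use Y_le_iff[OF g] in \<open>auto simp: indicator_def\<close>)
  qed measurable
  also have "\<dots> = (\<integral>w. indicator {..Y t z} (Y t w) * \<phi>' (Y t w) \<partial>?D)"
    using y_nonneg[OF r] by (subst integral_density) auto
  also have "\<dots> = (\<integral>x. indicator {..Y t z} x * \<phi>' x \<partial>?I)" unfolding I by (subst integral_distr) auto
  also have "\<dots> = (\<integral>x. \<phi>' x * indicator {X t..Y t z} x \<partial>lborel)"
    using Y_range[OF r, of z]
    by (subst integral_density) (auto intro!: Bochner_Integration.integral_cong simp: indicator_def)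
  also have "\<dots> = \<phi> (Y t z) - \<phi> (X t)"
    using Y_range[OF r, of z] c d
    by (intro integral_FTC_Icc_real) (auto simp: continuous_on_eq_continuous_at)
  finally show ?thesis by simp
qed

text \<open>No boundary term survives, because \<open>\<phi>\<close> returns to its value after one
  period and \<open>f\<close> has total zero.\<close>

lemma parts_Y:
  assumes g: "nondeg t" and d: "\<And>x. (\<phi> has_real_derivative \<phi>' x) (at x)" and c: "continuous_on UNIV \<phi>'"
    and per: "periodic1 \<phi>" and b: "bdd_meas (\<lambda>z. \<phi>' (Y t z))"
    and f: "bdd_meas f" "\<And>z. A z = A0 + kint M ker_le f z" "(\<integral>z. f z \<partial>M) = 0"
  shows "(\<integral>z. f z * \<phi> (Y t z) + A z * (\<phi>' (Y t z) * y t z) \<partial>M) = 0"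
proof -
  have r: "rng t" using g by (simp add: nondeg_def)
  have bb: "bdd_meas (\<lambda>w. \<phi>' (Y t w) * y t w)" by (intro bdd_meas_intros b bdd_meas_t r)
  have "(\<integral>z. \<phi>' (Y t z) * y t z \<partial>M) = 0"
    using chain_Y[OF g d c, of 1] Y_1[OF r, of 1] per kint_1[OF _ bb, of 1] by (simp add: periodic1_def)
  then show ?thesis
    using parts_all[OF f(1) bb f(2) chain_Y[OF g d c]] f(3) by simp
qed

text \<open>At the exceptional times the Eulerian functions are set to \<open>0\<close>: the space integrals are then, for
  every \<open>t\<close>, Lagrangian integrals or \<open>0\<close>, hence measurable in \<open>t\<close>.\<close>

definition "exceptional = (SOME N. N \<in> null_sets lborel \<and> {t. rng t \<and> \<not> nondeg t} \<subseteq> N)"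
text \<open>A Borel null superset is excluded in place of the degenerate times themselves, so that
  \<open>regular\<close> is a Borel predicate.\<close>

definition "regular t \<longleftrightarrow> rng t \<and> t \<notin> exceptional"

lemma exceptional: "exceptional \<in> null_sets lborel" "{t. rng t \<and> \<not> nondeg t} \<subseteq> exceptional"
proof -
  obtain N where "{t \<in> space lborel. \<not> (0 \<le> t \<and> t \<le> s \<longrightarrow> (AE x in M. 0 < y t x))} \<subseteq> N"
    "emeasure lborel N = 0" "N \<in> sets lborel" using aepos by (rule AE_E)
  then have "N \<in> null_sets lborel \<and> {t. rng t \<and> \<not> nondeg t} \<subseteq> N"
    by (auto simp: rng_def nondeg_def null_sets_def)
  then have "exceptional \<in> null_sets lborel \<and> {t. rng t \<and> \<not> nondeg t} \<subseteq> exceptional"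
    unfolding exceptional_def by (rule someI)
  then show "exceptional \<in> null_sets lborel" "{t. rng t \<and> \<not> nondeg t} \<subseteq> exceptional" by auto
qed

lemma regular_nondeg: "regular t \<Longrightarrow> nondeg t" using exceptional(2) by (auto simp: regular_def)

lemma regular_rng: "regular t \<Longrightarrow> rng t" by (simp add: regular_def)

lemma exceptional_sets [measurable]: "exceptional \<in> sets borel" using exceptional(1) by (auto simp: null_sets_def)

lemma regular_sets [measurable]: "Measurable.pred borel regular"
  unfolding regular_def[abs_def] rng_def by measurable

text \<open>The inverse of \<open>Y t\<close>, written as the measure of a sublevel set so that joint measurability is immediate.\<close>

definition "Xi t x = (\<integral>z. indicator {0..1} z * (if Y t z - X t \<le> frac (x - X t) then 1 else 0) \<partial>lborel :: real)"
definition "eu t x = (if regular t then U t (Xi t x) else 0)"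
definition "eux t x = (if regular t then v t (Xi t x) / y t (Xi t x) else 0)"

lemma measurable_eu: "(\<lambda>(t, x). eu t x) \<in> borel_measurable (borel \<Otimes>\<^sub>M borel)"
  "(\<lambda>(t, x). eux t x) \<in> borel_measurable (borel \<Otimes>\<^sub>M borel)"
proof -
  note [measurable] = meas
  have [measurable]: "(\<lambda>(t, x). Xi t x) \<in> borel_measurable (borel \<Otimes>\<^sub>M borel)"
  proof -
    have [measurable]: "(\<lambda>w. Y (fst (fst w)) (snd w)) \<in> borel_measurable ((borel \<Otimes>\<^sub>M borel) \<Otimes>\<^sub>M lborel)"
      using measurable_compose[OF _ meas(5), of "\<lambda>w. (fst (fst w), snd w)" "(borel \<Otimes>\<^sub>M borel) \<Otimes>\<^sub>M lborel"]
      by simp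
    have [measurable]: "(\<lambda>w. X (fst (fst w))) \<in> borel_measurable ((borel \<Otimes>\<^sub>M borel) \<Otimes>\<^sub>M lborel)"
      by measurable
    have [measurable]: "(\<lambda>w. frac (snd (fst w) - X (fst (fst w)))) \<in> borel_measurable ((borel \<Otimes>\<^sub>M borel) \<Otimes>\<^sub>M lborel)"
      by measurable
    have "(\<lambda>w. indicator {0..1} (snd w) * (if Y (fst (fst w)) (snd w) - X (fst (fst w)) \<le> frac (snd (fst w) - X (fst (fst w))) then 1 else 0 :: real))
      \<in> borel_measurable ((borel \<Otimes>\<^sub>M borel) \<Otimes>\<^sub>M lborel)"
      by measurable
    then have "(\<lambda>q. \<integral>z. indicator {0..1} z * (if Y (fst q) z - X (fst q) \<le> frac (snd q - X (fst q)) then 1 else 0 :: real) \<partial>lborel)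
       \<in> borel_measurable (borel \<Otimes>\<^sub>M borel)"
      by (intro lborel.borel_measurable_lebesgue_integral) (simp add: split_beta')
    then show ?thesis unfolding Xi_def by (simp add: split_beta')
  qed
  show "(\<lambda>(t, x). eu t x) \<in> borel_measurable (borel \<Otimes>\<^sub>M borel)"
    unfolding eu_def by measurable
  show "(\<lambda>(t, x). eux t x) \<in> borel_measurable (borel \<Otimes>\<^sub>M borel)"
    unfolding eux_def by measurable
qed

lemma Xi_per: "Xi t (x + 1) = Xi t x"
proof -
  have "frac (x + 1 - X t) = frac (x - X t)" using frac_1_eq[of "x - X t"] by (simp add: algebra_simps)
  then show ?thesis by (simp add: Xi_def)
qed

lemma per_eu: "periodic1 (eu t)" "periodic1 (eux t)"
  by (auto simp: periodic1_def eu_def eux_def Xi_per)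

text \<open>At a nondegenerate time \<open>Y t\<close> is strictly increasing on the unit interval,
  so up to endpoints the sublevel set at the height \<open>Y t z\<close> is \<open>{0..z}\<close>,
  whose length is \<open>z\<close>.\<close>

lemma Xi_Y:
  assumes g: "nondeg t" and z: "0 < z" "z < 1"
  shows "Xi t (Y t z) = z"
proof -
  have r: "rng t" using g by (simp add: nondeg_def)
  have "Y t 0 = X t" "Y t 1 = X t + 1" using Y_0[OF r] Y_1[OF r] by auto
  then have fr: "frac (Y t z - X t) = Y t z - X t"
    using Y_strict[OF g, of 0 z] Y_strict[OF g, of z 1] z by (intro frac_eq[THEN iffD2]) auto
  have [measurable]: "Y t \<in> borel_measurable borel" using Y_cont[OF r] by (rule borel_measurable_continuous_onI)
  have "AE w in lborel. w \<noteq> 0 \<and> w \<noteq> (1::real)"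
    using AE_lborel_singleton[of 0] AE_lborel_singleton[of 1] by eventually_elim auto
  then have ae: "AE w in lborel. indicator {0..1} w * (if Y t w - X t \<le> frac (Y t z - X t) then 1 else 0 :: real) = indicator {0..z} w"
  proof eventually_elim
    case (elim w)
    then have "w \<in> {0..1} \<longleftrightarrow> 0 < w \<and> w < 1" by auto
    then show ?case using Y_le_iff[OF g, of w z] elim z unfolding fr by (auto simp: indicator_def)
  qed
  have "Xi t (Y t z) = (\<integral>w. indicator {0..z} w \<partial>lborel)"
    unfolding Xi_def by (rule integral_cong_AE[OF _ _ ae]) measurable
  also have "\<dots> = z" using z by simp
  finally show ?thesis .
qed

lemma eu_Y: "regular t \<Longrightarrow> 0 < z \<Longrightarrow> z < 1 \<Longrightarrow> eu t (Y t z) = U t z"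
  "regular t \<Longrightarrow> 0 < z \<Longrightarrow> z < 1 \<Longrightarrow> eux t (Y t z) = v t z / y t z"
  by (auto simp: eu_def eux_def Xi_Y regular_nondeg)

text \<open>\<open>y * (v / y)^2 = v^2 / y\<close>, which is \<open>e\<close> by the quadratic
  relation.\<close>

lemma eux2_Y: "regular t \<Longrightarrow> 0 < z \<Longrightarrow> z < 1 \<Longrightarrow> 0 < y t z \<Longrightarrow> y t z * (eux t (Y t z))\<^sup>2 = e t z"
  using rel[of t z] by (auto simp: eu_Y power_divide power2_eq_square regular_def rng_def field_simps)

text \<open>The identity between the integrands is asked for only where \<open>y > 0\<close>: there
  the quotient in \<open>eux\<close> is genuine, and at a regular time this covers almost every
  label.\<close>

lemma eul_int:
  assumes t: "regular t" and g: "g \<in> borel_measurable borel" "periodic1 g" and H: "bdd_meas H"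
    and eq: "\<And>z. 0 < z \<Longrightarrow> z < 1 \<Longrightarrow> 0 < y t z \<Longrightarrow> y t z * g (Y t z) = H z"
  shows "(LINT x:{0..1}|lborel. g x) = (\<integral>z. H z \<partial>M)" "set_integrable lborel {0..1} g"
proof -
  note r = regular_rng[OF t]
  note [measurable] = bdd_meas_measurable[OF bdd_meas_t(1)[OF r]] bdd_meas_measurable[OF H] g(1)
  have [measurable]: "Y t \<in> borel_measurable borel" using Y_cont[OF r] by (rule borel_measurable_continuous_onI)
  have "AE z in M. 0 < y t z" using regular_nondeg[OF t] by (simp add: nondeg_def)
  then have ae: "AE z in M. y t z * g (Y t z) = H z"
    using supp by eventually_elim (use eq in auto)
  have "(\<integral>z. y t z * g (Y t z) \<partial>M) = (\<integral>z. H z \<partial>M)"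
    by (rule integral_cong_AE[OF _ _ ae]) measurable
  then show "(LINT x:{0..1}|lborel. g x) = (\<integral>z. H z \<partial>M)" using circle_cv(1)[OF r g] by simp
  have "integrable M (\<lambda>z. y t z * g (Y t z)) \<longleftrightarrow> integrable M H"
    by (rule integrable_cong_AE[OF _ _ ae]) measurable
  then show "set_integrable lborel {0..1} g" using circle_cv(2)[OF r g] bdd_meas_integrable[OF H] by simp
qed

end

lemma smooth1_deriv:
  assumes "smooth1 \<phi>"
  shows "(\<phi> has_real_derivative deriv \<phi> x) (at x)" "continuous_on UNIV \<phi>" "continuous_on UNIV (deriv \<phi>)"
proof -
  have 0: "\<phi> differentiable (at x)" for x using assms[unfolded smooth1_def, rule_format, of 0 x] by simp
  have 1: "deriv \<phi> differentiable (at x)" for x using assms[unfolded smooth1_def, rule_format, of 1 x] by simp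
  show "(\<phi> has_real_derivative deriv \<phi> x) (at x)"
    using 0[of x] by (simp add: DERIV_deriv_iff_real_differentiable)
  show "continuous_on UNIV \<phi>" "continuous_on UNIV (deriv \<phi>)"
    using 0 1 by (auto intro!: continuous_at_imp_continuous_on differentiable_imp_continuous_within)
qed

lemma periodic1_deriv:
  assumes "periodic1 \<phi>" "\<And>x. (\<phi> has_real_derivative \<phi>' x) (at x)"
  shows "periodic1 \<phi>'"
  unfolding periodic1_def
proof
  fix x
  have "((\<lambda>x. \<phi> (x + 1)) has_real_derivative \<phi>' (x + 1)) (at x)"
    using assms(2)[of "x + 1"] by (simp add: DERIV_shift)
  moreover have "(\<lambda>x. \<phi> (x + 1)) = \<phi>" using assms(1) by (auto simp: periodic1_def)
  ultimately show "\<phi>' (x + 1) = \<phi>' x" using assms(2)[of x] DERIV_unique by metis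
qed

lemma periodic1_intros:
  "periodic1 (\<lambda>_. c)"
  "periodic1 f \<Longrightarrow> periodic1 g \<Longrightarrow> periodic1 (\<lambda>x. f x + g x)"
  "periodic1 f \<Longrightarrow> periodic1 g \<Longrightarrow> periodic1 (\<lambda>x. f x - g x)"
  "periodic1 f \<Longrightarrow> periodic1 g \<Longrightarrow> periodic1 (\<lambda>x. f x * g x)"
  "periodic1 f \<Longrightarrow> periodic1 (\<lambda>x. f x ^ k)"
  "periodic1 (\<lambda>x. f (frac x))"
  by (auto simp: periodic1_def frac_1_eq)

text \<open>The endpoint 1 is left out because \<open>frac 1 = 0\<close>, so that functions
  rewritten with \<open>frac\<close> may differ there.\<close>

lemma set_integral_unit_cong:
  fixes f g :: "real \<Rightarrow> real"
  assumes "\<And>x. 0 \<le> x \<Longrightarrow> x < 1 \<Longrightarrow> f x = g x"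
  shows "(LINT x:{0..1}|lborel. f x :: real) = (LINT x:{0..1}|lborel. g x)"
  unfolding set_lebesgue_integral_def
proof (rule integral_discrete_difference[where X = "{1}"])
  fix x :: real assume "x \<notin> {1}"
  then show "indicator {0..1} x *\<^sub>R f x = indicator {0..1} x *\<^sub>R g x"
    using assms[of x] by (cases "x < 1") (auto simp: indicator_def)
qed auto

lemma periodic1_bounded:
  assumes "continuous_on UNIV f" "periodic1 f"
  obtains K where "\<And>x. \<bar>f x\<bar> \<le> K"
proof -
  have "continuous_on UNIV (\<lambda>q::real\<times>real. f (snd q))"
    by (rule continuous_on_compose2[OF assms(1)]) (auto intro: continuous_intros)
  then have "\<exists>K. \<forall>t x. (0::real) \<le> t \<and> t \<le> 0 \<longrightarrow> \<bar>f x\<bar> \<le> K"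
    by (intro periodic_bounded[of "\<lambda>_. f" 0] assms(2))
  then show thesis using that by auto
qed

context eulerian begin

section \<open>Bounded functions of time and label\<close>

definition bdd_meas2 :: "(real \<Rightarrow> real \<Rightarrow> real) \<Rightarrow> bool" where
  "bdd_meas2 f \<longleftrightarrow> (\<lambda>(t, z). f t z) \<in> borel_measurable (borel \<Otimes>\<^sub>M borel) \<and>
     (\<exists>K. \<forall>t z. 0 \<le> t \<and> t \<le> s \<longrightarrow> \<bar>f t z\<bar> \<le> K)"

lemma bdd_meas2I: "(\<lambda>(t, z). f t z) \<in> borel_measurable (borel \<Otimes>\<^sub>M borel) \<Longrightarrow>
    (\<And>t z. 0 \<le> t \<Longrightarrow> t \<le> s \<Longrightarrow> \<bar>f t z\<bar> \<le> K) \<Longrightarrow> bdd_meas2 f"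
  unfolding bdd_meas2_def by blast

lemma bdd_meas2_meas: "bdd_meas2 f \<Longrightarrow> (\<lambda>(t, z). f t z) \<in> borel_measurable (borel \<Otimes>\<^sub>M borel)"
  unfolding bdd_meas2_def by blast

lemma bdd_meas2E:
  assumes "bdd_meas2 f" obtains K where "K \<ge> 0" "\<And>t z. 0 \<le> t \<Longrightarrow> t \<le> s \<Longrightarrow> \<bar>f t z\<bar> \<le> K"
proof -
  obtain K where K: "\<And>t z. 0 \<le> t \<Longrightarrow> t \<le> s \<Longrightarrow> \<bar>f t z\<bar> \<le> K" using assms unfolding bdd_meas2_def by blast
  have "0 \<le> K" using K[of 0 0] s abs_ge_zero[of "f 0 0"] by linarith
  then show thesis using K by (rule that)
qed

lemma bdd_meas2_const: "bdd_meas2 (\<lambda>_ _. c)"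
  by (rule bdd_meas2I[where K = "\<bar>c\<bar>"]) auto

lemma bdd_meas2_add: assumes "bdd_meas2 f" "bdd_meas2 g" shows "bdd_meas2 (\<lambda>t z. f t z + g t z)"
proof -
  obtain K where K: "K \<ge> 0" "\<And>t z. 0 \<le> t \<Longrightarrow> t \<le> s \<Longrightarrow> \<bar>f t z\<bar> \<le> K"
    by (rule bdd_meas2E[OF assms(1)]) (rule that)
  obtain L where L: "L \<ge> 0" "\<And>t z. 0 \<le> t \<Longrightarrow> t \<le> s \<Longrightarrow> \<bar>g t z\<bar> \<le> L"
    by (rule bdd_meas2E[OF assms(2)]) (rule that)
  note [measurable] = assms[THEN bdd_meas2_meas]
  show ?thesis
  proof (rule bdd_meas2I[where K = "K + L"])
    show "\<bar>f t z + g t z\<bar> \<le> K + L" if "0 \<le> t" "t \<le> s" for t z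
      using K(2)[OF that, of z] L(2)[OF that, of z] by linarith
  qed measurable
qed

lemma bdd_meas2_mult: assumes "bdd_meas2 f" "bdd_meas2 g" shows "bdd_meas2 (\<lambda>t z. f t z * g t z)"
proof -
  obtain K where K: "K \<ge> 0" "\<And>t z. 0 \<le> t \<Longrightarrow> t \<le> s \<Longrightarrow> \<bar>f t z\<bar> \<le> K"
    by (rule bdd_meas2E[OF assms(1)]) (rule that)
  obtain L where L: "L \<ge> 0" "\<And>t z. 0 \<le> t \<Longrightarrow> t \<le> s \<Longrightarrow> \<bar>g t z\<bar> \<le> L"
    by (rule bdd_meas2E[OF assms(2)]) (rule that)
  note [measurable] = assms[THEN bdd_meas2_meas]
  show ?thesis
  proof (rule bdd_meas2I[where K = "K * L"])
    show "\<bar>f t z * g t z\<bar> \<le> K * L" if "0 \<le> t" "t \<le> s" for t z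
      unfolding abs_mult using K L that by (intro mult_mono) auto
  qed measurable
qed

lemma bdd_meas2_minus: "bdd_meas2 f \<Longrightarrow> bdd_meas2 (\<lambda>t z. - f t z)"
  using bdd_meas2_mult[OF bdd_meas2_const[of "-1"], of f] by simp

lemma bdd_meas2_diff: "bdd_meas2 f \<Longrightarrow> bdd_meas2 g \<Longrightarrow> bdd_meas2 (\<lambda>t z. f t z - g t z)"
  using bdd_meas2_add[OF _ bdd_meas2_minus, of f g] by simp

lemma bdd_meas2_power: "bdd_meas2 f \<Longrightarrow> bdd_meas2 (\<lambda>t z. f t z ^ n)"
proof (induction n)
  case 0 show ?case using bdd_meas2_const[of 1] by simp
next
  case (Suc n) show ?case using bdd_meas2_mult[OF Suc.prems Suc.IH[OF Suc.prems]] by simp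
qed

lemma bdd_meas2_slice: assumes "bdd_meas2 f" "rng t" shows "bdd_meas (f t)"
proof -
  obtain K where K: "K \<ge> 0" "\<And>t z. 0 \<le> t \<Longrightarrow> t \<le> s \<Longrightarrow> \<bar>f t z\<bar> \<le> K"
    by (rule bdd_meas2E[OF assms(1)]) (rule that)
  show ?thesis using K(2) assms(2) by (intro bdd_meas_slice[OF bdd_meas2_meas[OF assms(1)], of _ K]) (simp add: rng_def)
qed

lemma bdd_meas2_kint:
  assumes "bdd_meas2 f" "kernel k" shows "bdd_meas2 (\<lambda>t. kint M k (f t))"
proof -
  obtain K where K: "K \<ge> 0" "\<And>t z. 0 \<le> t \<Longrightarrow> t \<le> s \<Longrightarrow> \<bar>f t z\<bar> \<le> K"
    by (rule bdd_meas2E[OF assms(1)]) (rule that)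
  show ?thesis
  proof (rule bdd_meas2I[OF kint_measurable2[OF assms(2) bdd_meas2_meas[OF assms(1)]]])
    show "\<bar>kint M k (f t) z\<bar> \<le> K * measure M UNIV" if "0 \<le> t" "t \<le> s" for t z
      using kint_bound[OF assms(2) bdd_meas_measurable[OF bdd_meas2_slice[OF assms(1)]] K(2)[OF that]] that by (simp add: rng_def)
  qed
qed

lemma bdd_meas2_int: "bdd_meas2 f \<Longrightarrow> bdd_meas2 (\<lambda>t _. \<integral>z. f t z \<partial>M)"
  using bdd_meas2_kint[OF _ kernel_K1, of f] by (simp add: kint_K1[abs_def])

lemma bdd_meas2_base: "bdd_meas2 y" "bdd_meas2 v" "bdd_meas2 e" "bdd_meas2 U"
  by (rule bdd_meas2I[OF meas(1) bd(1)] bdd_meas2I[OF meas(2) bd(2)] bdd_meas2I[OF meas(3) bd(3)] bdd_meas2I[OF meas(4) bd(4)]; assumption)+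

lemmas bdd_meas2_intros = bdd_meas2_add bdd_meas2_mult bdd_meas2_diff bdd_meas2_minus bdd_meas2_power bdd_meas2_const

lemma bdd_meas2_W: "bdd_meas2 W" "bdd_meas2 G" "bdd_meas2 (\<lambda>t _. F t)" "bdd_meas2 P"
proof -
  show w: "bdd_meas2 W" unfolding W_def[abs_def] by (intro bdd_meas2_intros bdd_meas2_base)
  show g: "bdd_meas2 G" unfolding G_def[abs_def] by (intro bdd_meas2_kint w kernel_ker_le)
  have "bdd_meas2 (\<lambda>t _. inverse (1 - h) * (\<integral>z. G t z * (y t z - e t z) \<partial>M))"
    by (intro bdd_meas2_intros bdd_meas2_int bdd_meas2_base g)
  then show f: "bdd_meas2 (\<lambda>t _. F t)" by (simp add: F_def[abs_def] divide_inverse mult.commute)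
  show "bdd_meas2 P" unfolding P_def[abs_def] by (intro bdd_meas2_intros g f)
qed

lemma bdd_meas2_int_integrable:
  assumes "bdd_meas2 f" "b \<le> s" shows "set_integrable lborel {0..b} (\<lambda>t. \<integral>z. f t z \<partial>M)"
proof -
  have i: "bdd_meas2 (\<lambda>t _. \<integral>z. f t z \<partial>M)" using assms(1) by (rule bdd_meas2_int)
  obtain K where K: "K \<ge> 0" "\<And>t z. 0 \<le> t \<Longrightarrow> t \<le> s \<Longrightarrow> \<bar>\<integral>z. f t z \<partial>M\<bar> \<le> K"
    by (rule bdd_meas2E[OF i]) (rule that)
  note [measurable] = bdd_meas2_meas[OF assms(1)]
  have [measurable]: "(\<lambda>t. \<integral>z. f t z \<partial>M) \<in> borel_measurable borel" by measurable
  have "emeasure lborel {0..b} < \<infinity>" by (simp add: emeasure_lborel_Icc_eq)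
  then have "set_integrable lborel {0..b} (\<lambda>_. K)"
    unfolding set_integrable_def by (simp add: integrable_indicator_iff)
  then show ?thesis
  proof (rule set_integrable_bound)
    show "set_borel_measurable lborel {0..b} (\<lambda>t. \<integral>z. f t z \<partial>M)" unfolding set_borel_measurable_def by measurable
    show "AE t in lborel. t \<in> {0..b} \<longrightarrow> norm (\<integral>z. f t z \<partial>M) \<le> norm K"
    proof (rule AE_I2, rule impI)
      fix t assume "t \<in> {0..b}"
      then have "\<bar>\<integral>z. f t z \<partial>M\<bar> \<le> K" using assms(2) by (intro K) auto
      then show "norm (\<integral>z. f t z \<partial>M) \<le> norm K" by simp
    qed
  qed
qed

lemma test_triple_bm2:
  assumes "test_triple p pt px"
  shows "bdd_meas2 (\<lambda>t z. p t (Y t z))" "bdd_meas2 (\<lambda>t z. pt t (Y t z))" "bdd_meas2 (\<lambda>t z. px t (Y t z))"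
proof -
  obtain K where K: "\<And>t x. 0 \<le> t \<Longrightarrow> t \<le> s \<Longrightarrow> \<bar>p t x\<bar> \<le> K" "\<And>t x. 0 \<le> t \<Longrightarrow> t \<le> s \<Longrightarrow> \<bar>pt t x\<bar> \<le> K"
    "\<And>t x. 0 \<le> t \<Longrightarrow> t \<le> s \<Longrightarrow> \<bar>px t x\<bar> \<le> K" using test_triple_bounded[OF assms] by blast
  note [measurable] = test_triple_measurable[OF assms] meas(5)
  have m: "(\<lambda>(t, z). p t (Y t z)) \<in> borel_measurable (borel \<Otimes>\<^sub>M borel)"
    "(\<lambda>(t, z). pt t (Y t z)) \<in> borel_measurable (borel \<Otimes>\<^sub>M borel)"
    "(\<lambda>(t, z). px t (Y t z)) \<in> borel_measurable (borel \<Otimes>\<^sub>M borel)"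
    by measurable
  show "bdd_meas2 (\<lambda>t z. p t (Y t z))" by (rule bdd_meas2I[OF m(1) K(1)])
  show "bdd_meas2 (\<lambda>t z. pt t (Y t z))" by (rule bdd_meas2I[OF m(2) K(2)])
  show "bdd_meas2 (\<lambda>t z. px t (Y t z))" by (rule bdd_meas2I[OF m(3) K(3)])
qed

text \<open>The Eulerian side is zero at exceptional times, the Lagrangian side need not be. A
  change on a Borel null set preserves integrability and integral, which spares a direct proof that
  the Eulerian space integrals are measurable in time.\<close>

lemma exceptional_transfer:
  assumes g: "set_integrable lborel {0..b} g" and f: "\<And>t. 0 \<le> t \<Longrightarrow> t \<le> b \<Longrightarrow> f t = (if t \<in> exceptional then 0 else g t :: real)"
  shows "set_integrable lborel {0..b} f" "(LINT t:{0..b}|lborel. f t) = (LINT t:{0..b}|lborel. g t)"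
proof -
  let ?g = "\<lambda>t. indicator {0..b} t *\<^sub>R g t"
  have eq: "(\<lambda>t. indicator {0..b} t *\<^sub>R f t) = (\<lambda>t. indicator (- exceptional) t *\<^sub>R ?g t)"
    using f by (auto simp: indicator_def fun_eq_iff)
  have gm: "integrable lborel ?g" using g by (simp add: set_integrable_def)
  then have i: "integrable lborel (\<lambda>t. indicator (- exceptional) t *\<^sub>R ?g t)"
    using exceptional_sets by (intro integrable_mult_indicator[OF _ gm]) auto
  have ae: "AE t in lborel. indicator (- exceptional) t *\<^sub>R ?g t = ?g t"
    by (rule AE_I'[OF exceptional(1)]) (auto simp: indicator_def)
  show "set_integrable lborel {0..b} f" unfolding set_integrable_def eq by (rule i)
  show "(LINT t:{0..b}|lborel. f t) = (LINT t:{0..b}|lborel. g t)"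
    unfolding set_lebesgue_integral_def eq
    by (rule integral_cong_AE[OF _ _ ae]) (use i gm in auto)
qed

lemma eu_slice [measurable]: "eu t \<in> borel_measurable borel" "eux t \<in> borel_measurable borel"
proof -
  note [measurable] = measurable_eu
  show "eu t \<in> borel_measurable borel" "eux t \<in> borel_measurable borel" by measurable
qed

section \<open>Conserved quantities and the weak derivative\<close>

definition "ew t x = eu t x - eu t x * (eux t x)\<^sup>2"

lemma ew_meas [measurable]: "ew t \<in> borel_measurable borel"
  unfolding ew_def[abs_def] by measurable

lemma per_ew: "periodic1 (ew t)" unfolding ew_def[abs_def] by (intro periodic1_intros per_eu)

lemma ew_Y: "regular t \<Longrightarrow> 0 < z \<Longrightarrow> z < 1 \<Longrightarrow> 0 < y t z \<Longrightarrow> y t z * ew t (Y t z) = U t z * (y t z - e t z)"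
  unfolding ew_def using eux2_Y[of t z] by (simp add: eu_Y(1) algebra_simps)

lemma mean_ew: assumes "regular t" shows "Smean (ew t) = m"
proof -
  note r = regular_rng[OF assms]
  have "(LINT x:{0..1}|lborel. ew t x) = (\<integral>z. U t z * (y t z - e t z) \<partial>M)"
    by (rule eul_int[OF assms ew_meas per_ew _ ew_Y[OF assms]]) (intro bdd_meas_intros bdd_meas_t r)
  then show ?thesis using tot(4)[of t] r by (simp add: Smean_def rng_def)
qed

lemma energy: assumes "regular t" shows "(LINT x:{0..1}|lborel. (eux t x)\<^sup>2) = h" "set_integrable lborel {0..1} (\<lambda>x. (eux t x)\<^sup>2)"
proof -
  note r = regular_rng[OF assms]
  have g: "(\<lambda>x. (eux t x)\<^sup>2) \<in> borel_measurable borel" "periodic1 (\<lambda>x. (eux t x)\<^sup>2)"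
    by (measurable, intro periodic1_intros per_eu)
  note E = eul_int[OF assms g bdd_meas_t(3)[OF r] eux2_Y[OF assms]]
  show "(LINT x:{0..1}|lborel. (eux t x)\<^sup>2) = h" using E(1) tot(3)[of t] r by (simp add: rng_def)
  show "set_integrable lborel {0..1} (\<lambda>x. (eux t x)\<^sup>2)" using E(2) by simp
qed

lemma norm_bound: assumes "regular t"
  shows "(LINT x:{0..1}|lborel. (eu t x)\<^sup>2 + (eux t x)\<^sup>2) \<le> (2 * vel_bound h m)\<^sup>2 + h" "set_integrable lborel {0..1} (\<lambda>x. (eu t x)\<^sup>2)"
proof -
  note r = regular_rng[OF assms]
  have U: "\<bar>U t z\<bar> \<le> 2 * vel_bound h m" for z using Ub[of t z] r by (simp add: rng_def)
  have "(\<lambda>x. (eu t x)\<^sup>2) \<in> borel_measurable borel" "periodic1 (\<lambda>x. (eu t x)\<^sup>2)"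
    by (measurable, intro periodic1_intros per_eu)
  note E = eul_int[OF assms this, of "\<lambda>z. y t z * (U t z)\<^sup>2"]
  have b: "bdd_meas (\<lambda>z. y t z * (U t z)\<^sup>2)" by (intro bdd_meas_intros bdd_meas_t r)
  show i: "set_integrable lborel {0..1} (\<lambda>x. (eu t x)\<^sup>2)" using E(2)[OF b] assms by (simp add: eu_Y)
  have "(LINT x:{0..1}|lborel. (eu t x)\<^sup>2) = (\<integral>z. y t z * (U t z)\<^sup>2 \<partial>M)" using E(1)[OF b] assms by (simp add: eu_Y)
  also have "\<dots> \<le> (\<integral>z. y t z * (2 * vel_bound h m)\<^sup>2 \<partial>M)"
  proof (rule integral_mono)
    show "integrable M (\<lambda>z. y t z * (U t z)\<^sup>2)" by (rule bdd_meas_integrable[OF b])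
    show "integrable M (\<lambda>z. y t z * (2 * vel_bound h m)\<^sup>2)" by (intro bdd_meas_integrable bdd_meas_intros bdd_meas_t r)
    have "(U t z)\<^sup>2 \<le> (2 * vel_bound h m)\<^sup>2" for z using power_mono[OF U abs_ge_zero, of z 2] by simp
    then show "y t z * (U t z)\<^sup>2 \<le> y t z * (2 * vel_bound h m)\<^sup>2" for z using y_nonneg[OF r] by (intro mult_left_mono)
  qed
  also have "\<dots> = (2 * vel_bound h m)\<^sup>2" using tot(2)[of t] r by (simp add: rng_def)
  finally show "(LINT x:{0..1}|lborel. (eu t x)\<^sup>2 + (eux t x)\<^sup>2) \<le> (2 * vel_bound h m)\<^sup>2 + h"
    using set_integral_add(2)[OF i energy(2)[OF assms]] energy(1)[OF assms] by simp
qed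

text \<open>Zero totals make the primitives \<open>U\<close> and \<open>G\<close> take equal values
  at the labels 0 and 1, as integration by parts on the circle requires.\<close>

lemma rng_tot: "rng t \<Longrightarrow> (\<integral>z. v t z \<partial>M) = 0" "rng t \<Longrightarrow> (\<integral>z. W t z \<partial>M) = 0"
proof -
  show "rng t \<Longrightarrow> (\<integral>z. v t z \<partial>M) = 0" using tot(1) by (simp add: rng_def)
  assume r: "rng t"
  have "integrable M (\<lambda>z. U t z * (y t z - e t z))" "integrable M (\<lambda>z. m * y t z)"
    by (intro bdd_meas_integrable bdd_meas_intros bdd_meas_t r)+
  then show "(\<integral>z. W t z \<partial>M) = 0" using tot(2,4)[of t] r by (simp add: W_def[abs_def] rng_def)
qed

text \<open>The weak derivative relation, pulled back to labels, is \<open>parts_Y\<close> with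
  density \<open>v\<close> and primitive \<open>U\<close>.\<close>

lemma H1S_eu: assumes t: "regular t" shows "H1S (eu t) (eux t)"
  unfolding H1S_def
proof (intro conjI allI impI)
  note r = regular_rng[OF t]
  fix \<phi> assume \<phi>: "smooth1 \<phi> \<and> periodic1 \<phi>"
  note d = smooth1_deriv[OF conjunct1[OF \<phi>]]
  have per: "periodic1 (deriv \<phi>)" using periodic1_deriv[OF _ d(1)] \<phi> by simp
  have [measurable]: "\<phi> \<in> borel_measurable borel" "deriv \<phi> \<in> borel_measurable borel"
    using d by (auto intro: borel_measurable_continuous_onI)
  have [measurable]: "Y t \<in> borel_measurable borel" using Y_cont[OF r] by (rule borel_measurable_continuous_onI)
  obtain K1 where K1: "\<And>x. \<bar>\<phi> x\<bar> \<le> K1" using periodic1_bounded[OF d(2)] \<phi> by blast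
  obtain K2 where K2: "\<And>x. \<bar>deriv \<phi> x\<bar> \<le> K2" using periodic1_bounded[OF d(3) per] by blast
  have b: "bdd_meas (\<lambda>z. \<phi> (Y t z))" "bdd_meas (\<lambda>z. deriv \<phi> (Y t z))"
    using K1 K2 by (auto intro!: bdd_measI)
  have b': "bdd_meas (\<lambda>z. v t z * \<phi> (Y t z))" "bdd_meas (\<lambda>z. U t z * (deriv \<phi> (Y t z) * y t z))" by (intro bdd_meas_intros b bdd_meas_t r)+
  have "(LINT x:{0..1}|lborel. eu t x * deriv \<phi> x) = (\<integral>z. U t z * (deriv \<phi> (Y t z) * y t z) \<partial>M)"
    by (rule eul_int[OF t _ _ b'(2)]) (measurable, auto intro!: periodic1_intros per_eu per simp: eu_Y(1)[OF t])
  moreover have "(LINT x:{0..1}|lborel. eux t x * \<phi> x) = (\<integral>z. v t z * \<phi> (Y t z) \<partial>M)"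
    by (rule eul_int[OF t _ _ b'(1)]) (measurable, use \<phi> in \<open>auto intro!: periodic1_intros per_eu simp: eu_Y(2)[OF t]\<close>)
  moreover have "(\<integral>z. v t z * \<phi> (Y t z) + U t z * (deriv \<phi> (Y t z) * y t z) \<partial>M) = 0"
    using \<phi> by (intro parts_Y[OF regular_nondeg[OF t] d(1,3) _ b(2) bdd_meas_t(2)[OF r] U_eq'[OF r] rng_tot(1)[OF r]]) auto
  ultimately show "(LINT x:{0..1}|lborel. eu t x * deriv \<phi> x) = - (LINT x:{0..1}|lborel. eux t x * \<phi> x)"
    using bdd_meas_integrable[OF b'(1)] bdd_meas_integrable[OF b'(2)] by simp
qed (use per_eu norm_bound(2)[OF t] energy(2)[OF t] in auto)

section \<open>The nonlocal term and its base point\<close>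

text \<open>The primitive from 0 to \<open>c\<close> is rewritten as an integral over a full period
  with a periodic cutoff, the kind of integral that \<open>eul_int\<close> transports to
  labels.\<close>

lemma Sdxinv_ew:
  assumes t: "regular t" and c: "0 \<le> c" "c < 1"
  shows "Sdxinv (ew t) c = (LINT y:{0..1}|lborel. indicator {..c} (frac y) * (ew t y - m))"
proof -
  have "Sdxinv (ew t) c = (LINT y:{0..c}|lborel. ew t y - m)"
    unfolding Sdxinv_def Sproj_def mean_ew[OF t]
    using interval_integral_Icc[OF c(1), of "\<lambda>y. ew t y - m"] by (simp add: zero_ereal_def)
  also have "\<dots> = (LINT y:{0..1}|lborel. indicator {..c} (frac y) * (ew t y - m))"
    unfolding set_lebesgue_integral_def
  proof (rule integral_discrete_difference[where X = "{1}"])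
    fix x :: real assume "x \<notin> {1}"
    then consider "x < 0" | "1 < x" | "0 \<le> x" "x < 1" by fastforce
    then show "indicator {0..c} x *\<^sub>R (ew t x - m) = indicator {0..1} x *\<^sub>R (indicator {..c} (frac x) * (ew t x - m))"
    proof cases
      case 3
      then have "frac x = x" by (simp add: frac_eq)
      then show ?thesis using 3 by (auto simp: indicator_def)
    qed (use c in \<open>auto simp: indicator_def\<close>)
  qed auto
  finally show ?thesis .
qed

text \<open>\<open>nx t\<close> is the first integer above \<open>X t\<close>, where the period
  starting at \<open>X t\<close> crosses the base point of \<open>Sdxinv\<close>;
  \<open>kk t\<close> is the integral of \<open>u - u u_x^2 - m\<close> from \<open>X t\<close> up
  to that crossing.\<close>

definition "nx t = of_int \<lfloor>X t\<rfloor> + (1::real)"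
definition "kk t = (\<integral>w. indicator {w. Y t w < nx t} w * W t w \<partial>M)"

lemma frac_Y:
  assumes g: "nondeg t" and z: "0 < z" "z < 1"
  shows "frac (Y t z) = (if Y t z < nx t then Y t z - (nx t - 1) else Y t z - nx t)"
proof -
  have r: "rng t" using g by (simp add: nondeg_def)
  have Y: "X t \<le> Y t z" "Y t z < X t + 1"
    using Y_range[OF r, of z] Y_strict[OF g, of z 1] Y_1[OF r, of 1] z by auto
  have X: "nx t - 1 \<le> X t" "X t < nx t" unfolding nx_def by linarith+
  show ?thesis
  proof (cases "Y t z < nx t")
    case True
    then have "\<lfloor>Y t z\<rfloor> = \<lfloor>X t\<rfloor>" using Y X unfolding nx_def by (intro floor_unique) linarith+
    then show ?thesis using True by (simp add: frac_def nx_def)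
  next
    case False
    then have "\<lfloor>Y t z\<rfloor> = \<lfloor>X t\<rfloor> + 1" using Y X unfolding nx_def
      by (intro floor_unique; simp only: of_int_add of_int_1; linarith)
    then show ?thesis using False by (simp add: frac_def nx_def)
  qed
qed

text \<open>Comparing points modulo 1 amounts to comparing labels, corrected for the side of the
  crossing \<open>nx t\<close> on which they lie: points before the crossing come last on the
  circle, points after it first.\<close>

lemma frac_Y_le:
  assumes g: "nondeg t" and z: "0 < z" "z < 1" and w: "0 < w" "w < 1"
  shows "indicator {..frac (Y t z)} (frac (Y t w))
    = indicator {..z} w - indicator {w. Y t w < nx t} w + (if Y t z < nx t then 1 else 0 :: real)"
proof -
  have r: "rng t" using g by (simp add: nondeg_def)
  have Y: "X t \<le> Y t z" "Y t z < X t + 1" "X t \<le> Y t w" "Y t w < X t + 1"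
    using Y_range[OF r] Y_strict[OF g, of _ 1] Y_1[OF r, of 1] z w by auto
  have X: "nx t - 1 \<le> X t" "X t < nx t" unfolding nx_def by linarith+
  show ?thesis using Y_le_iff[OF g w, of z] Y X
    unfolding frac_Y[OF g z] frac_Y[OF g w] by (auto simp: indicator_def)
qed

text \<open>Moving the base point from \<open>X t\<close> to 0 costs the constant
  \<open>kk t\<close>; the remaining correction in \<open>frac_Y_le\<close> does not depend on
  \<open>w\<close> and multiplies the total of \<open>W\<close>, which is zero.\<close>

lemma Sdxinv_along_Y:
  assumes t: "regular t" and z: "0 < z" "z < 1"
  shows "Sdxinv (ew t) (frac (Y t z)) = G t z - kk t"
proof -
  note r = regular_rng[OF t] and g = regular_nondeg[OF t]
  note [measurable] = bdd_meas_measurable[OF bdd_meas_W(1)[OF r]]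
  have [measurable]: "Y t \<in> borel_measurable borel" using Y_cont[OF r] by (rule borel_measurable_continuous_onI)
  let ?i = "indicator {..frac (Y t z)} :: real \<Rightarrow> real"
  have bi: "bdd_meas (\<lambda>w. ?i (frac (Y t w)))"   proof (rule bdd_measI[where B = 1])
    show "(\<lambda>w. ?i (frac (Y t w))) \<in> borel_measurable borel"
      by (rule measurable_compose[of "\<lambda>w. frac (Y t w)" borel borel ?i]) measurable
  qed (simp add: indicator_def)
  have bj: "bdd_meas (indicator {w. Y t w < nx t})" by (intro bdd_meas_indicator) measurable
  have "Sdxinv (ew t) (frac (Y t z)) = (LINT x:{0..1}|lborel. ?i (frac x) * (ew t x - m))"
    by (rule Sdxinv_ew[OF t]) (simp_all add: frac_lt_1)
  also have "\<dots> = (\<integral>w. ?i (frac (Y t w)) * W t w \<partial>M)"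
  proof (rule eul_int[OF t])
    show "(\<lambda>x. ?i (frac x) * (ew t x - m)) \<in> borel_measurable borel" by measurable
    show "periodic1 (\<lambda>x. ?i (frac x) * (ew t x - m))" by (intro periodic1_intros per_ew)
    show "bdd_meas (\<lambda>w. ?i (frac (Y t w)) * W t w)" by (intro bdd_meas_intros bi bdd_meas_W r)
    show "y t w * (?i (frac (Y t w)) * (ew t (Y t w) - m)) = ?i (frac (Y t w)) * W t w"
      if "0 < w" "w < 1" "0 < y t w" for w
    proof -
      have "y t w * (?i (frac (Y t w)) * (ew t (Y t w) - m)) = ?i (frac (Y t w)) * (y t w * ew t (Y t w) - m * y t w)"
        by (simp add: algebra_simps)
      then show ?thesis unfolding ew_Y[OF t that] W_def .
    qed
  qed
  also have "\<dots> = (\<integral>w. indicator {..z} w * W t w - indicator {w. Y t w < nx t} w * W t w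
      + (if Y t z < nx t then 1 else 0) * W t w \<partial>M)"
  proof (rule integral_cong_AE)
    show "AE w in M. ?i (frac (Y t w)) * W t w = indicator {..z} w * W t w - indicator {w. Y t w < nx t} w * W t w
      + (if Y t z < nx t then 1 else 0) * W t w"
      using supp
    proof eventually_elim
      case (elim w)
      show ?case using frac_Y_le[OF g z, of w] elim by (simp only: greaterThanLessThan_iff left_diff_distrib distrib_right)
    qed
  qed measurable
  also have "\<dots> = (\<integral>w. indicator {..z} w * W t w \<partial>M) - kk t + (if Y t z < nx t then 1 else 0) * (\<integral>w. W t w \<partial>M)"
  proof -
    have i: "integrable M (\<lambda>w. indicator {..z} w * W t w)" "integrable M (\<lambda>w. indicator {w. Y t w < nx t} w * W t w)"
      "integrable M (\<lambda>w. (if Y t z < nx t then 1 else 0) * W t w)"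
      by (intro bdd_meas_integrable bdd_meas_intros bdd_meas_W r bj; simp)+
    show ?thesis unfolding kk_def
      using Bochner_Integration.integral_add[OF Bochner_Integration.integrable_diff[OF i(1,2)] i(3)]
        Bochner_Integration.integral_diff[OF i(1,2)] by simp
  qed
  finally show ?thesis using rng_tot(2)[OF r] by (simp add: G_def kint_ker_le)
qed

text \<open>\<open>Sdxinv\<close> read on \<open>[0, 1)\<close> and repeated with period 1, as the
  change of variables takes periodic functions.\<close>

definition "sd t x = Sdxinv (ew t) (frac x)"

lemma sd_meas: assumes "regular t" shows "sd t \<in> borel_measurable borel"
proof -
  have eq: "sd t = (\<lambda>x. \<integral>y. indicator {0..1} y * ((if frac y \<le> frac x then 1 else 0) * (ew t y - m)) \<partial>lborel)"
  proof
    fix x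
    show "sd t x = (\<integral>y. indicator {0..1} y * ((if frac y \<le> frac x then 1 else 0) * (ew t y - m)) \<partial>lborel)"
      unfolding sd_def Sdxinv_ew[OF assms frac_ge_0 frac_lt_1] set_lebesgue_integral_def
      by (intro Bochner_Integration.integral_cong refl) (auto simp: indicator_def)
  qed
  have "(\<lambda>x. \<integral>y. indicator {0..1} y * ((if frac y \<le> frac x then 1 else 0) * (ew t y - m)) \<partial>lborel) \<in> borel_measurable borel"
  proof (rule lborel.borel_measurable_lebesgue_integral)
    have [measurable]: "(\<lambda>w. ew t (snd w)) \<in> borel_measurable (borel \<Otimes>\<^sub>M lborel)"
      by measurable
    show "(\<lambda>(x, y). indicator {0..1} y * ((if frac y \<le> frac x then 1 else 0) * (ew t y - m))) \<in> borel_measurable (borel \<Otimes>\<^sub>M lborel)"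
      unfolding split_beta' by measurable
  qed
  then show ?thesis unfolding eq .
qed

text \<open>The weight \<open>1 - u_x^2\<close> integrates to \<open>1 - h\<close>, so after
  division the constant \<open>kk t\<close> appears with coefficient one. The primitive minus
  \<open>f\<close> is thus free of the base point and equals \<open>P\<close> along the
  flow.\<close>

lemma ffun_eu: assumes t: "regular t" shows "ffun h eu eux t = F t - kk t"
proof -
  note r = regular_rng[OF t]
  note [measurable] = sd_meas[OF t]
  have b: "bdd_meas (\<lambda>z. (y t z - e t z) * (G t z - kk t))" by (intro bdd_meas_intros bdd_meas_t bdd_meas_W r)
  have "(LINT x:{0..1}|lborel. (1 - (eux t x)\<^sup>2) * Sdxinv (ew t) x) = (LINT x:{0..1}|lborel. (1 - (eux t x)\<^sup>2) * sd t x)"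
    by (rule set_integral_unit_cong) (simp add: sd_def frac_eq[THEN iffD2])
  also have "\<dots> = (\<integral>z. (y t z - e t z) * (G t z - kk t) \<partial>M)"
  proof (rule eul_int[OF t _ _ b])
    show "(\<lambda>x. (1 - (eux t x)\<^sup>2) * sd t x) \<in> borel_measurable borel" by measurable
    show "periodic1 (\<lambda>x. (1 - (eux t x)\<^sup>2) * sd t x)" unfolding sd_def by (intro periodic1_intros per_eu)
    show "y t z * ((1 - (eux t (Y t z))\<^sup>2) * sd t (Y t z)) = (y t z - e t z) * (G t z - kk t)"
      if "0 < z" "z < 1" "0 < y t z" for z
    proof -
      have "y t z * (1 - (eux t (Y t z))\<^sup>2) = y t z - e t z" using eux2_Y[OF t that] by (simp add: right_diff_distrib)
      then show ?thesis using Sdxinv_along_Y[OF t that(1,2)] by (simp add: sd_def flip: mult.assoc)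
    qed
  qed
  also have "\<dots> = (\<integral>z. G t z * (y t z - e t z) - kk t * (y t z - e t z) \<partial>M)"
    by (intro Bochner_Integration.integral_cong refl) (simp add: algebra_simps)
  also have "\<dots> = (\<integral>z. G t z * (y t z - e t z) \<partial>M) - kk t * (1 - h)"
  proof -
    have i: "integrable M (\<lambda>z. G t z * (y t z - e t z))" "integrable M (y t)" "integrable M (e t)"
      by (intro bdd_meas_integrable bdd_meas_intros bdd_meas_t bdd_meas_W r)+
    then show ?thesis using tot(2,3)[of t] r by (simp add: rng_def)
  qed
  finally show ?thesis
    using h(2) unfolding ffun_def ew_def[symmetric] by (simp add: F_def ew_def[abs_def] field_simps)
qed

section \<open>The weak form of the evolution equation\<close>

lemma der_Psi:
  assumes "test_triple p pt px" "0 \<le> t" "t \<le> s"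
  shows "((\<lambda>t. p t (Y t z)) has_real_derivative pt t (Y t z) - px t (Y t z) * (U t z)\<^sup>2) (at t)"
  using test_triple_curve_deriv[OF assms(1) der(4)[OF assms(2,3)], of z] by simp

lemma der_U:
  assumes "0 \<le> t" "t \<le> s" shows "((\<lambda>t. U t z) has_real_derivative P t z) (at t)"
  using der(5)[OF assms, of z] unfolding P_def G_def F_def W_def[abs_def] .

lemma test_triple_parts:
  assumes T: "test_triple p pt px" and g: "nondeg t" and f: "bdd_meas f" "\<And>z. A z = A0 + kint M ker_le f z" "(\<integral>z. f z \<partial>M) = 0"
  shows "(\<integral>z. f z * p t (Y t z) + A z * (px t (Y t z) * y t z) \<partial>M) = 0"
proof (rule parts_Y[OF g _ _ _ _ f])
  have r: "rng t" using g by (simp add: nondeg_def)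
  show "(p t has_real_derivative px t x) (at x)" for x by (rule test_triple_x_deriv[OF T])
  show "continuous_on UNIV (px t)"
    by (rule continuous_on_compose2[OF test_triple_cont(3)[OF T], of UNIV "\<lambda>x. (t, x)", simplified])
      (auto intro: continuous_intros)
  show "periodic1 (p t)" using T by (simp add: test_triple_def)
  show "bdd_meas (\<lambda>z. px t (Y t z))" using bdd_meas2_slice[OF test_triple_bm2(3)[OF T] r] .
qed

text \<open>\<open>l2\<close> and \<open>r2\<close> are the label forms of the two space integrals
  in (ii); \<open>D2\<close> is the pointwise time derivative of
  \<open>U * y * p(Y)\<close>.\<close>

definition "l2 pt px t = (\<integral>z. U t z * y t z * pt t (Y t z) - 1/3 * (U t z ^ 3 * y t z * px t (Y t z)) \<partial>M)"
definition "r2 p t = (\<integral>z. P t z * y t z * p t (Y t z) \<partial>M)"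
definition "D2 p pt px t z = P t z * y t z * p t (Y t z) - 2 * (U t z)\<^sup>2 * v t z * p t (Y t z)
    + U t z * y t z * (pt t (Y t z) - px t (Y t z) * (U t z)\<^sup>2)"

lemma bdd_meas2_D2: assumes "test_triple p pt px" shows "bdd_meas2 (D2 p pt px)"
  unfolding D2_def[abs_def] by (intro bdd_meas2_intros bdd_meas2_base bdd_meas2_W test_triple_bm2[OF assms])

lemma D2_integral:
  assumes T: "test_triple p pt px" and b: "0 \<le> b" "b \<le> s"
  shows "(LINT t:{0..b}|lborel. (\<integral>z. D2 p pt px t z \<partial>M))
    = (\<integral>z. U b z * y b z * p b (Y b z) \<partial>M) - (\<integral>z. U 0 z * y 0 z * p 0 (Y 0 z) \<partial>M)"
proof -
  obtain K where K: "K \<ge> 0" "\<And>t z. 0 \<le> t \<Longrightarrow> t \<le> s \<Longrightarrow> \<bar>D2 p pt px t z\<bar> \<le> K"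
    by (rule bdd_meas2E[OF bdd_meas2_D2[OF T]]) (rule that)
  have bb: "bdd_meas (\<lambda>z. U t z * y t z * p t (Y t z))" if "rng t" for t
    by (intro bdd_meas_intros bdd_meas_t bdd_meas2_slice[OF test_triple_bm2(1)[OF T]] that)
  show ?thesis
  proof (rule time_FTC[where f = "\<lambda>t z. U t z * y t z * p t (Y t z)" and K = K])
    show "((\<lambda>t. U t z * y t z * p t (Y t z)) has_real_derivative D2 p pt px t z) (at t)" if "0 \<le> t" "t \<le> b" for t z
    proof -
      have t: "0 \<le> t" "t \<le> s" using that b by auto
      show ?thesis
        by (rule DERIV_cong[OF DERIV_mult[OF DERIV_mult[OF der_U[OF t] der(1)[OF t]] der_Psi[OF T t]]])
          (simp add: D2_def algebra_simps power2_eq_square)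
    qed
    show "(\<lambda>(t, z). D2 p pt px t z) \<in> borel_measurable (borel \<Otimes>\<^sub>M borel)" by (rule bdd_meas2_meas[OF bdd_meas2_D2[OF T]])
    show "\<bar>D2 p pt px t z\<bar> \<le> K" if "0 \<le> t" "t \<le> b" for t z using K(2)[of t z] that b by simp
    show "bdd_meas (\<lambda>z. U 0 z * y 0 z * p 0 (Y 0 z))" "bdd_meas (\<lambda>z. U b z * y b z * p b (Y b z))"
      using b s by (auto intro!: bb simp: rng_def)
  qed (use b in auto)
qed

text \<open>\<open>3 U^2 v\<close> is the label density of \<open>U^3\<close>, by the product rule
  applied twice; its total is zero because that of \<open>v\<close> is.\<close>

lemma U3_parts:
  assumes T: "test_triple p pt px" and g: "nondeg t"
  shows "(\<integral>z. U t z ^ 3 * y t z * px t (Y t z) \<partial>M) = - 3 * (\<integral>z. (U t z)\<^sup>2 * v t z * p t (Y t z) \<partial>M)"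
proof -
  have r: "rng t" using g by (simp add: nondeg_def)
  note v = bdd_meas_t(2)[OF r] and u = U_eq'[OF r]
  note bp = bdd_meas2_slice[OF test_triple_bm2(1)[OF T] r] bdd_meas2_slice[OF test_triple_bm2(3)[OF T] r]
  let ?f = "\<lambda>z. v t z * U t z + U t z * v t z"
  let ?g = "\<lambda>z. ?f z * U t z + U t z * U t z * v t z"
  have f: "bdd_meas ?f" by (intro bdd_meas_intros bdd_meas_t r)
  have sq: "U t z * U t z = C t * C t + kint M ker_le ?f z" for z
    using parts_le[OF v v u u, of z] by simp
  have g': "bdd_meas ?g" by (intro bdd_meas_intros bdd_meas_t r)
  have cu: "U t z * U t z * U t z = C t * C t * C t + kint M ker_le ?g z" for z
    using parts_le[OF f v sq u, of z] by simp
  have f0: "(\<integral>z. ?f z \<partial>M) = 0" using parts_all[OF v v u u] rng_tot(1)[OF r] by simp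
  have g0: "(\<integral>z. ?g z \<partial>M) = 0" using parts_all[OF f v sq u] rng_tot(1)[OF r] f0 by simp
  have "0 = (\<integral>z. ?g z * p t (Y t z) + U t z * U t z * U t z * (px t (Y t z) * y t z) \<partial>M)"
    using test_triple_parts[OF T g g' cu g0] by simp
  also have "\<dots> = (\<integral>z. 3 * ((U t z)\<^sup>2 * v t z * p t (Y t z)) + U t z ^ 3 * y t z * px t (Y t z) \<partial>M)"
    by (intro Bochner_Integration.integral_cong refl) (simp add: algebra_simps power2_eq_square power3_eq_cube)
  also have "\<dots> = 3 * (\<integral>z. (U t z)\<^sup>2 * v t z * p t (Y t z) \<partial>M) + (\<integral>z. U t z ^ 3 * y t z * px t (Y t z) \<partial>M)"
  proof -
    have "integrable M (\<lambda>z. 3 * ((U t z)\<^sup>2 * v t z * p t (Y t z)))" "integrable M (\<lambda>z. U t z ^ 3 * y t z * px t (Y t z))"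
      by (intro bdd_meas_integrable bdd_meas_intros bdd_meas_t bp r)+
    then show ?thesis by simp
  qed
  finally show ?thesis by simp
qed

text \<open>Transport contributes \<open>- U^3 y p_x\<close> and the change of \<open>y\<close>
  contributes \<open>- 2 U^2 v p\<close>; by \<open>U3_parts\<close> the latter integrates to
  \<open>2/3\<close> of \<open>U^3 y p_x\<close>, which leaves the factor
  \<open>- 1/3\<close>.\<close>

lemma D2_split:
  assumes T: "test_triple p pt px" and g: "nondeg t"
  shows "(\<integral>z. D2 p pt px t z \<partial>M) = l2 pt px t + r2 p t"
proof -
  have r: "rng t" using g by (simp add: nondeg_def)
  note bp = bdd_meas2_slice[OF test_triple_bm2(1)[OF T] r] bdd_meas2_slice[OF test_triple_bm2(2)[OF T] r] bdd_meas2_slice[OF test_triple_bm2(3)[OF T] r]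
  have i: "integrable M (\<lambda>z. P t z * y t z * p t (Y t z))" "integrable M (\<lambda>z. (U t z)\<^sup>2 * v t z * p t (Y t z))"
    "integrable M (\<lambda>z. U t z * y t z * pt t (Y t z))" "integrable M (\<lambda>z. U t z ^ 3 * y t z * px t (Y t z))"
    by (intro bdd_meas_integrable bdd_meas_intros bdd_meas_t bdd_meas_W bp r)+
  have "(\<integral>z. D2 p pt px t z \<partial>M) = (\<integral>z. P t z * y t z * p t (Y t z) - 2 * ((U t z)\<^sup>2 * v t z * p t (Y t z))
      + (U t z * y t z * pt t (Y t z) - U t z ^ 3 * y t z * px t (Y t z)) \<partial>M)"
    by (intro Bochner_Integration.integral_cong refl)
      (simp add: D2_def algebra_simps power2_eq_square power3_eq_cube)
  also have "\<dots> = r2 p t - 2 * (\<integral>z. (U t z)\<^sup>2 * v t z * p t (Y t z) \<partial>M)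
      + ((\<integral>z. U t z * y t z * pt t (Y t z) \<partial>M) - (\<integral>z. U t z ^ 3 * y t z * px t (Y t z) \<partial>M))"
    unfolding r2_def using i by simp
  also have "\<dots> = l2 pt px t + r2 p t"
    unfolding l2_def using i U3_parts[OF T g] by simp
  finally show ?thesis .
qed

lemma AE_nondeg_integral:
  assumes "set_integrable lborel {0..b} f" "set_integrable lborel {0..b} g" "b \<le> s"
    "\<And>t. nondeg t \<Longrightarrow> f t = g t"
  shows "(LINT t:{0..b}|lborel. f t :: real) = (LINT t:{0..b}|lborel. g t)"
  unfolding set_lebesgue_integral_def
proof (rule integral_cong_AE)
  show "AE t in lborel. indicator {0..b} t *\<^sub>R f t = indicator {0..b} t *\<^sub>R g t"
  proof (rule AE_I'[OF exceptional(1)])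
    have "f t = g t" if "t \<in> {0..b}" "t \<notin> exceptional" for t
      using that assms(3) regular_nondeg[of t] by (intro assms(4)) (auto simp: regular_def rng_def)
    then show "{t \<in> space lborel. indicator {0..b} t *\<^sub>R f t \<noteq> indicator {0..b} t *\<^sub>R g t} \<subseteq> exceptional"
      by (auto simp: indicator_def)
  qed
qed (use assms(1,2) in \<open>auto simp: set_integrable_def\<close>)

lemma rl_integrable:
  assumes "test_triple p pt px" "b \<le> s"
  shows "set_integrable lborel {0..b} (l2 pt px)" "set_integrable lborel {0..b} (r2 p)"
    "set_integrable lborel {0..b} (\<lambda>t. \<integral>z. D2 p pt px t z \<partial>M)"
  unfolding l2_def[abs_def] r2_def[abs_def]
  by (intro bdd_meas2_int_integrable bdd_meas2_intros bdd_meas2_base bdd_meas2_W bdd_meas2_D2 test_triple_bm2[OF assms(1)] assms)+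

lemma lr2_integral:
  assumes T: "test_triple p pt px" and b: "0 \<le> b" "b \<le> s"
  shows "(LINT t:{0..b}|lborel. l2 pt px t) + (LINT t:{0..b}|lborel. r2 p t)
    = (\<integral>z. U b z * y b z * p b (Y b z) \<partial>M) - (\<integral>z. U 0 z * y 0 z * p 0 (Y 0 z) \<partial>M)"
proof -
  note i = rl_integrable[OF T b(2)]
  have "(LINT t:{0..b}|lborel. l2 pt px t) + (LINT t:{0..b}|lborel. r2 p t) = (LINT t:{0..b}|lborel. l2 pt px t + r2 p t)"
    by (rule set_integral_add(2)[OF i(1,2), symmetric])
  also have "\<dots> = (LINT t:{0..b}|lborel. \<integral>z. D2 p pt px t z \<partial>M)"
    by (rule AE_nondeg_integral[OF set_integral_add(1)[OF i(1,2)] i(3) b(2)]) (simp add: D2_split[OF T])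
  finally show ?thesis using D2_integral[OF T b] by simp
qed

end

lemma test_triple_slice: assumes "test_triple p pt px"
  shows "p t \<in> borel_measurable borel" "pt t \<in> borel_measurable borel" "px t \<in> borel_measurable borel"
    "periodic1 (p t)" "periodic1 (pt t)" "periodic1 (px t)"
proof -
  note [measurable] = test_triple_measurable[OF assms]
  show "p t \<in> borel_measurable borel" "pt t \<in> borel_measurable borel" "px t \<in> borel_measurable borel" by measurable
qed (use assms in \<open>auto simp: test_triple_def\<close>)

context eulerian begin

lemma not_regular: assumes "\<not> regular t" shows "eu t = (\<lambda>_. 0)" "eux t = (\<lambda>_. 0)"
  using assms by (auto simp: eu_def eux_def)

lemma Sdxinv_0: "Sdxinv (\<lambda>_. 0) x = 0"
  by (simp add: Sdxinv_def Sproj_def Smean_def)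

lemma range_regular: "0 \<le> t \<Longrightarrow> t \<le> b \<Longrightarrow> b \<le> s \<Longrightarrow> regular t \<longleftrightarrow> t \<notin> exceptional"
  by (auto simp: regular_def rng_def)

text \<open>At the regular time \<open>b\<close> the boundary term can be written in Eulerian form;
  the one at time 0 stays in label form until the initial data are identified.\<close>

theorem weak2:
  assumes T: "test_triple p pt px" and b: "regular b"
  shows "set_integrable lborel {0..b} (\<lambda>t. LINT x:{0..1}|lborel. eu t x * pt t x - 1/3 * (eu t x)^3 * px t x)"
    "set_integrable lborel {0..b} (\<lambda>t. LINT x:{0..1}|lborel. (Sdxinv (\<lambda>z. eu t z - eu t z * (eux t z)\<^sup>2) x - ffun h eu eux t) * p t x)"
    "(LINT t:{0..b}|lborel. LINT x:{0..1}|lborel. eu t x * pt t x - 1/3 * (eu t x)^3 * px t x) + (LINT t:{0..b}|lborel. LINT x:{0..1}|lborel. (Sdxinv (\<lambda>z. eu t z - eu t z * (eux t z)\<^sup>2) x - ffun h eu eux t) * p t x)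
       = (LINT x:{0..1}|lborel. eu b x * p b x) - (\<integral>z. U 0 z * y 0 z * p 0 (Y 0 z) \<partial>M)"
proof -
  let ?L = "\<lambda>t. LINT x:{0..1}|lborel. eu t x * pt t x - 1/3 * (eu t x)^3 * px t x"
  let ?R = "\<lambda>t. LINT x:{0..1}|lborel. (Sdxinv (\<lambda>z. eu t z - eu t z * (eux t z)\<^sup>2) x - ffun h eu eux t) * p t x"
  have bs: "0 \<le> b" "b \<le> s" using b by (auto simp: regular_def rng_def)
  note i = rl_integrable[OF T bs(2)]
  note [measurable] = test_triple_slice(1-3)[OF T]
  note ps = test_triple_slice(4-6)[OF T]
  have L: "?L t = (if t \<in> exceptional then 0 else l2 pt px t)" if t: "0 \<le> t" "t \<le> b" for t
  proof (cases "regular t")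
    case True
    note r = regular_rng[OF True]
    note bp = bdd_meas2_slice[OF test_triple_bm2(1)[OF T] r] bdd_meas2_slice[OF test_triple_bm2(2)[OF T] r] bdd_meas2_slice[OF test_triple_bm2(3)[OF T] r]
    have "?L t = l2 pt px t" unfolding l2_def
    proof (rule eul_int[OF True])
      show "(\<lambda>x. eu t x * pt t x - 1/3 * (eu t x)^3 * px t x) \<in> borel_measurable borel" by measurable
      show "periodic1 (\<lambda>x. eu t x * pt t x - 1/3 * (eu t x)^3 * px t x)" by (intro periodic1_intros per_eu ps)
      show "bdd_meas (\<lambda>z. U t z * y t z * pt t (Y t z) - 1/3 * (U t z ^ 3 * y t z * px t (Y t z)))"
        by (intro bdd_meas_intros bdd_meas_t bp r)
    qed (simp add: eu_Y(1)[OF True] algebra_simps)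
    then show ?thesis using True range_regular[OF t bs(2)] by simp
  next
    case False
    then show ?thesis using range_regular[OF t bs(2)] by (simp add: not_regular)
  qed
  have R: "?R t = (if t \<in> exceptional then 0 else r2 p t)" if t: "0 \<le> t" "t \<le> b" for t
  proof (cases "regular t")
    case True
    note r = regular_rng[OF True]
    note bp = bdd_meas2_slice[OF test_triple_bm2(1)[OF T] r]
    note [measurable] = sd_meas[OF True]
    have "?R t = (LINT x:{0..1}|lborel. (sd t x - (F t - kk t)) * p t x)"
      unfolding ffun_eu[OF True] ew_def[symmetric]
      by (rule set_integral_unit_cong) (simp add: sd_def frac_eq[THEN iffD2] ew_def[abs_def])
    also have "\<dots> = r2 p t" unfolding r2_def
    proof (rule eul_int[OF True])
      show "(\<lambda>x. (sd t x - (F t - kk t)) * p t x) \<in> borel_measurable borel" by measurable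
      show "periodic1 (\<lambda>x. (sd t x - (F t - kk t)) * p t x)" unfolding sd_def by (intro periodic1_intros ps)
      show "bdd_meas (\<lambda>z. P t z * y t z * p t (Y t z))" by (intro bdd_meas_intros bdd_meas_t bdd_meas_W bp r)
      show "y t z * ((sd t (Y t z) - (F t - kk t)) * p t (Y t z)) = P t z * y t z * p t (Y t z)"
        if "0 < z" "z < 1" for z
        using Sdxinv_along_Y[OF True that] by (simp add: sd_def P_def)
    qed
    finally show ?thesis using True range_regular[OF t bs(2)] by simp
  next
    case False
    then show ?thesis using range_regular[OF t bs(2)] by (simp add: not_regular Sdxinv_0 ffun_def)
  qed
  note tl = exceptional_transfer[OF i(1) L] and tr = exceptional_transfer[OF i(2) R]
  show "set_integrable lborel {0..b} ?L" by (rule tl(1))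
  show "set_integrable lborel {0..b} ?R" by (rule tr(1))
  note r = regular_rng[OF b]
  note bp = bdd_meas2_slice[OF test_triple_bm2(1)[OF T] r]
  have "(LINT x:{0..1}|lborel. eu b x * p b x) = (\<integral>z. U b z * y b z * p b (Y b z) \<partial>M)"
  proof (rule eul_int[OF b])
    show "(\<lambda>x. eu b x * p b x) \<in> borel_measurable borel" by measurable
    show "periodic1 (\<lambda>x. eu b x * p b x)" by (intro periodic1_intros per_eu ps)
    show "bdd_meas (\<lambda>z. U b z * y b z * p b (Y b z))" by (intro bdd_meas_intros bdd_meas_t bp r)
  qed (simp add: eu_Y(1)[OF b])
  then show "(LINT t:{0..b}|lborel. ?L t) + (LINT t:{0..b}|lborel. ?R t)
       = (LINT x:{0..1}|lborel. eu b x * p b x) - (\<integral>z. U 0 z * y 0 z * p 0 (Y 0 z) \<partial>M)"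
    using lr2_integral[OF T bs] tl(2) tr(2) by simp
qed

section \<open>The weak form of the differentiated equation\<close>

definition "l1 pxt px t = (\<integral>z. U t z * y t z * pxt t (Y t z) + (U t z)\<^sup>2 * v t z * px t (Y t z) \<partial>M)"
definition "r1 p t = (\<integral>z. W t z * p t (Y t z) \<partial>M)"

text \<open>Integration by parts in space for the test function \<open>px\<close>: the cubic flux
  turns into \<open>u^2 u_x\<close> and the primitive \<open>P\<close> into its density
  \<open>W\<close>.\<close>

lemma l1_r1:
  assumes T: "test_triple p pt px" and Tx: "test_triple px pxt pxx" and g: "nondeg t"
  shows "l2 pxt pxx t + r2 px t = l1 pxt px t - r1 p t"
proof -
  have r: "rng t" using g by (simp add: nondeg_def)
  note bp = bdd_meas2_slice[OF test_triple_bm2(1)[OF T] r] bdd_meas2_slice[OF test_triple_bm2(1)[OF Tx] r] bdd_meas2_slice[OF test_triple_bm2(2)[OF Tx] r]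
    bdd_meas2_slice[OF test_triple_bm2(3)[OF Tx] r]
  have i: "integrable M (\<lambda>z. U t z * y t z * pxt t (Y t z))" "integrable M (\<lambda>z. U t z ^ 3 * y t z * pxx t (Y t z))"
    "integrable M (\<lambda>z. (U t z)\<^sup>2 * v t z * px t (Y t z))" "integrable M (\<lambda>z. W t z * p t (Y t z))"
    "integrable M (\<lambda>z. P t z * (px t (Y t z) * y t z))"
    by (intro bdd_meas_integrable bdd_meas_intros bdd_meas_t bdd_meas_W bp r)+
  have Pe: "P t z = - F t + kint M ker_le (W t) z" for z by (simp add: P_def G_def)
  have "l2 pxt pxx t = l1 pxt px t"
    unfolding l2_def l1_def using i U3_parts[OF Tx g] by simp
  moreover have "r2 px t = (\<integral>z. P t z * (px t (Y t z) * y t z) \<partial>M)"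
    unfolding r2_def by (intro Bochner_Integration.integral_cong refl) simp
  moreover have "\<dots> = - r1 p t"
    using test_triple_parts[OF T g bdd_meas_W(1)[OF r] Pe rng_tot(2)[OF r]] i unfolding r1_def by simp
  ultimately show ?thesis by simp
qed

lemma Ux_parts:
  assumes T: "test_triple p pt px" and g: "nondeg t"
  shows "(\<integral>z. U t z * y t z * px t (Y t z) \<partial>M) = - (\<integral>z. v t z * p t (Y t z) \<partial>M)"
proof -
  have r: "rng t" using g by (simp add: nondeg_def)
  note bp = bdd_meas2_slice[OF test_triple_bm2(1)[OF T] r] bdd_meas2_slice[OF test_triple_bm2(3)[OF T] r]
  have i: "integrable M (\<lambda>z. v t z * p t (Y t z))" "integrable M (\<lambda>z. U t z * (px t (Y t z) * y t z))"
    by (intro bdd_meas_integrable bdd_meas_intros bdd_meas_t bp r)+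
  have "(\<integral>z. U t z * y t z * px t (Y t z) \<partial>M) = (\<integral>z. U t z * (px t (Y t z) * y t z) \<partial>M)"
    by (intro Bochner_Integration.integral_cong refl) simp
  then show ?thesis
    using test_triple_parts[OF T g bdd_meas_t(2)[OF r] U_eq'[OF r] rng_tot(1)[OF r]] i by simp
qed

text \<open>Derived from \<open>lr2_integral\<close> for \<open>px\<close> in place of
  differentiating \<open>v * p(Y)\<close> in time. Nondegeneracy at time 0 serves to integrate the
  initial boundary term by parts.\<close>

theorem weak1:
  assumes T: "test_triple p pt px" and Tx: "test_triple px pxt pxx" and b: "regular b" and g0: "nondeg 0"
  shows "set_integrable lborel {0..b} (\<lambda>t. LINT x:{0..1}|lborel. eu t x * pxt t x + (eu t x)\<^sup>2 * eux t x * px t x)"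
    "set_integrable lborel {0..b} (\<lambda>t. LINT x:{0..1}|lborel.
        (eu t x - eu t x * (eux t x)\<^sup>2 - Smean (\<lambda>z. eu t z - eu t z * (eux t z)\<^sup>2)) * p t x)"
    "(LINT t:{0..b}|lborel. LINT x:{0..1}|lborel. eu t x * pxt t x + (eu t x)\<^sup>2 * eux t x * px t x) - (LINT t:{0..b}|lborel. LINT x:{0..1}|lborel.
        (eu t x - eu t x * (eux t x)\<^sup>2 - Smean (\<lambda>z. eu t z - eu t z * (eux t z)\<^sup>2)) * p t x)
       = - (LINT x:{0..1}|lborel. eux b x * p b x) + (\<integral>z. v 0 z * p 0 (Y 0 z) \<partial>M)"
proof -
  let ?L = "\<lambda>t. LINT x:{0..1}|lborel. eu t x * pxt t x + (eu t x)\<^sup>2 * eux t x * px t x"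
  let ?R = "\<lambda>t. LINT x:{0..1}|lborel.
        (eu t x - eu t x * (eux t x)\<^sup>2 - Smean (\<lambda>z. eu t z - eu t z * (eux t z)\<^sup>2)) * p t x"
  have bs: "0 \<le> b" "b \<le> s" using b by (auto simp: regular_def rng_def)
  note [measurable] = test_triple_slice(1-3)[OF T] test_triple_slice(1-3)[OF Tx]
  note ps = test_triple_slice(4-6)[OF T] test_triple_slice(4-6)[OF Tx]
  have i: "set_integrable lborel {0..b} (l1 pxt px)" "set_integrable lborel {0..b} (r1 p)"
    unfolding l1_def[abs_def] r1_def[abs_def]
    by (intro bdd_meas2_int_integrable bdd_meas2_intros bdd_meas2_base bdd_meas2_W test_triple_bm2[OF T] test_triple_bm2[OF Tx] bs)+
  have L: "?L t = (if t \<in> exceptional then 0 else l1 pxt px t)" if t: "0 \<le> t" "t \<le> b" for t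
  proof (cases "regular t")
    case True
    note r = regular_rng[OF True]
    note bp = bdd_meas2_slice[OF test_triple_bm2(1)[OF Tx] r] bdd_meas2_slice[OF test_triple_bm2(2)[OF Tx] r]
    have "?L t = l1 pxt px t" unfolding l1_def
    proof (rule eul_int[OF True])
      show "(\<lambda>x. eu t x * pxt t x + (eu t x)\<^sup>2 * eux t x * px t x) \<in> borel_measurable borel" by measurable
      show "periodic1 (\<lambda>x. eu t x * pxt t x + (eu t x)\<^sup>2 * eux t x * px t x)" by (intro periodic1_intros per_eu ps)
      show "bdd_meas (\<lambda>z. U t z * y t z * pxt t (Y t z) + (U t z)\<^sup>2 * v t z * px t (Y t z))"
        by (intro bdd_meas_intros bdd_meas_t bp r)
      show "y t z * (eu t (Y t z) * pxt t (Y t z) + (eu t (Y t z))\<^sup>2 * eux t (Y t z) * px t (Y t z))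
        = U t z * y t z * pxt t (Y t z) + (U t z)\<^sup>2 * v t z * px t (Y t z)" if "0 < z" "z < 1" "0 < y t z" for z
        using that by (simp add: eu_Y[OF True] field_simps)
    qed
    then show ?thesis using True range_regular[OF t bs(2)] by simp
  next
    case False
    then show ?thesis using range_regular[OF t bs(2)] by (simp add: not_regular)
  qed
  have R: "?R t = (if t \<in> exceptional then 0 else r1 p t)" if t: "0 \<le> t" "t \<le> b" for t
  proof (cases "regular t")
    case True
    note r = regular_rng[OF True]
    note bp = bdd_meas2_slice[OF test_triple_bm2(1)[OF T] r]
    have "?R t = (LINT x:{0..1}|lborel. (ew t x - m) * p t x)"
      using mean_ew[OF True] by (simp add: ew_def[abs_def])
    also have "\<dots> = r1 p t" unfolding r1_def
    proof (rule eul_int[OF True])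
      show "(\<lambda>x. (ew t x - m) * p t x) \<in> borel_measurable borel" by measurable
      show "periodic1 (\<lambda>x. (ew t x - m) * p t x)" by (intro periodic1_intros per_ew ps)
      show "bdd_meas (\<lambda>z. W t z * p t (Y t z))" by (intro bdd_meas_intros bdd_meas_W bp r)
      show "y t z * ((ew t (Y t z) - m) * p t (Y t z)) = W t z * p t (Y t z)" if "0 < z" "z < 1" "0 < y t z" for z
      proof -
        have "y t z * (ew t (Y t z) - m) = W t z" using ew_Y[OF True that] by (simp add: W_def algebra_simps)
        then show ?thesis by (simp flip: mult.assoc)
      qed
    qed
    finally show ?thesis using True range_regular[OF t bs(2)] by simp
  next
    case False
    then show ?thesis using range_regular[OF t bs(2)] by (simp add: not_regular Smean_def)
  qed
  note tl = exceptional_transfer[OF i(1) L] and tr = exceptional_transfer[OF i(2) R]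
  show "set_integrable lborel {0..b} ?L" by (rule tl(1))
  show "set_integrable lborel {0..b} ?R" by (rule tr(1))
  note r = regular_rng[OF b]
  note bp = bdd_meas2_slice[OF test_triple_bm2(1)[OF T] r]
  have eb: "(LINT x:{0..1}|lborel. eux b x * p b x) = (\<integral>z. v b z * p b (Y b z) \<partial>M)"
  proof (rule eul_int[OF b])
    show "(\<lambda>x. eux b x * p b x) \<in> borel_measurable borel" by measurable
    show "periodic1 (\<lambda>x. eux b x * p b x)" by (intro periodic1_intros per_eu ps)
    show "bdd_meas (\<lambda>z. v b z * p b (Y b z))" by (intro bdd_meas_intros bdd_meas_t bp r)
  qed (simp add: eu_Y(2)[OF b])
  note ix = rl_integrable[OF Tx bs(2)]
  have "(LINT t:{0..b}|lborel. ?L t) - (LINT t:{0..b}|lborel. ?R t)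
     = (LINT t:{0..b}|lborel. l1 pxt px t) - (LINT t:{0..b}|lborel. r1 p t)"
    using tl(2) tr(2) by simp
  also have "\<dots> = (LINT t:{0..b}|lborel. l1 pxt px t - r1 p t)"
    by (rule set_integral_diff(2)[OF i, symmetric])
  also have "\<dots> = (LINT t:{0..b}|lborel. l2 pxt pxx t + r2 px t)"
    by (rule AE_nondeg_integral[OF set_integral_diff(1)[OF i] set_integral_add(1)[OF ix(1,2)] bs(2)])
      (simp add: l1_r1[OF T Tx])
  also have "\<dots> = (LINT t:{0..b}|lborel. l2 pxt pxx t) + (LINT t:{0..b}|lborel. r2 px t)"
    by (rule set_integral_add(2)[OF ix(1,2)])
  also have "\<dots> = (\<integral>z. U b z * y b z * px b (Y b z) \<partial>M) - (\<integral>z. U 0 z * y 0 z * px 0 (Y 0 z) \<partial>M)"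
    by (rule lr2_integral[OF Tx bs])
  also have "\<dots> = - (\<integral>z. v b z * p b (Y b z) \<partial>M) + (\<integral>z. v 0 z * p 0 (Y 0 z) \<partial>M)"
    using Ux_parts[OF T regular_nondeg[OF b]] Ux_parts[OF T g0] by simp
  finally show "(LINT t:{0..b}|lborel. ?L t) - (LINT t:{0..b}|lborel. ?R t)
       = - (LINT x:{0..1}|lborel. eux b x * p b x) + (\<integral>z. v 0 z * p 0 (Y 0 z) \<partial>M)" using eb by simp
qed

section \<open>The energy balance\<close>

text \<open>The energy density obeys an ordinary differential equation along each characteristic, so
  no integration by parts in space occurs: the time derivative of \<open>e * p(Y)\<close> is already
  the sum of the two integrands.\<close>

theorem weak4:
  assumes T: "test_triple p pt px" and b: "regular b"
  shows "set_integrable lborel {0..b} (\<lambda>t. LINT x:{0..1}|lborel. (eux t x)\<^sup>2 * pt t x - (eu t x)\<^sup>2 * (eux t x)\<^sup>2 * px t x)"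
    "set_integrable lborel {0..b} (\<lambda>t. LINT x:{0..1}|lborel.
        (2 * eu t x * eux t x - 2 * eux t x * Smean (\<lambda>y. eu t y - eu t y * (eux t y)\<^sup>2)) * p t x)"
    "(LINT t:{0..b}|lborel. LINT x:{0..1}|lborel. (eux t x)\<^sup>2 * pt t x - (eu t x)\<^sup>2 * (eux t x)\<^sup>2 * px t x) + (LINT t:{0..b}|lborel. LINT x:{0..1}|lborel.
        (2 * eu t x * eux t x - 2 * eux t x * Smean (\<lambda>y. eu t y - eu t y * (eux t y)\<^sup>2)) * p t x)
       = (LINT x:{0..1}|lborel. (eux b x)\<^sup>2 * p b x) - (\<integral>z. e 0 z * p 0 (Y 0 z) \<partial>M)"
proof -
  let ?L = "\<lambda>t. LINT x:{0..1}|lborel. (eux t x)\<^sup>2 * pt t x - (eu t x)\<^sup>2 * (eux t x)\<^sup>2 * px t x"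
  let ?R = "\<lambda>t. LINT x:{0..1}|lborel.
        (2 * eu t x * eux t x - 2 * eux t x * Smean (\<lambda>y. eu t y - eu t y * (eux t y)\<^sup>2)) * p t x"
  have bs: "0 \<le> b" "b \<le> s" using b by (auto simp: regular_def rng_def)
  note [measurable] = test_triple_slice(1-3)[OF T]
  note ps = test_triple_slice(4-6)[OF T]
  let ?l = "\<lambda>t z. e t z * pt t (Y t z) - (U t z)\<^sup>2 * e t z * px t (Y t z)"
  let ?r = "\<lambda>t z. (2 * U t z * v t z - 2 * v t z * m) * p t (Y t z)"
  have b2: "bdd_meas2 ?l" "bdd_meas2 ?r" by (intro bdd_meas2_intros bdd_meas2_base test_triple_bm2[OF T])+
  note i = b2[THEN bdd_meas2_int_integrable, OF bs(2)]
  have L: "?L t = (if t \<in> exceptional then 0 else \<integral>z. ?l t z \<partial>M)" if t: "0 \<le> t" "t \<le> b" for t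
  proof (cases "regular t")
    case True
    note r = regular_rng[OF True]
    have "?L t = (\<integral>z. ?l t z \<partial>M)"
    proof (rule eul_int[OF True])
      show "(\<lambda>x. (eux t x)\<^sup>2 * pt t x - (eu t x)\<^sup>2 * (eux t x)\<^sup>2 * px t x) \<in> borel_measurable borel" by measurable
      show "periodic1 (\<lambda>x. (eux t x)\<^sup>2 * pt t x - (eu t x)\<^sup>2 * (eux t x)\<^sup>2 * px t x)" by (intro periodic1_intros per_eu ps)
      show "bdd_meas (?l t)" by (rule bdd_meas2_slice[OF b2(1) r])
      show "y t z * ((eux t (Y t z))\<^sup>2 * pt t (Y t z) - (eu t (Y t z))\<^sup>2 * (eux t (Y t z))\<^sup>2 * px t (Y t z)) = ?l t z"
        if z: "0 < z" "z < 1" "0 < y t z" for z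
      proof -
        have "y t z * ((eux t (Y t z))\<^sup>2 * pt t (Y t z) - (eu t (Y t z))\<^sup>2 * (eux t (Y t z))\<^sup>2 * px t (Y t z))
          = (y t z * (eux t (Y t z))\<^sup>2) * pt t (Y t z) - (U t z)\<^sup>2 * (y t z * (eux t (Y t z))\<^sup>2) * px t (Y t z)"
          using z by (simp add: eu_Y(1)[OF True] algebra_simps)
        then show ?thesis unfolding eux2_Y[OF True z] .
      qed
    qed
    then show ?thesis using True range_regular[OF t bs(2)] by simp
  next
    case False
    then show ?thesis using range_regular[OF t bs(2)] by (simp add: not_regular)
  qed
  have R: "?R t = (if t \<in> exceptional then 0 else \<integral>z. ?r t z \<partial>M)" if t: "0 \<le> t" "t \<le> b" for t
  proof (cases "regular t")
    case True
    note r = regular_rng[OF True]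
    have "?R t = (LINT x:{0..1}|lborel. (2 * eu t x * eux t x - 2 * eux t x * m) * p t x)"
      using mean_ew[OF True] by (simp add: ew_def[abs_def])
    also have "\<dots> = (\<integral>z. ?r t z \<partial>M)"
    proof (rule eul_int[OF True])
      show "(\<lambda>x. (2 * eu t x * eux t x - 2 * eux t x * m) * p t x) \<in> borel_measurable borel" by measurable
      show "periodic1 (\<lambda>x. (2 * eu t x * eux t x - 2 * eux t x * m) * p t x)" by (intro periodic1_intros per_eu ps)
      show "bdd_meas (?r t)" by (rule bdd_meas2_slice[OF b2(2) r])
      show "y t z * ((2 * eu t (Y t z) * eux t (Y t z) - 2 * eux t (Y t z) * m) * p t (Y t z)) = ?r t z"
        if z: "0 < z" "z < 1" "0 < y t z" for z
        using z by (simp add: eu_Y[OF True] field_simps)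
    qed
    finally show ?thesis using True range_regular[OF t bs(2)] by simp
  next
    case False
    then show ?thesis using range_regular[OF t bs(2)] by (simp add: not_regular)
  qed
  note tl = exceptional_transfer[OF i(1) L] and tr = exceptional_transfer[OF i(2) R]
  show "set_integrable lborel {0..b} ?L" by (rule tl(1))
  show "set_integrable lborel {0..b} ?R" by (rule tr(1))
  note r = regular_rng[OF b]
  have r0: "rng 0" using s by (simp add: rng_def)
  have bb: "bdd_meas (\<lambda>z. e t z * p t (Y t z))" if "rng t" for t
    by (intro bdd_meas_intros bdd_meas_t bdd_meas2_slice[OF test_triple_bm2(1)[OF T]] that)
  have eb: "(LINT x:{0..1}|lborel. (eux b x)\<^sup>2 * p b x) = (\<integral>z. e b z * p b (Y b z) \<partial>M)"
  proof (rule eul_int[OF b])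
    show "(\<lambda>x. (eux b x)\<^sup>2 * p b x) \<in> borel_measurable borel" by measurable
    show "periodic1 (\<lambda>x. (eux b x)\<^sup>2 * p b x)" by (intro periodic1_intros per_eu ps)
    show "bdd_meas (\<lambda>z. e b z * p b (Y b z))" by (rule bb[OF r])
    show "y b z * ((eux b (Y b z))\<^sup>2 * p b (Y b z)) = e b z * p b (Y b z)" if "0 < z" "z < 1" "0 < y b z" for z
      using eux2_Y[OF b that] by (simp flip: mult.assoc)
  qed
  have d2: "bdd_meas2 (\<lambda>t z. ?l t z + ?r t z)" by (intro bdd_meas2_add b2)
  obtain K where K: "K \<ge> 0" "\<And>t z. 0 \<le> t \<Longrightarrow> t \<le> s \<Longrightarrow> \<bar>?l t z + ?r t z\<bar> \<le> K"
    by (rule bdd_meas2E[OF d2]) (rule that)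
  have "(LINT t:{0..b}|lborel. (\<integral>z. ?l t z + ?r t z \<partial>M)) = (\<integral>z. e b z * p b (Y b z) \<partial>M) - (\<integral>z. e 0 z * p 0 (Y 0 z) \<partial>M)"
  proof (rule time_FTC[where f = "\<lambda>t z. e t z * p t (Y t z)" and K = K])
    show "((\<lambda>t. e t z * p t (Y t z)) has_real_derivative ?l t z + ?r t z) (at t)" if "0 \<le> t" "t \<le> b" for t z
    proof -
      have t: "0 \<le> t" "t \<le> s" using that bs by auto
      show ?thesis
        by (rule DERIV_cong[OF DERIV_mult[OF der(3)[OF t] der_Psi[OF T t]]]) (simp add: algebra_simps)
    qed
    show "(\<lambda>(t, z). ?l t z + ?r t z) \<in> borel_measurable (borel \<Otimes>\<^sub>M borel)" by (rule bdd_meas2_meas[OF d2])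
    show "\<bar>?l t z + ?r t z\<bar> \<le> K" if "0 \<le> t" "t \<le> b" for t z using K(2)[of t z] that bs by simp
  qed (use bs bb[OF r] bb[OF r0] in auto)
  moreover have "(LINT t:{0..b}|lborel. (\<integral>z. ?l t z + ?r t z \<partial>M))
     = (LINT t:{0..b}|lborel. (\<integral>z. ?l t z \<partial>M) + (\<integral>z. ?r t z \<partial>M))"
    unfolding set_lebesgue_integral_def
  proof (intro Bochner_Integration.integral_cong refl)
    fix t
    have "(\<integral>z. ?l t z + ?r t z \<partial>M) = (\<integral>z. ?l t z \<partial>M) + (\<integral>z. ?r t z \<partial>M)" if "t \<in> {0..b}"
    proof -
      have "rng t" using that bs by (simp add: rng_def)
      then show ?thesis
        by (intro Bochner_Integration.integral_add bdd_meas_integrable bdd_meas2_slice[OF b2(1)] bdd_meas2_slice[OF b2(2)])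
    qed
    then show "indicator {0..b} t *\<^sub>R (\<integral>z. ?l t z + ?r t z \<partial>M) = indicator {0..b} t *\<^sub>R ((\<integral>z. ?l t z \<partial>M) + (\<integral>z. ?r t z \<partial>M))"
      by (simp add: indicator_def)
  qed
  ultimately show "(LINT t:{0..b}|lborel. ?L t) + (LINT t:{0..b}|lborel. ?R t)
       = (LINT x:{0..1}|lborel. (eux b x)\<^sup>2 * p b x) - (\<integral>z. e 0 z * p 0 (Y 0 z) \<partial>M)"
    using eb tl(2) tr(2) set_integral_add(2)[OF i] by simp
qed

end

section \<open>The lemma of du Bois-Reymond on the circle\<close>

text \<open>\<open>arcf c\<close> is positive exactly on the arc \<open>(0, c)\<close>, so its logistic images are smooth, periodic,
  and converge to the indicator of the arc.\<close>

definition arcf :: "real \<Rightarrow> real \<Rightarrow> real" where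
  "arcf c x = cos (2 * pi * x - pi * c) - cos (pi * c)"

definition arcstep :: "real \<Rightarrow> real \<Rightarrow> real \<Rightarrow> real" where
  "arcstep n c x = 1 / (1 + exp (- (n * arcf c x)))"

text \<open>A class closed under differentiation: all iterated derivatives then stay inside it, and
  \<open>smooth1\<close> follows by one induction with no formula for higher derivatives.\<close>

inductive_set arc_fun :: "real \<Rightarrow> real \<Rightarrow> (real \<Rightarrow> real) set" for n c :: real where
  "(\<lambda>_. k) \<in> arc_fun n c"
| "(\<lambda>x. sin (2 * pi * x - pi * c)) \<in> arc_fun n c"
| "(\<lambda>x. cos (2 * pi * x - pi * c)) \<in> arc_fun n c"
| "arcstep n c \<in> arc_fun n c"
| "f \<in> arc_fun n c \<Longrightarrow> g \<in> arc_fun n c \<Longrightarrow> (\<lambda>x. f x + g x) \<in> arc_fun n c"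
| "f \<in> arc_fun n c \<Longrightarrow> g \<in> arc_fun n c \<Longrightarrow> (\<lambda>x. f x * g x) \<in> arc_fun n c"

text \<open>The logistic function satisfies \<open>s' = s (1 - s)\<close>, so the derivative is
  polynomial in \<open>arcstep\<close> and the sine; it is written without subtraction to match the
  closure rules of \<open>arc_fun\<close>.\<close>

lemma arcstep_deriv:
  "(arcstep n c has_real_derivative
     arcstep n c x * (1 + (- 1) * arcstep n c x) * ((- 2 * pi * n) * sin (2 * pi * x - pi * c))) (at x)"
proof -
  have pos: "1 + exp (- (n * arcf c x)) \<noteq> 0" using add_pos_pos[OF zero_less_one exp_gt_zero, of "- (n * arcf c x)"] by simp
  have d: "((\<lambda>x. 1 + exp (- (n * arcf c x))) has_real_derivative
      exp (- (n * arcf c x)) * (n * (2 * pi) * sin (2 * pi * x - pi * c))) (at x)"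
    unfolding arcf_def by (auto intro!: derivative_eq_intros)
  have "((\<lambda>x. inverse (1 + exp (- (n * arcf c x)))) has_real_derivative
     - (inverse (1 + exp (- (n * arcf c x))) * (exp (- (n * arcf c x)) * (n * (2 * pi) * sin (2 * pi * x - pi * c)))
        * inverse (1 + exp (- (n * arcf c x))))) (at x)"
    by (rule DERIV_inverse'[OF d pos])
  moreover have I: "(\<lambda>x. inverse (1 + exp (- (n * arcf c x)))) = arcstep n c"
    by (simp add: fun_eq_iff arcstep_def inverse_eq_divide)
  ultimately have 1: "(arcstep n c has_real_derivative
     - (arcstep n c x * (exp (- (n * arcf c x)) * (n * (2 * pi) * sin (2 * pi * x - pi * c))) * arcstep n c x)) (at x)"
    by (simp only: I fun_cong[OF I])
  have "exp (- (n * arcf c x)) * arcstep n c x = 1 + (- 1) * arcstep n c x"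
    using pos by (simp add: arcstep_def field_simps)
  then have 2: "arcstep n c x * (1 + (- 1) * arcstep n c x) = arcstep n c x * (exp (- (n * arcf c x)) * arcstep n c x)"
    by (simp only:)
  show ?thesis by (rule DERIV_cong[OF 1], unfold 2) (simp add: mult_ac)
qed

lemma arc_fun_deriv: "f \<in> arc_fun n c \<Longrightarrow> \<exists>g \<in> arc_fun n c. \<forall>x. (f has_real_derivative g x) (at x)"
proof (induction rule: arc_fun.induct)
  case (1 k)
  then show ?case by (intro bexI[of _ "\<lambda>_. 0"] arc_fun.intros) auto
next
  case 2
  have "(\<lambda>x. (2 * pi) * cos (2 * pi * x - pi * c)) \<in> arc_fun n c" by (intro arc_fun.intros)
  then show ?case by (rule bexI[rotated]) (auto intro!: derivative_eq_intros)
next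
  case 3
  have "(\<lambda>x. (- 2 * pi) * sin (2 * pi * x - pi * c)) \<in> arc_fun n c" by (intro arc_fun.intros)
  then show ?case by (rule bexI[rotated]) (auto intro!: derivative_eq_intros)
next
  case 4
  have "(\<lambda>x. arcstep n c x * (1 + (- 1) * arcstep n c x) * ((- 2 * pi * n) * sin (2 * pi * x - pi * c))) \<in> arc_fun n c"
    by (intro arc_fun.intros)
  then show ?case by (rule bexI[rotated]) (intro allI arcstep_deriv)
next
  case (5 f g)
  then obtain f' g' where "f' \<in> arc_fun n c" "g' \<in> arc_fun n c" "\<forall>x. (f has_real_derivative f' x) (at x)"
    "\<forall>x. (g has_real_derivative g' x) (at x)" by blast
  then show ?case by (intro bexI[of _ "\<lambda>x. f' x + g' x"] arc_fun.intros) (auto intro: DERIV_add)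
next
  case (6 f g)
  then obtain f' g' where fg: "f' \<in> arc_fun n c" "g' \<in> arc_fun n c" "\<forall>x. (f has_real_derivative f' x) (at x)"
    "\<forall>x. (g has_real_derivative g' x) (at x)" by blast
  with 6 have "(\<lambda>x. f' x * g x + g' x * f x) \<in> arc_fun n c" by (intro arc_fun.intros)
  then show ?case by (rule bexI[rotated]) (use fg in \<open>auto intro: DERIV_mult\<close>)
qed

lemma arc_fun_iterate: "f \<in> arc_fun n c \<Longrightarrow> (deriv ^^ k) f \<in> arc_fun n c"
proof (induction k)
  case (Suc k)
  then obtain g where "g \<in> arc_fun n c" "\<forall>x. ((deriv ^^ k) f has_real_derivative g x) (at x)" using arc_fun_deriv by blast
  moreover from this have "deriv ((deriv ^^ k) f) = g" by (auto intro: DERIV_imp_deriv)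
  ultimately show ?case by simp
qed simp

lemma arc_fun_smooth: "f \<in> arc_fun n c \<Longrightarrow> smooth1 f"
  unfolding smooth1_def
  using arc_fun_deriv[OF arc_fun_iterate] real_differentiable_def by meson

lemma smooth1_const: "smooth1 (\<lambda>_. k)"
  by (rule arc_fun_smooth[of _ 0 0]) (rule arc_fun.intros)

lemma arcstep_periodic: "periodic1 (arcstep n c)"
proof -
  have "cos (2 * pi * (x + 1) - pi * c) = cos (2 * pi * x - pi * c)" for x
    using cos_periodic[of "2 * pi * x - pi * c"] by (simp add: algebra_simps)
  then show ?thesis by (simp add: periodic1_def arcstep_def arcf_def)
qed

lemma arcstep_bounds: "0 \<le> arcstep n c x" "arcstep n c x \<le> 1"
proof -
  have "0 < 1 + exp (- (n * arcf c x))" by (intro add_pos_pos) simp_all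
  then show "0 \<le> arcstep n c x" "arcstep n c x \<le> 1"
    unfolding arcstep_def by (auto simp: divide_le_eq intro: add_pos_pos)
qed

text \<open>The increment over one period is constant in \<open>x\<close> and equals the mean, which
  is zero; this gives periodicity.\<close>

lemma smooth_antiderivative:
  assumes q: "continuous_on UNIV q" "periodic1 q" "smooth1 q"
    and mean: "(LINT x:{0..1}|lborel. q x) = 0"
  obtains \<phi> where "smooth1 \<phi>" "periodic1 \<phi>" "deriv \<phi> = q"
proof -
  define \<phi> where "\<phi> x = (LBINT y=ereal 0..ereal x. q y)" for x :: real
  have d: "(\<phi> has_real_derivative q x) (at x)" for x
  proof -
    let ?a = "- (\<bar>x\<bar> + 1)" and ?b = "\<bar>x\<bar> + 1"
    have "((\<lambda>u. LBINT y=ereal 0..ereal u. q y) has_vector_derivative q x) (at x within {?a..?b})"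
      by (rule interval_integral_FTC2) (use q in \<open>auto intro: continuous_on_subset\<close>)
    then have "((\<lambda>u. LBINT y=ereal 0..ereal u. q y) has_vector_derivative q x) (at x)"
      by (subst (asm) at_within_interior) auto
    then show ?thesis unfolding \<phi>_def[abs_def] by (simp add: has_real_derivative_iff_has_vector_derivative)
  qed
  have dq: "deriv \<phi> = q" using d by (auto intro: DERIV_imp_deriv)
  have "smooth1 \<phi>"
    unfolding smooth1_def
  proof (intro allI)
    fix n x
    show "(deriv ^^ n) \<phi> differentiable (at x)"
    proof (cases n)
      case 0
      then show ?thesis using d[of x] by (auto simp: real_differentiable_def)
    next
      case (Suc k)
      then have "(deriv ^^ n) \<phi> = (deriv ^^ k) q" by (simp add: funpow_Suc_right dq del: funpow.simps)
      then show ?thesis using q(3) by (simp add: smooth1_def)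
    qed
  qed
  moreover have "periodic1 \<phi>"
  proof -
    have "((\<lambda>x. \<phi> (x + 1) - \<phi> x) has_real_derivative 0) (at x)" for x
      using DERIV_diff[OF DERIV_shift[THEN iffD1, OF d[of "x + 1"]] d[of x]] q(2) by (simp add: periodic1_def)
    then have "\<phi> (x + 1) - \<phi> x = \<phi> (0 + 1) - \<phi> 0" for x
      using DERIV_isconst_all[of "\<lambda>x. \<phi> (x + 1) - \<phi> x"] by blast
    moreover have "\<phi> 1 = 0" using mean interval_integral_Icc[of 0 1 q] by (simp add: \<phi>_def)
    moreover have "\<phi> 0 = 0" by (simp add: \<phi>_def)
    ultimately show ?thesis by (simp add: periodic1_def)
  qed
  ultimately show thesis using that dq by blast
qed

text \<open>On the arc the angle \<open>2 * pi * x\<close> lies within \<open>pi * c\<close> of its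
  central value \<open>pi * c\<close>, and the cosine decreases with the distance from the centre up
  to \<open>pi\<close>.\<close>

lemma arcf_sign:
  assumes c: "0 < c" "c < 1" and x: "0 \<le> x" "x \<le> 1"
  shows "0 < x \<Longrightarrow> x < c \<Longrightarrow> 0 < arcf c x" "c < x \<Longrightarrow> x < 1 \<Longrightarrow> arcf c x < 0"
proof -
  have pc: "0 < pi * c" "pi * c < pi" using c by auto
  assume "0 < x" "x < c"
  define \<theta> where "\<theta> = \<bar>2 * pi * x - pi * c\<bar>"
  have "pi * x < pi * c" "0 < pi * x" using \<open>0 < x\<close> \<open>x < c\<close> by auto
  then have "\<theta> < pi * c" unfolding \<theta>_def by linarith
  then have "cos (pi * c) < cos \<theta>" using pc by (intro cos_monotone_0_pi) (auto simp: \<theta>_def)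
  then show "0 < arcf c x" by (simp add: \<theta>_def arcf_def)
next
  have pc: "0 < pi * c" "pi * c < pi" using c by auto
  assume xc: "c < x" "x < 1"
  define \<theta> where "\<theta> = 2 * pi * x - pi * c"
  have "pi * c < pi * x" "pi * x < pi" using xc by auto
  then have t: "pi * c < \<theta>" "\<theta> < 2 * pi - pi * c" unfolding \<theta>_def by linarith+
  have "cos \<theta> < cos (pi * c)"
  proof (cases "\<theta> \<le> pi")
    case True
    then show ?thesis using t pc by (intro cos_monotone_0_pi) auto
  next
    case False
    have "cos \<theta> = cos (2 * pi - \<theta>)" by simp
    also have "\<dots> < cos (pi * c)" using t pc False by (intro cos_monotone_0_pi) auto
    finally show ?thesis .
  qed
  then show "arcf c x < 0" by (simp add: \<theta>_def arcf_def)
qed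

lemma logistic_tendsto:
  assumes "a \<noteq> 0"
  shows "(\<lambda>n. 1 / (1 + exp (- (real n * a)))) \<longlonglongrightarrow> (if 0 < a then 1 else 0)"
proof (cases "0 < a")
  case True
  then have "(\<lambda>n. 1 / (1 + exp (- (real n * a)))) \<longlonglongrightarrow> 1" by real_asymp
  then show ?thesis using True by simp
next
  case False
  then have "a < 0" using assms by simp
  then have "(\<lambda>n. 1 / (1 + exp (- (real n * a)))) \<longlonglongrightarrow> 0" by real_asymp
  then show ?thesis using False by simp
qed

text \<open>Testing with antiderivatives of smoothed arc indicators minus their means shows that
  \<open>D\<close> minus its mean is orthogonal to every arc starting at 0. Its positive and
  negative parts then have equal mass on all right half-lines, hence are equal almost everywhere,
  and the difference vanishes.\<close>

lemma du_Bois_Reymond: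
  assumes D: "set_integrable lborel {0..1} D"
    and ort: "\<And>\<phi>. smooth1 \<phi> \<Longrightarrow> periodic1 \<phi> \<Longrightarrow> (LINT x:{0..1}|lborel. D x * deriv \<phi> x) = 0"
  shows "\<exists>c. AE x in lborel. x \<in> {0..1} \<longrightarrow> D x = c"
proof -
  define d where "d = (LINT x:{0..1}|lborel. D x)"
  \<comment> \<open>Extended by zero to the whole line, so that right half-lines can serve as a
    determining class.\<close>
  define E where "E x = indicator {0..1} x * (D x - d)" for x
  have Di: "integrable lborel (\<lambda>x. indicator {0..1} x * D x)" using D by (simp add: set_integrable_def)
  have ind: "integrable lborel (indicator {0..1::real} :: real \<Rightarrow> real)" by (simp add: integrable_indicator_iff)
  have E_alt: "E x = indicator {0..1} x * D x - indicator {0..1} x * d" for x by (simp add: E_def right_diff_distrib)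
  have Ei: "integrable lborel E"
    unfolding E_alt[abs_def] by (intro Bochner_Integration.integrable_diff Di integrable_mult_left ind)
  note [measurable] = borel_measurable_integrable[OF Ei]
  have E0: "(\<integral>x. E x \<partial>lborel) = 0"
    unfolding E_alt[abs_def] using Di ind by (simp add: d_def set_lebesgue_integral_def)
  have q0: "(\<integral>x. E x * q x \<partial>lborel) = 0" if q: "q = arcstep n c" for q n c
  proof -
    have qs: "smooth1 q" using arc_fun_smooth[OF arc_fun.intros(4)[of n c]] q by simp
    have qp: "periodic1 q" using q arcstep_periodic by simp
    note qc = smooth1_deriv(2)[OF qs]
    have qb: "0 \<le> q x" "q x \<le> 1" for x using q arcstep_bounds by auto
    have [measurable]: "q \<in> borel_measurable borel" using qc by (rule borel_measurable_continuous_onI)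
    \<comment> \<open>Subtracting the mean makes the antiderivative periodic, hence an admissible
      test function.\<close>
    define qm where "qm = (LINT x:{0..1}|lborel. q x)"
    have qi: "integrable lborel (\<lambda>x. indicator {0..1} x * q x)"
      by (rule Bochner_Integration.integrable_bound[OF ind]) (use qb in \<open>auto simp: indicator_def abs_le_iff intro!: AE_I2 order_trans[OF _ qb(1)]\<close>)
    have m0: "(LINT x:{0..1}|lborel. q x + (- qm)) = 0"
      using qi ind by (simp add: set_lebesgue_integral_def right_diff_distrib qm_def)
    have "(\<lambda>x. q x + (- qm)) \<in> arc_fun n c" unfolding q by (intro arc_fun.intros)
    then have s: "smooth1 (\<lambda>x. q x + (- qm))" by (rule arc_fun_smooth)
    obtain \<phi> where \<phi>: "smooth1 \<phi>" "periodic1 \<phi>" "deriv \<phi> = (\<lambda>x. q x + (- qm))"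
      using smooth_antiderivative[OF smooth1_deriv(2)[OF s] _ s m0] qp by (auto simp: periodic1_def)
    have "(LINT x:{0..1}|lborel. D x * (q x + (- qm))) = 0" using ort[OF \<phi>(1,2)] \<phi>(3) by simp
    moreover have Dq: "integrable lborel (\<lambda>x. indicator {0..1} x * D x * q x)"
      by (rule Bochner_Integration.integrable_bound[OF Di])
        (use qb borel_measurable_integrable[OF Di] in \<open>auto simp: abs_mult intro!: AE_I2 mult_left_le\<close>)
    moreover have "indicator {0..1} x * (D x * (q x + (- qm))) = indicator {0..1} x * D x * q x - qm * (indicator {0..1} x * D x)" for x
      by (simp add: algebra_simps)
    ultimately have 1: "(\<integral>x. indicator {0..1} x * D x * q x \<partial>lborel) = qm * d"
      using Di by (simp add: set_lebesgue_integral_def d_def)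
    have "(\<integral>x. E x * q x \<partial>lborel) = (\<integral>x. indicator {0..1} x * D x * q x - d * (indicator {0..1} x * q x) \<partial>lborel)"
      by (intro Bochner_Integration.integral_cong refl) (simp add: E_def algebra_simps)
    also have "\<dots> = qm * d - d * qm" using 1 Dq qi by (simp add: qm_def set_lebesgue_integral_def)
    finally show ?thesis by simp
  qed
  have int_c: "(\<integral>x. E x * indicator {0<..<c} x \<partial>lborel) = 0" if c: "0 < c" "c < 1" for c
  proof -
    have "(\<lambda>n. \<integral>x. E x * arcstep (real n) c x \<partial>lborel) \<longlonglongrightarrow> (\<integral>x. E x * indicator {0<..<c} x \<partial>lborel)"
    proof (rule integral_dominated_convergence[where w = "\<lambda>x. \<bar>E x\<bar>"])
      have "AE x in lborel. x \<noteq> 0 \<and> x \<noteq> c \<and> x \<noteq> 1"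
        using AE_lborel_singleton[of 0] AE_lborel_singleton[of 1] AE_lborel_singleton[of c] by eventually_elim auto
      then show "AE x in lborel. (\<lambda>n. E x * arcstep (real n) c x) \<longlonglongrightarrow> E x * indicator {0<..<c} x"
      proof eventually_elim
        case (elim x)
        show ?case
        proof (cases "x \<in> {0..1}")
          case False then show ?thesis by (simp add: E_def)
        next
          case True
          then have "arcf c x \<noteq> 0 \<and> (0 < arcf c x \<longleftrightarrow> x < c)"
            using arcf_sign[OF c, of x] elim by (cases "x < c") auto
          then have "(\<lambda>n. arcstep (real n) c x) \<longlonglongrightarrow> indicator {0<..<c} x"
            using logistic_tendsto[of "arcf c x"] True elim unfolding arcstep_def by (auto simp: indicator_def)
          then show ?thesis by (rule tendsto_mult_left)
        qed
      qed
      show "AE x in lborel. norm (E x * arcstep (real n) c x) \<le> \<bar>E x\<bar>" for n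
        using arcstep_bounds by (auto simp: abs_mult intro!: mult_left_le)
      show "(\<lambda>x. E x * arcstep (real n) c x) \<in> borel_measurable lborel" for n
        using smooth1_deriv(2)[OF arc_fun_smooth[OF arc_fun.intros(4)], of n c, THEN borel_measurable_continuous_onI] by measurable
      show "integrable lborel (\<lambda>x. \<bar>E x\<bar>)" using Ei by simp
    qed measurable
    then show ?thesis using q0[OF refl] by (simp add: LIMSEQ_const_iff)
  qed
  have tail: "(\<integral>x. indicator {c<..} x * E x \<partial>lborel) = 0" for c
  proof -
    consider "c \<le> 0" | "0 < c" "c < 1" | "1 \<le> c" by linarith
    then show ?thesis
    proof cases
      case 1
      have "(\<integral>x. indicator {c<..} x * E x \<partial>lborel) = (\<integral>x. E x \<partial>lborel)"
        by (rule integral_discrete_difference[where X = "{0}"]) (use 1 in \<open>auto simp: E_def indicator_def\<close>)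
      then show ?thesis using E0 by simp
    next
      case 2
      have "(\<integral>x. indicator {c<..} x * E x \<partial>lborel) = (\<integral>x. E x - E x * indicator {0<..<c} x \<partial>lborel)"
        by (rule integral_discrete_difference[where X = "{0, c}"]) (use 2 in \<open>auto simp: E_def indicator_def\<close>)
      also have "\<dots> = (\<integral>x. E x \<partial>lborel) - (\<integral>x. E x * indicator {0<..<c} x \<partial>lborel)"
        by (intro Bochner_Integration.integral_diff Ei integrable_real_mult_indicator) auto
      finally show ?thesis using E0 int_c[OF 2] by simp
    next
      case 3
      have "(\<lambda>x. indicator {c<..} x * E x) = (\<lambda>_. 0)" using 3 by (auto simp: E_def indicator_def fun_eq_iff)
      then show ?thesis by (simp only: Bochner_Integration.integral_zero)
    qed
  qed
  let ?P = "\<lambda>x. ennreal (E x)" and ?N = "\<lambda>x. ennreal (- E x)"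
  have em: "emeasure (density lborel (\<lambda>x. ennreal (f x))) {c<..} = ennreal (\<integral>x. indicator {c<..} x * max 0 (f x) \<partial>lborel)"
    if f: "integrable lborel f" for f :: "real \<Rightarrow> real" and c
  proof -
    note [measurable] = borel_measurable_integrable[OF f]
    have "integrable lborel (\<lambda>x. max 0 (f x))" using f by simp
    then have i: "integrable lborel (\<lambda>x. indicator {c<..} x * max 0 (f x))"
      using integrable_real_mult_indicator[of "{c<..}" lborel "\<lambda>x. max 0 (f x)"] by (simp add: mult.commute)
    have "emeasure (density lborel (\<lambda>x. ennreal (f x))) {c<..} = (\<integral>\<^sup>+x. ennreal (indicator {c<..} x * max 0 (f x)) \<partial>lborel)"
      by (subst emeasure_density) (auto intro!: nn_integral_cong simp: indicator_def max_def ennreal_neg)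
    also have "\<dots> = ennreal (\<integral>x. indicator {c<..} x * max 0 (f x) \<partial>lborel)"
      by (rule nn_integral_eq_integral[OF i]) auto
    finally show ?thesis .
  qed
  have eq: "emeasure (density lborel ?P) {c<..} = emeasure (density lborel ?N) {c<..}" for c
  proof -
    have i: "integrable lborel (\<lambda>x. max 0 (E x))" "integrable lborel (\<lambda>x. max 0 (- E x))" using Ei by simp_all
    have j: "integrable lborel (\<lambda>x. indicator {c<..} x * max 0 (E x))" "integrable lborel (\<lambda>x. indicator {c<..} x * max 0 (- E x))"
      using i[THEN integrable_real_mult_indicator[rotated], of "{c<..}"] by (simp_all add: mult.commute)
    have "(\<integral>x. indicator {c<..} x * max 0 (E x) \<partial>lborel) - (\<integral>x. indicator {c<..} x * max 0 (- E x) \<partial>lborel)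
       = (\<integral>x. indicator {c<..} x * max 0 (E x) - indicator {c<..} x * max 0 (- E x) \<partial>lborel)"
      using j by simp
    also have "\<dots> = (\<integral>x. indicator {c<..} x * E x \<partial>lborel)"
      by (intro Bochner_Integration.integral_cong refl) (auto simp: indicator_def max_def)
    finally show ?thesis using tail[of c] Ei by (simp add: em)
  qed
  have "density lborel ?P = density lborel ?N"
  proof (rule measure_eqI_lessThan)
    show "emeasure (density lborel ?P) {c<..} < \<infinity>" for c using em[OF Ei] by simp
  qed (use eq in auto)
  then have "AE x in lborel. ?P x = ?N x"
    by (subst (asm) sigma_finite_measure.density_unique_iff[OF sigma_finite_lborel]) auto
  then have "AE x in lborel. x \<in> {0..1} \<longrightarrow> D x = d"
  proof eventually_elim
    case (elim x)
    then have "E x = 0" by (cases "0 \<le> E x") (auto simp: ennreal_neg ennreal_eq_0_iff)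
    then show ?case by (auto simp: E_def)
  qed
  then show ?thesis ..
qed

section \<open>Solutions on a short time interval\<close>

text \<open>What a restart needs: regularity in space and the two conserved numbers, since the time
  step depends on nothing else.\<close>

definition good_state :: "real \<Rightarrow> real \<Rightarrow> (real \<Rightarrow> real) \<Rightarrow> (real \<Rightarrow> real) \<Rightarrow> bool" where
  "good_state h m a ax \<longleftrightarrow> H1S a ax \<and> hval ax = h \<and> (LINT x:{0..1}|lborel. a x - a x * (ax x)\<^sup>2) = m"

text \<open>The space integrals in (i), (ii) and (iv) become functionals of single time slices, so
  that shifting in time is mere substitution.\<close>

definition "fL1 v w qxt qx = (LINT x:{0..1}|lborel. v x * qxt x + (v x)\<^sup>2 * w x * qx x :: real)"
definition "fR1 v w q = (LINT x:{0..1}|lborel. (v x - v x * (w x)\<^sup>2 - Smean (\<lambda>z. v z - v z * (w z)\<^sup>2)) * q x :: real)"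
definition "fL2 v qt qx = (LINT x:{0..1}|lborel. v x * qt x - 1/3 * (v x)^3 * qx x :: real)"
text \<open>\<open>ffun\<close> takes functions of time; constant ones evaluated at time 0 turn it
  into a functional of the slice.\<close>

definition "fR2 h v w q = (LINT x:{0..1}|lborel. (Sdxinv (\<lambda>z. v z - v z * (w z)\<^sup>2) x - ffun h (\<lambda>_. v) (\<lambda>_. w) 0) * q x :: real)"
definition "fL4 v w qt qx = (LINT z:{0..1}|lborel. (w z)\<^sup>2 * qt z - (v z)\<^sup>2 * (w z)\<^sup>2 * qx z :: real)"
definition "fR4 v w q = (LINT z:{0..1}|lborel. (2 * v z * w z - 2 * w z * Smean (\<lambda>y. v y - v y * (w y)\<^sup>2)) * q z :: real)"

text \<open>Boundary terms are kept at both ends so that consecutive pieces telescope; integrability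
  is included because additivity of the time integral needs it.\<close>

definition piece where
  "piece h b u ux a ax p pt px pxt \<longleftrightarrow>
     set_integrable lborel {0..b} (\<lambda>t. fL1 (u t) (ux t) (pxt t) (px t)) \<and>
     set_integrable lborel {0..b} (\<lambda>t. fR1 (u t) (ux t) (p t)) \<and>
     set_integrable lborel {0..b} (\<lambda>t. fL2 (u t) (pt t) (px t)) \<and>
     set_integrable lborel {0..b} (\<lambda>t. fR2 h (u t) (ux t) (p t)) \<and>
     set_integrable lborel {0..b} (\<lambda>t. fL4 (u t) (ux t) (pt t) (px t)) \<and>
     set_integrable lborel {0..b} (\<lambda>t. fR4 (u t) (ux t) (p t)) \<and>
     (LINT t:{0..b}|lborel. fL1 (u t) (ux t) (pxt t) (px t)) - (LINT t:{0..b}|lborel. fR1 (u t) (ux t) (p t))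
       = - (LINT x:{0..1}|lborel. ux b x * p b x) + (LINT x:{0..1}|lborel. ax x * p 0 x :: real) \<and>
     (LINT t:{0..b}|lborel. fL2 (u t) (pt t) (px t)) + (LINT t:{0..b}|lborel. fR2 h (u t) (ux t) (p t))
       = (LINT x:{0..1}|lborel. u b x * p b x) - (LINT x:{0..1}|lborel. a x * p 0 x :: real) \<and>
     (LINT t:{0..b}|lborel. fL4 (u t) (ux t) (pt t) (px t)) + (LINT t:{0..b}|lborel. fR4 (u t) (ux t) (p t))
       = (LINT x:{0..1}|lborel. (ux b x)\<^sup>2 * p b x) - (LINT x:{0..1}|lborel. (ax x)\<^sup>2 * p 0 x :: real)"

locale initial =
  fixes h m :: real and a ax :: "real \<Rightarrow> real"
  assumes gs: "good_state h m a ax" and h1: "h \<noteq> 1"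
begin

lemma H: "H1S a ax" and hv: "(LINT x:{0..1}|lborel. (ax x)\<^sup>2) = h"
  and mv: "(LINT x:{0..1}|lborel. a x - a x * (ax x)\<^sup>2) = m"
  using gs by (auto simp: good_state_def hval_def)

lemma ms [measurable]: "a \<in> borel_measurable borel" "ax \<in> borel_measurable borel"
  using H by (auto simp: H1S_def)

lemma sq: "set_integrable lborel {0..1} (\<lambda>x. (a x)\<^sup>2)" "set_integrable lborel {0..1} (\<lambda>x. (ax x)\<^sup>2)"
  using H by (auto simp: H1S_def)

lemma weak_deriv_test: "smooth1 \<phi> \<Longrightarrow> periodic1 \<phi> \<Longrightarrow>
    (LINT x:{0..1}|lborel. a x * deriv \<phi> x) = - (LINT x:{0..1}|lborel. ax x * \<phi> x)"
  using H by (auto simp: H1S_def)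

section \<open>The label measure and the initial densities\<close>

definition "\<rho> x = 1 + (ax x)\<^sup>2"
definition "M = density lborel (\<lambda>x. ennreal (indicator {0..1} x * \<rho> x))"
definition "y0 x = 1 / \<rho> x"
definition "v0 x = ax x / \<rho> x"
definition "e0 x = (ax x)\<^sup>2 / \<rho> x"

lemma rho1: "1 \<le> \<rho> x" "0 < \<rho> x" "\<rho> x \<noteq> 0"
proof -
  show "1 \<le> \<rho> x" by (simp add: \<rho>_def)
  then show "0 < \<rho> x" "\<rho> x \<noteq> 0" by auto
qed

lemma ms2 [measurable]: "\<rho> \<in> borel_measurable borel" "y0 \<in> borel_measurable borel" "v0 \<in> borel_measurable borel" "e0 \<in> borel_measurable borel"
  unfolding \<rho>_def[abs_def] y0_def[abs_def] v0_def[abs_def] e0_def[abs_def] by measurable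

lemma one_int: "set_integrable lborel {0..1::real} (\<lambda>_. 1 :: real)"
  by (simp add: set_integrable_def integrable_indicator_iff)

lemma rho_int: "set_integrable lborel {0..1} \<rho>"
  unfolding \<rho>_def[abs_def] by (intro set_integral_add(1) one_int sq)

lemma sets_M: "sets M = sets borel" by (simp add: M_def)

lemma emM: assumes "A \<in> sets borel"
  shows "emeasure M A = (\<integral>\<^sup>+x. ennreal (indicator {0..1} x * \<rho> x) * indicator A x \<partial>lborel)"
  unfolding M_def using assms by (subst emeasure_density) auto

lemma noatom_M: "noatom M"
proof -
  have "emeasure M (space M) = (\<integral>\<^sup>+x. ennreal (indicator {0..1} x * \<rho> x) \<partial>lborel)"
    using emM[of UNIV] by (simp add: M_def)
  also have "\<dots> = ennreal (\<integral>x. indicator {0..1} x * \<rho> x \<partial>lborel)"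
    using rho_int less_imp_le[OF rho1(2)] by (intro nn_integral_eq_integral) (auto simp: set_integrable_def)
  finally have "emeasure M (space M) \<noteq> \<infinity>" by simp
  then interpret finite_measure M by (rule finite_measureI)
  show ?thesis
  proof
    show "sets M = sets borel" by (rule sets_M)
    fix x :: real
    have "emeasure M {x} = (\<integral>\<^sup>+y. ennreal (indicator {0..1} x * \<rho> x) * indicator {x} y \<partial>lborel)"
      unfolding emM[OF borel_singleton[OF sets.empty_sets]]
      by (intro nn_integral_cong) (auto simp: indicator_def)
    then show "emeasure M {x} = 0" by (simp add: nn_integral_cmult_indicator)
  qed
qed

sublocale noatom M by (rule noatom_M)

lemma intM: assumes "g \<in> borel_measurable borel"
  shows "(\<integral>x. g x \<partial>M) = (LINT x:{0..1}|lborel. \<rho> x * g x)"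
proof -
  note [measurable] = assms
  show ?thesis unfolding M_def set_lebesgue_integral_def
    using less_imp_le[OF rho1(2)] by (subst integral_density) (auto simp: mult.assoc)
qed

lemma intM': assumes "g \<in> borel_measurable borel" "g' \<in> borel_measurable borel"
    and "AE x in lborel. x \<in> {0..1} \<longrightarrow> \<rho> x * g x = g' x"
  shows "(\<integral>x. g x \<partial>M) = (LINT x:{0..1}|lborel. g' x)"
  unfolding intM[OF assms(1)] set_lebesgue_integral_def
proof (rule integral_cong_AE)
  note [measurable] = assms(1,2)
  show "(\<lambda>x. indicator {0..1} x *\<^sub>R (\<rho> x * g x)) \<in> borel_measurable lborel"
    "(\<lambda>x. indicator {0..1} x *\<^sub>R g' x) \<in> borel_measurable lborel" by measurable
  show "AE x in lborel. indicator {0..1} x *\<^sub>R (\<rho> x * g x) = indicator {0..1} x *\<^sub>R g' x"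
    using assms(3) by eventually_elim (auto simp: indicator_def)
qed

lemma bm0: "bdd_meas y0" "bdd_meas v0" "bdd_meas e0"
proof -
  have "\<bar>y0 x\<bar> \<le> 1" for x using rho1[of x] by (simp add: y0_def abs_divide divide_le_eq)
  then show "bdd_meas y0" by (intro bdd_measI[where B = 1] ms2)
  have "\<bar>e0 x\<bar> \<le> 1" for x
    using rho1[of x] by (simp add: e0_def abs_divide divide_le_eq) (simp add: \<rho>_def)
  then show "bdd_meas e0" by (intro bdd_measI[where B = 1] ms2)
  have "\<bar>ax x\<bar> \<le> 1 + (ax x)\<^sup>2" for x
  proof -
    have "0 \<le> (\<bar>ax x\<bar> - 1/2)\<^sup>2" by simp
    then show ?thesis by (simp add: power2_eq_square algebra_simps)
  qed
  then show "bdd_meas v0" by (intro bdd_measI[where B = 1]) (auto simp: v0_def \<rho>_def abs_divide divide_le_eq intro: abs_of_nonneg[THEN sym, THEN subst])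
qed

text \<open>The total of \<open>v0\<close> is the mean of the weak derivative, which vanishes by
  testing with the constant 1.\<close>

lemma tot0: "(\<integral>z. v0 z \<partial>M) = 0" "(\<integral>z. y0 z \<partial>M) = 1" "(\<integral>z. e0 z \<partial>M) = h"
proof -
  have "(\<integral>z. v0 z \<partial>M) = (LINT x:{0..1}|lborel. ax x)"
    by (rule intM') (use rho1 in \<open>auto simp: v0_def\<close>)
  also have "\<dots> = 0" using weak_deriv_test[OF smooth1_const[of 1]] by (simp add: periodic1_def)
  finally show "(\<integral>z. v0 z \<partial>M) = 0" .
  have "(\<integral>z. y0 z \<partial>M) = (LINT x:{0..1::real}|lborel. 1 :: real)"
    by (rule intM') (use rho1 in \<open>auto simp: y0_def\<close>)
  then show "(\<integral>z. y0 z \<partial>M) = 1" by (simp add: set_lebesgue_integral_def)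
  have "(\<integral>z. e0 z \<partial>M) = (LINT x:{0..1}|lborel. (ax x)\<^sup>2)"
    by (rule intM') (use rho1 in \<open>auto simp: e0_def\<close>)
  then show "(\<integral>z. e0 z \<partial>M) = h" using hv by simp
qed

definition "A = kint M ker_le v0"

lemma bmA: "bdd_meas A" unfolding A_def by (intro bdd_meas_intros kernel_ker_le bm0)

text \<open>\<open>y0\<close> is the reciprocal of the density of \<open>M\<close>, so primitives of
  \<open>g * y0\<close> against \<open>M\<close> are ordinary ones. With \<open>g = 1\<close> this
  makes the flow map the identity on the unit interval at time 0.\<close>

lemma kint_y0: assumes z: "0 \<le> z" "z \<le> 1" and g: "bdd_meas g"
    and d: "\<And>x. (\<phi> has_real_derivative g x) (at x)" and c: "continuous_on UNIV g"
  shows "kint M ker_le (\<lambda>x. g x * y0 x) z = \<phi> z - \<phi> 0"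
proof -
  note [measurable] = bdd_meas_measurable[OF g]
  have "kint M ker_le (\<lambda>x. g x * y0 x) z = (LINT x:{0..1}|lborel. indicator {..z} x * g x)"
    unfolding kint_ker_le by (rule intM') (use rho1 in \<open>auto simp: y0_def\<close>)
  also have "\<dots> = (\<integral>x. g x * indicator {0..z} x \<partial>lborel)"
    unfolding set_lebesgue_integral_def using z
    by (intro Bochner_Integration.integral_cong refl) (auto simp: indicator_def)
  also have "\<dots> = \<phi> z - \<phi> 0"
    using z c d by (intro integral_FTC_Icc_real) (auto simp: continuous_on_eq_continuous_at)
  finally show ?thesis .
qed

lemma a_int: "set_integrable lborel {0..1} a"
proof (rule set_integrable_bound)
  show "set_integrable lborel {0..1} (\<lambda>x. 1 + (a x)\<^sup>2)" by (intro set_integral_add(1) one_int sq)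
  show "set_borel_measurable lborel {0..1} a" unfolding set_borel_measurable_def by measurable
  have "\<bar>a x\<bar> \<le> 1 + (a x)\<^sup>2" for x
  proof -
    have "0 \<le> (\<bar>a x\<bar> - 1/2)\<^sup>2" by simp
    then show ?thesis by (simp add: power2_eq_square algebra_simps)
  qed
  then show "AE x in lborel. x \<in> {0..1} \<longrightarrow> norm (a x) \<le> norm (1 + (a x)\<^sup>2)"
    by (intro AE_I2) (simp add: abs_le_iff add_nonneg_nonneg)
qed

lemma bdd_meas_set_int: assumes "bdd_meas g" shows "set_integrable lborel {0..1} g"
proof -
  obtain B where B: "B \<ge> 0" "\<And>x. \<bar>g x\<bar> \<le> B" using bdd_measE[OF assms] by metis
  note [measurable] = bdd_meas_measurable[OF assms]
  have "set_integrable lborel {0..1::real} (\<lambda>_. B)"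
    using set_integrable_mult_right[of B lborel "{0..1}" "\<lambda>_. 1"] one_int by simp
  then show ?thesis
    by (rule set_integrable_bound) (auto simp: set_borel_measurable_def intro!: AE_I2 order_trans[OF B(2)])
qed

lemma mult_bm_int: assumes "set_integrable lborel {0..1} f" "bdd_meas g" shows "set_integrable lborel {0..1} (\<lambda>x. f x * g x)"
proof -
  obtain B where B: "B \<ge> 0" "\<And>x. \<bar>g x\<bar> \<le> B" using bdd_measE[OF assms(2)] by metis
  note [measurable] = bdd_meas_measurable[OF assms(2)]
  have f: "integrable lborel (\<lambda>x. indicator {0..1} x * f x)" using assms(1) by (simp add: set_integrable_def)
  have "integrable lborel (\<lambda>x. (indicator {0..1} x * f x) * g x)"
  proof (rule Bochner_Integration.integrable_bound)
    show "integrable lborel (\<lambda>x. B * (indicator {0..1} x * f x))" using f by simp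
    show "(\<lambda>x. (indicator {0..1} x * f x) * g x) \<in> borel_measurable lborel"
      using borel_measurable_integrable[OF f] by measurable
    show "AE x in lborel. norm ((indicator {0..1} x * f x) * g x) \<le> norm (B * (indicator {0..1} x * f x))"
      using B by (intro AE_I2) (auto simp: abs_mult mult.commute[of B] intro!: mult_left_mono)
  qed
  then show ?thesis by (simp add: set_integrable_def mult.assoc)
qed

text \<open>The initial function is known only through its weak derivative. Integration by parts
  against \<open>M\<close> shows that its difference from the primitive \<open>A\<close> is
  orthogonal to all derivatives of test functions, and \<open>du_Bois_Reymond\<close>
  applies.\<close>

lemma a_eq: "\<exists>c. AE x in lborel. x \<in> {0..1} \<longrightarrow> a x = c + A x"
proof -
  have "\<exists>c. AE x in lborel. x \<in> {0..1} \<longrightarrow> a x - A x = c"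
  proof (rule du_Bois_Reymond)
    show "set_integrable lborel {0..1} (\<lambda>x. a x - A x)" by (intro set_integral_diff(1) a_int bdd_meas_set_int bmA)
    fix \<phi> assume \<phi>: "smooth1 \<phi>" "periodic1 \<phi>"
    note d = smooth1_deriv[OF \<phi>(1)]
    have [measurable]: "\<phi> \<in> borel_measurable borel" "deriv \<phi> \<in> borel_measurable borel" "A \<in> borel_measurable borel"
      using d bmA by (auto intro: borel_measurable_continuous_onI)
    have bd: "bdd_meas (deriv \<phi>)"
    proof -
      obtain K where "\<And>x. \<bar>deriv \<phi> x\<bar> \<le> K" using periodic1_bounded[OF d(3) periodic1_deriv[OF \<phi>(2) d(1)]] by blast
      then show ?thesis by (intro bdd_measI) auto
    qed
    have bp: "bdd_meas \<phi>"
    proof -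
      obtain K where "\<And>x. \<bar>\<phi> x\<bar> \<le> K" using periodic1_bounded[OF d(2) \<phi>(2)] by blast
      then show ?thesis by (intro bdd_measI) auto
    qed
    let ?g = "\<lambda>x. deriv \<phi> x * y0 x"
    have bg: "bdd_meas ?g" by (intro bdd_meas_intros bd bm0)
    define G where "G z = \<phi> 0 + kint M ker_le ?g z" for z
    have bG: "bdd_meas G" unfolding G_def[abs_def] by (intro bdd_meas_intros kernel_ker_le bg)
    note [measurable] = bdd_meas_measurable[OF bG]
    have Geq: "G z = \<phi> z" if "0 \<le> z" "z \<le> 1" for z using kint_y0[OF that bd d(1) d(3)] by (simp add: G_def)
    have "(\<integral>z. v0 z * G z + A z * ?g z \<partial>M) = 0"
      using parts_all[OF bm0(2) bg, of A 0 G "\<phi> 0"] tot0(1) by (simp add: A_def G_def)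
    moreover have "(\<integral>z. v0 z * G z + A z * ?g z \<partial>M) = (LINT x:{0..1}|lborel. ax x * \<phi> x + A x * deriv \<phi> x)"
      by (rule intM') (use Geq rho1 in \<open>auto simp: v0_def y0_def field_simps\<close>)
    moreover have "set_integrable lborel {0..1} ax"
    proof -
      have "(\<lambda>x. \<rho> x * v0 x) = ax" using rho1 by (auto simp: v0_def fun_eq_iff)
      then show ?thesis using mult_bm_int[OF rho_int bm0(2)] by simp
    qed
    then have "set_integrable lborel {0..1} (\<lambda>x. ax x * \<phi> x)" by (intro mult_bm_int bp)
    moreover have "set_integrable lborel {0..1} (\<lambda>x. A x * deriv \<phi> x)" by (intro bdd_meas_set_int bdd_meas_intros bmA bd)
    ultimately have "(LINT x:{0..1}|lborel. ax x * \<phi> x) + (LINT x:{0..1}|lborel. A x * deriv \<phi> x) = 0"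
      by (simp add: set_integral_add)
    moreover have "set_integrable lborel {0..1} (\<lambda>x. a x * deriv \<phi> x)" by (intro mult_bm_int a_int bd)
    then have "(LINT x:{0..1}|lborel. (a x - A x) * deriv \<phi> x)
       = (LINT x:{0..1}|lborel. a x * deriv \<phi> x) - (LINT x:{0..1}|lborel. A x * deriv \<phi> x)"
      using \<open>set_integrable lborel {0..1} (\<lambda>x. A x * deriv \<phi> x)\<close> by (simp add: left_diff_distrib set_integral_diff)
    ultimately show "(LINT x:{0..1}|lborel. (a x - A x) * deriv \<phi> x) = 0" using weak_deriv_test[OF \<phi>] by simp
  qed
  then obtain c where "AE x in lborel. x \<in> {0..1} \<longrightarrow> a x - A x = c" by blast
  then have "AE x in lborel. x \<in> {0..1} \<longrightarrow> a x = c + A x" by eventually_elim auto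
  then show ?thesis ..
qed

lemma supp_M: "AE x in M. x \<in> {0<..<1}"
proof -
  have "AE x in lborel. x \<noteq> (0::real) \<and> x \<noteq> (1::real)"
    using AE_lborel_singleton[of 0] AE_lborel_singleton[of 1] by eventually_elim auto
  then have "AE x in lborel. 0 < ennreal (indicator {0..1} x * \<rho> x) \<longrightarrow> x \<in> {0<..<1}"
    by eventually_elim (auto simp: indicator_def)
  then show ?thesis unfolding M_def by (subst AE_density) auto
qed

lemma pint_M: assumes "0 \<le> p" "p < q" "q \<le> 1" shows "emeasure M {p<..<q} \<noteq> 0"
proof -
  have "ennreal (q - p) = (\<integral>\<^sup>+x. indicator {p<..<q} x \<partial>lborel)" using assms by simp
  also have "\<dots> \<le> emeasure M {p<..<q}"
    unfolding emM[OF borel_open[OF open_greaterThanLessThan]]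
  proof (rule nn_integral_mono)
    fix x
    have "1 \<le> ennreal (\<rho> x)" using rho1(1)[of x] by (simp add: ennreal_1[symmetric] del: ennreal_1)
    then show "indicator {p<..<q} x \<le> ennreal (indicator {0..1} x * \<rho> x) * indicator {p<..<q} x"
      using assms by (auto simp: indicator_def)
  qed
  finally show ?thesis using assms by auto
qed

lemma h0: "0 \<le> h"
  unfolding hv[symmetric] set_lebesgue_integral_def by (rule Bochner_Integration.integral_nonneg) auto

text \<open>The end time \<open>b\<close> is a regular one, so that the state there is again an
  admissible starting point; the bounds involve only \<open>h\<close> and \<open>m\<close> and hence
  survive iteration.\<close>

theorem local_solution:
  "\<exists>b u ux. time_step h m / 2 \<le> b \<and> b \<le> time_step h m \<and>
     (\<lambda>(t, x). u t x) \<in> borel_measurable (borel \<Otimes>\<^sub>M borel) \<and>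
     (\<lambda>(t, x). ux t x) \<in> borel_measurable (borel \<Otimes>\<^sub>M borel) \<and>
     good_state h m (u b) (ux b) \<and>
     (AE t in lborel. 0 \<le> t \<and> t \<le> b \<longrightarrow> good_state h m (u t) (ux t) \<and>
        (LINT x:{0..1}|lborel. (u t x)\<^sup>2 + (ux t x)\<^sup>2) \<le> (2 * vel_bound h m)\<^sup>2 + h) \<and>
     (\<forall>p pt px pxt pxx. test_triple p pt px \<longrightarrow> test_triple px pxt pxx \<longrightarrow> piece h b u ux a ax p pt px pxt)"
proof -
  obtain c where c: "AE x in lborel. x \<in> {0..1} \<longrightarrow> a x = c + A x" using a_eq by blast
  note [measurable] = bdd_meas_measurable[OF bmA]
  \<comment> \<open>The constant of integration is determined by \<open>m\<close>: integrating
    \<open>(c + A) (y0 - e0)\<close> gives \<open>c (1 - h)\<close> plus the integral of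
    \<open>A (y0 - e0)\<close>. It therefore agrees with the value \<open>C 0\<close> prescribed by
    the flow.\<close>
  have cm: "c = (m - (\<integral>z. A z * (y0 z - e0 z) \<partial>M)) / (1 - h)"
  proof -
    have "(\<integral>z. (c + A z) * (y0 z - e0 z) \<partial>M) = (LINT x:{0..1}|lborel. a x - a x * (ax x)\<^sup>2)"
    proof (rule intM')
      show "AE x in lborel. x \<in> {0..1} \<longrightarrow> \<rho> x * ((c + A x) * (y0 x - e0 x)) = a x - a x * (ax x)\<^sup>2"
        using c
      proof eventually_elim
        case (elim x)
        have "\<rho> x * (y0 x - e0 x) = 1 - (ax x)\<^sup>2" using rho1(3)[of x] by (simp add: y0_def e0_def right_diff_distrib)
        then have "\<rho> x * ((c + A x) * (y0 x - e0 x)) = (c + A x) * (1 - (ax x)\<^sup>2)" by (metis mult.left_commute)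
        then show ?case using elim by (simp add: right_diff_distrib)
      qed
    qed measurable
    then have "m = (\<integral>z. c * (y0 z - e0 z) + A z * (y0 z - e0 z) \<partial>M)" using mv by (simp add: distrib_right)
    also have "\<dots> = c * (1 - h) + (\<integral>z. A z * (y0 z - e0 z) \<partial>M)"
    proof -
      have "integrable M y0" "integrable M e0" "integrable M (\<lambda>z. A z * (y0 z - e0 z))"
        by (intro bdd_meas_integrable bdd_meas_intros bmA bm0)+
      then show ?thesis using tot0 by simp
    qed
    finally show ?thesis using h1 by (simp add: field_simps)
  qed
  have pos: "0 < y0 x" "0 \<le> e0 x" "y0 x + e0 x = 1" "y0 x * e0 x = (v0 x)\<^sup>2" for x
    using rho1[of x] by (simp_all add: y0_def e0_def v0_def power2_eq_square add_divide_distrib[symmetric]) (simp add: \<rho>_def power2_eq_square)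
  obtain B y v e U Y C X where L: "lagrangian M (time_step h m) h m B y v e U Y C X"
    and init: "y 0 = y0" "v 0 = v0" "e 0 = e0"
      "C 0 = (m - (\<integral>z. kint M ker_le v0 z * (y0 z - e0 z) \<partial>M)) / (1 - h)" "X 0 = 0"
    by (rule lagrangian_flow[OF noatom_M h0 h1 ms2(2-4) pos tot0])
  interpret E: eulerian M "time_step h m" h m B y v e U Y C X
    using L supp_M pint_M by (intro eulerian.intro eulerian_axioms.intro) auto
  have C0: "C 0 = c" using init(4) cm by (simp add: A_def)
  have s0: "0 < time_step h m" by (rule E.s)
  have r0: "E.rng 0" using s0 by (simp add: E.rng_def)
  have g0: "E.nondeg 0" using r0 pos(1) init(1) by (simp add: E.nondeg_def)
  \<comment> \<open>An interval of positive length is not contained in a null set.\<close>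
  have "\<exists>b. time_step h m / 2 \<le> b \<and> b \<le> time_step h m \<and> b \<notin> E.exceptional"
  proof (rule ccontr)
    assume "\<not> ?thesis"
    then have "{time_step h m / 2..time_step h m} \<subseteq> E.exceptional" by auto
    then have "emeasure lborel {time_step h m / 2..time_step h m} \<le> emeasure lborel E.exceptional"
      using E.exceptional(1) by (intro emeasure_mono) auto
    also have "\<dots> = 0" using E.exceptional(1) by auto
    finally show False using s0 by simp
  qed
  then obtain b where b: "time_step h m / 2 \<le> b" "b \<le> time_step h m" "b \<notin> E.exceptional" by blast
  then have gb: "E.regular b" using s0 by (simp add: E.regular_def E.rng_def)
  have st: "good_state h m (E.eu t) (E.eux t)" if "E.regular t" for t
    using E.H1S_eu[OF that] E.energy(1)[OF that] E.mean_ew[OF that]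
    by (simp add: good_state_def hval_def Smean_def E.ew_def)
  have ae: "AE t in lborel. 0 \<le> t \<and> t \<le> b \<longrightarrow> good_state h m (E.eu t) (E.eux t) \<and>
        (LINT x:{0..1}|lborel. (E.eu t x)\<^sup>2 + (E.eux t x)\<^sup>2) \<le> (2 * vel_bound h m)\<^sup>2 + h"
  proof (rule AE_I'[OF E.exceptional(1)])
    have "E.regular t" if "0 \<le> t" "t \<le> b" "t \<notin> E.exceptional" for t using that b by (simp add: E.regular_def E.rng_def)
    then show "{t \<in> space lborel. \<not> (0 \<le> t \<and> t \<le> b \<longrightarrow> good_state h m (E.eu t) (E.eux t) \<and>
        (LINT x:{0..1}|lborel. (E.eu t x)\<^sup>2 + (E.eux t x)\<^sup>2) \<le> (2 * vel_bound h m)\<^sup>2 + h)} \<subseteq> E.exceptional"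
      using st E.norm_bound(1) by auto
  qed
  have Y0: "Y 0 z = z" if "0 \<le> z" "z \<le> 1" for z
  proof -
    have "Y 0 z = kint M ker_le (\<lambda>x. 1 * y0 x) z" using E.Y_eq'[OF r0, of z] init by simp
    also have "\<dots> = z - 0" by (rule kint_y0[OF that bdd_meas_const]) (auto intro!: derivative_eq_intros)
    finally show ?thesis by simp
  qed
  have U0: "U 0 z = c + A z" for z using E.U_eq'[OF r0, of z] init C0 by (simp add: A_def)
  have ym [measurable]: "Y 0 \<in> borel_measurable borel"
    using E.Y_cont[OF r0] by (rule borel_measurable_continuous_onI)
  have pc: "piece h b E.eu E.eux a ax p pt px pxt" if T: "test_triple p pt px" and Tx: "test_triple px pxt pxx" for p pt px pxt pxx
  proof -
    note [measurable] = test_triple_slice(1)[OF T]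
    have 1: "(\<integral>z. v 0 z * p 0 (Y 0 z) \<partial>M) = (LINT x:{0..1}|lborel. ax x * p 0 x)"
      unfolding init by (rule intM') (use Y0 rho1 in \<open>auto simp: v0_def\<close>)
    have 4: "(\<integral>z. e 0 z * p 0 (Y 0 z) \<partial>M) = (LINT x:{0..1}|lborel. (ax x)\<^sup>2 * p 0 x)"
      unfolding init by (rule intM') (use Y0 rho1 in \<open>auto simp: e0_def\<close>)
    have 2: "(\<integral>z. U 0 z * y 0 z * p 0 (Y 0 z) \<partial>M) = (LINT x:{0..1}|lborel. a x * p 0 x)"
      unfolding init U0
    proof (rule intM')
      show "AE x in lborel. x \<in> {0..1} \<longrightarrow> \<rho> x * ((c + A x) * y0 x * p 0 (Y 0 x)) = a x * p 0 x"
        using c by eventually_elim (use Y0 rho1 in \<open>auto simp: y0_def\<close>)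
    qed measurable
    show ?thesis
      unfolding piece_def fL1_def fR1_def fL2_def fR2_def fL4_def fR4_def
      using E.weak1[OF T Tx gb g0] E.weak2[OF T gb] E.weak4[OF T gb] unfolding 1 2 4 by (simp add: ffun_def)
  qed
  show ?thesis
    using b(1,2) E.measurable_eu st[OF gb] ae pc by (intro exI[of _ b] exI[of _ E.eu] exI[of _ E.eux]) auto
qed

end

section \<open>Gluing\<close>

text \<open>Differentiability yields some linear map; its values on the two unit vectors are
  identified with the iterated one-variable derivatives used for test functions.\<close>

lemma has_derivative_partials:
  fixes f :: "real \<Rightarrow> real \<Rightarrow> real"
  assumes "(\<lambda>q. f (fst q) (snd q)) differentiable (at (t, x))"
  shows "((\<lambda>q. f (fst q) (snd q)) has_derivative (\<lambda>d. pdt f t x * fst d + pdx f t x * snd d)) (at (t, x))"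
proof -
  obtain D where D: "((\<lambda>q. f (fst q) (snd q)) has_derivative D) (at (t, x))"
    using assms by (auto simp: differentiable_def)
  interpret bounded_linear D using D by (rule has_derivative_bounded_linear)
  have lin: "D d = D (1, 0) * fst d + D (0, 1) * snd d" for d
  proof -
    have "d = fst d *\<^sub>R (1, 0) + snd d *\<^sub>R (0, 1)" by (simp add: prod_eq_iff)
    then have "D d = D (fst d *\<^sub>R (1, 0) + snd d *\<^sub>R (0, 1))" by (rule arg_cong)
    also have "\<dots> = fst d *\<^sub>R D (1, 0) + snd d *\<^sub>R D (0, 1)" unfolding add scaleR ..
    finally show ?thesis by (simp only: real_scaleR_def mult.commute)
  qed
  have lin1: "(\<lambda>d. D (d, 0)) = (*) (D (1, 0))" and lin2: "(\<lambda>d. D (0, d)) = (*) (D (0, 1))"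
  proof -
    have l1: "D (d, 0) = D (1, 0) * d" for d
      using lin[of "(d, 0)"] by (simp only: fst_conv snd_conv mult_zero_right add_0_right)
    have l2: "D (0, d) = D (0, 1) * d" for d
      using lin[of "(0, d)"] by (simp only: fst_conv snd_conv mult_zero_right add_0_left)
    show "(\<lambda>d. D (d, 0)) = (*) (D (1, 0))" by (rule ext) (rule l1)
    show "(\<lambda>d. D (0, d)) = (*) (D (0, 1))" by (rule ext) (rule l2)
  qed
  have "((\<lambda>s. (s, x)) has_derivative (\<lambda>d. (d, 0))) (at t)" by (auto intro!: derivative_eq_intros)
  from has_derivative_compose[OF this D]
  have "((\<lambda>s. f s x) has_derivative (\<lambda>d. D (d, 0))) (at t)" by simp
  then have "((\<lambda>s. f s x) has_real_derivative D (1, 0)) (at t)"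
    unfolding has_field_derivative_def lin1 .
  then have 1: "pdt f t x = D (1, 0)" unfolding pdt_def by (rule DERIV_imp_deriv)
  have "((\<lambda>y. (t, y)) has_derivative (\<lambda>d. (0, d))) (at x)" by (auto intro!: derivative_eq_intros)
  from has_derivative_compose[OF this D]
  have "((\<lambda>y. f t y) has_derivative (\<lambda>d. D (0, d))) (at x)" by simp
  then have "((\<lambda>y. f t y) has_real_derivative D (0, 1)) (at x)"
    unfolding has_field_derivative_def lin2 .
  then have 2: "pdx f t x = D (0, 1)" unfolding pdx_def by (rule DERIV_imp_deriv)
  show ?thesis unfolding 1 2 using D by (rule has_derivative_eq_rhs) (rule ext, rule lin)
qed

lemma test_triple_of_differentiable:
  assumes d: "\<And>q. (\<lambda>q. f (fst q) (snd q)) differentiable (at q)"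
    "\<And>q. (\<lambda>q. pdt f (fst q) (snd q)) differentiable (at q)"
    "\<And>q. (\<lambda>q. pdx f (fst q) (snd q)) differentiable (at q)"
    and per: "\<And>t. periodic1 (f t)"
  shows "test_triple f (pdt f) (pdx f)"
proof -
  have c: "continuous_on UNIV (\<lambda>q. pdt f (fst q) (snd q))" "continuous_on UNIV (\<lambda>q. pdx f (fst q) (snd q))"
    using d by (auto intro!: continuous_at_imp_continuous_on differentiable_imp_continuous_within)
  have pt: "periodic1 (pdt f t)" for t
    using per by (simp add: periodic1_def pdt_def)
  have "(f t has_real_derivative pdx f t x) (at x)" for t x
  proof -
    have "((\<lambda>y. (t, y)) has_derivative (\<lambda>d. (0, d))) (at x)" by (auto intro!: derivative_eq_intros)
    from has_derivative_compose[OF this has_derivative_partials[OF d(1)]]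
    have "(f t has_derivative (\<lambda>d. pdx f t x * d)) (at x)" by simp
    then show ?thesis unfolding has_field_derivative_def by simp
  qed
  then have "periodic1 (pdx f t)" for t using periodic1_deriv[OF per] by blast
  then show ?thesis unfolding test_triple_def using has_derivative_partials[OF d(1)] c pt per by blast
qed

lemma test_fun_TF:
  assumes "test_fun \<psi>"
  shows "test_triple \<psi> (pdt \<psi>) (pdx \<psi>)" "test_triple (pdx \<psi>) (pdt (pdx \<psi>)) (pdx (pdx \<psi>))"
proof -
  have s: "(\<lambda>q::real\<times>real. pd_iter ds \<psi> (fst q) (snd q)) differentiable (at p)" for ds p
    using assms unfolding test_fun_def smooth2_def by blast
  show 1: "test_triple \<psi> (pdt \<psi>) (pdx \<psi>)"
    using s[of "[]"] s[of "[True]"] s[of "[False]"] assms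
    by (intro test_triple_of_differentiable) (auto simp: test_fun_def)
  show "test_triple (pdx \<psi>) (pdt (pdx \<psi>)) (pdx (pdx \<psi>))"
    using s[of "[False]"] s[of "[True, False]"] s[of "[False, False]"] 1
    by (intro test_triple_of_differentiable) (auto simp: test_triple_def)
qed

lemma test_triple_shift:
  assumes "test_triple p pt px"
  shows "test_triple (\<lambda>t. p (a + t)) (\<lambda>t. pt (a + t)) (\<lambda>t. px (a + t))"
proof -
  have s: "((\<lambda>q. (a + fst q, snd q)) has_derivative (\<lambda>d. (fst d, snd d))) (at q)" for q :: "real \<times> real"
    by (auto intro!: derivative_eq_intros)
  have "((\<lambda>q. p (a + fst q) (snd q)) has_derivative (\<lambda>d. pt (a + t) x * fst d + px (a + t) x * snd d)) (at (t, x))" for t x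
  proof -
    have "((\<lambda>q. p (fst q) (snd q)) has_derivative (\<lambda>d. pt (a + t) x * fst d + px (a + t) x * snd d))
        (at (a + fst (t, x), snd (t, x)))"
      using assms by (simp add: test_triple_def)
    from has_derivative_compose[OF s this] show ?thesis by simp
  qed
  moreover have "continuous_on UNIV (\<lambda>q. f (a + fst q) (snd q))"
    if "continuous_on UNIV (\<lambda>q. f (fst q) (snd q))" for f :: "real \<Rightarrow> real \<Rightarrow> real"
  proof -
    have "continuous_on UNIV (\<lambda>q::real\<times>real. (a + fst q, snd q))" by (intro continuous_intros)
    from continuous_on_compose2[OF that this] show ?thesis by simp
  qed
  ultimately show ?thesis using assms unfolding test_triple_def by blast
qed

text \<open>The second inequality is strict because vanishing from \<open>T\<close> onwards controls
  the two-sided time derivative only after \<open>T\<close>.\<close>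

lemma test_fun_vanish:
  assumes "\<And>t x. T \<le> t \<Longrightarrow> \<psi> t x = 0" "T < t"
  shows "pdt \<psi> t x = 0" "pdx \<psi> t x = 0" "pdt (pdx \<psi>) t x = 0"
proof -
  have pdt0: "pdt f t x = 0" if "\<And>r x. T \<le> r \<Longrightarrow> f r x = 0" for f :: "real \<Rightarrow> real \<Rightarrow> real"
  proof -
    have "((\<lambda>s. f s x) has_real_derivative 0) (at t)"
      by (rule has_field_derivative_transform_within_open[of "\<lambda>_. 0" _ _ "{T<..}"]) (use assms(2) that in auto)
    then show ?thesis unfolding pdt_def by (rule DERIV_imp_deriv)
  qed
  have x0: "pdx \<psi> r y = 0" if "T \<le> r" for r y
  proof -
    have "\<psi> r = (\<lambda>_. 0)" using assms(1)[OF that] by (simp add: fun_eq_iff)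
    then show ?thesis by (simp add: pdx_def)
  qed
  show "pdt \<psi> t x = 0" by (rule pdt0[OF assms(1)])
  show "pdx \<psi> t x = 0" using x0 assms(2) by simp
  show "pdt (pdx \<psi>) t x = 0" by (rule pdt0[OF x0])
qed

section \<open>Time partitions and summation over pieces\<close>

text \<open>Half-open intervals tile the half-line; the endpoint they drop from the closed interval
  of a piece is a null set.\<close>

lemma shift_piece:
  fixes f fk :: "real \<Rightarrow> real"
  assumes eq: "\<And>t. a \<le> t \<Longrightarrow> t < b \<Longrightarrow> f t = fk (t - a)" and i: "set_integrable lborel {0..b - a} fk"
  shows "set_integrable lborel {a..<b} f" "(LINT t:{a..<b}|lborel. f t) = (LINT t:{0..b - a}|lborel. fk t)"
proof -
  let ?F = "\<lambda>t. indicator {a..<b} t *\<^sub>R f t" and ?G = "\<lambda>t. indicator {0..b - a} t *\<^sub>R fk t"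
  have F: "?F (a + 1 * x) = indicator {0..<b - a} x *\<^sub>R fk x" for x
    using eq[of "a + x"] by (auto simp: indicator_def)
  have g: "integrable lborel ?G" using i by (simp add: set_integrable_def)
  have h: "integrable lborel (\<lambda>x. indicator {0..<b - a} x *\<^sub>R fk x)"
  proof (rule integrable_discrete_difference[where X = "{b - a}", THEN iffD1, OF _ _ _ _ g])
    fix x assume "x \<notin> {b - a}"
    then show "?G x = indicator {0..<b - a} x *\<^sub>R fk x" by (auto simp: indicator_def)
  qed auto
  then have "integrable lborel (\<lambda>x. ?F (a + 1 * x))" unfolding F .
  then show "set_integrable lborel {a..<b} f"
    using lborel_integrable_real_affine_iff[of 1 ?F a] by (simp add: set_integrable_def)
  have "(LINT t:{a..<b}|lborel. f t) = (\<integral>x. ?F (a + 1 * x) \<partial>lborel)"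
    unfolding set_lebesgue_integral_def using lborel_integral_real_affine[of 1 ?F a] by simp
  also have "\<dots> = (\<integral>x. ?G x \<partial>lborel)"
    unfolding F
    by (rule integral_discrete_difference[where X = "{b - a}"]) (auto simp: indicator_def)
  finally show "(LINT t:{a..<b}|lborel. f t) = (LINT t:{0..b - a}|lborel. fk t)"
    by (simp add: set_lebesgue_integral_def)
qed

locale partition =
  fixes T :: "nat \<Rightarrow> real"
  assumes T0: "T 0 = 0" and T_less: "\<And>k. T k < T (Suc k)" and T_top: "\<And>R. \<exists>k. R \<le> T k"
begin

lemma T_mono: "i \<le> j \<Longrightarrow> T i \<le> T j"
  by (rule lift_Suc_mono_le[of T]) (auto intro: less_imp_le T_less)

lemma pieces:
  fixes f :: "real \<Rightarrow> real"
  assumes "\<And>k t. T k \<le> t \<Longrightarrow> t < T (Suc k) \<Longrightarrow> f t = fk k (t - T k)"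
    "\<And>k. set_integrable lborel {0..T (Suc k) - T k} (fk k)"
  shows "set_integrable lborel {0..<T n} f \<and>
    (LINT t:{0..<T n}|lborel. f t) = (\<Sum>k<n. LINT t:{0..T (Suc k) - T k}|lborel. fk k t)"
proof (induction n)
  case 0
  show ?case by (simp add: T0 set_integrable_def set_lebesgue_integral_def)
next
  case (Suc n)
  note s = shift_piece[of "T n" "T (Suc n)" f "fk n", OF assms]
  have u: "{0..<T (Suc n)} = {0..<T n} \<union> {T n..<T (Suc n)}"
    using T_mono[of 0 n] T_less[of n] T0 by auto
  have "set_integrable lborel {0..<T (Suc n)} f"
    unfolding u using Suc s(1) by (intro set_integrable_Un) auto
  moreover have "(LINT t:{0..<T (Suc n)}|lborel. f t) = (LINT t:{0..<T n}|lborel. f t) + (LINT t:{T n..<T (Suc n)}|lborel. f t)"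
    unfolding u using Suc s(1) by (intro set_integral_Un) auto
  ultimately show ?case using Suc s(2) by simp
qed

text \<open>\<open>\<beta> k\<close> is the boundary term at \<open>T k\<close>. The terms
  telescope, and the last one vanishes because the test function is zero beyond
  \<open>R\<close>.\<close>

lemma glue:
  fixes f g :: "real \<Rightarrow> real"
  assumes f: "\<And>k t. T k \<le> t \<Longrightarrow> t < T (Suc k) \<Longrightarrow> f t = fk k (t - T k)"
      "\<And>k. set_integrable lborel {0..T (Suc k) - T k} (fk k)"
    and g: "\<And>k t. T k \<le> t \<Longrightarrow> t < T (Suc k) \<Longrightarrow> g t = gk k (t - T k)"
      "\<And>k. set_integrable lborel {0..T (Suc k) - T k} (gk k)"
    and eq: "\<And>k. (LINT t:{0..T (Suc k) - T k}|lborel. fk k t) + (LINT t:{0..T (Suc k) - T k}|lborel. gk k t)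
        = \<beta> (Suc k) - \<beta> k"
    and zero: "\<And>t. R \<le> t \<Longrightarrow> f t = 0" "\<And>t. R \<le> t \<Longrightarrow> g t = 0" "\<And>k. R \<le> T k \<Longrightarrow> \<beta> k = 0"
  shows "(LINT t:{0..}|lborel. f t) + (LINT t:{0..}|lborel. g t) = - \<beta> 0"
proof -
  obtain n where n: "R \<le> T n" using T_top by blast
  have cut: "(LINT t:{0..}|lborel. q t) = (LINT t:{0..<T n}|lborel. q t)" if "\<And>t. R \<le> t \<Longrightarrow> q t = 0" for q :: "real \<Rightarrow> real"
    unfolding set_lebesgue_integral_def
    using that n by (intro Bochner_Integration.integral_cong refl) (auto simp: indicator_def)
  have "(LINT t:{0..}|lborel. f t) + (LINT t:{0..}|lborel. g t)
     = (\<Sum>k<n. (LINT t:{0..T (Suc k) - T k}|lborel. fk k t) + (LINT t:{0..T (Suc k) - T k}|lborel. gk k t))"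
    using pieces[of f fk, OF f, of n] pieces[of g gk, OF g, of n] cut[OF zero(1)] cut[OF zero(2)]
    by (simp add: sum.distrib)
  also have "\<dots> = (\<Sum>k<n. \<beta> (Suc k) - \<beta> k)" by (simp only: eq)
  also have "\<dots> = \<beta> n - \<beta> 0" by (rule sum_lessThan_telescope)
  finally show ?thesis using zero(3)[OF n] by simp
qed

text \<open>The least-number form makes measurability immediate and assigns index 0 to negative
  times.\<close>

definition "idx t = (LEAST k. t < T (Suc k))"

lemma idx_eq: assumes "T k \<le> t" "t < T (Suc k)" shows "idx t = k"
  unfolding idx_def
proof (rule Least_equality)
  show "t < T (Suc k)" by (rule assms(2))
  fix j assume "t < T (Suc j)"
  then show "k \<le> j" using assms(1) T_mono[of "Suc j" k] by (cases "k \<le> j") auto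
qed

lemma idx_exists: assumes "0 \<le> t" shows "\<exists>k. T k \<le> t \<and> t < T (Suc k)"
proof -
  obtain n where n: "t + 1 \<le> T n" using T_top by blast
  have "\<exists>k. t < T (Suc k)" using n T_less[of n] by (intro exI[of _ n]) linarith
  then have L: "t < T (Suc (idx t))" unfolding idx_def by (rule LeastI_ex)
  have "T (idx t) \<le> t"
  proof (cases "idx t")
    case 0 then show ?thesis using assms T0 by simp
  next
    case (Suc j)
    then have "\<not> t < T (Suc j)" using not_less_Least[of j "\<lambda>k. t < T (Suc k)"] by (simp add: idx_def)
    then show ?thesis using Suc by simp
  qed
  then show ?thesis using L by blast
qed

lemma idx_measurable [measurable]: "idx \<in> measurable borel (count_space UNIV)"
  unfolding idx_def[abs_def] by measurable

end

lemma AE_shift: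
  assumes "AE t in lborel. Q (t :: real)"
  shows "AE t in lborel. Q (t - a)"
proof -
  obtain N where N: "{t \<in> space lborel. \<not> Q t} \<subseteq> N" "emeasure lborel N = 0" "N \<in> sets lborel"
    using assms by (rule AE_E)
  have "AE t in lborel. t \<notin> N" using N by (intro AE_not_in) (auto simp: null_sets_def)
  then have "AE t in lborel. - a + 1 * t \<notin> N"
    using N(3) by (intro AE_borel_affine) auto
  then show ?thesis by eventually_elim (use N(1) in auto)
qed

lemma functionals_zero_test: "fL1 v w (\<lambda>_. 0) (\<lambda>_. 0) = 0" "fR1 v w (\<lambda>_. 0) = 0" "fL2 v (\<lambda>_. 0) (\<lambda>_. 0) = 0"
  "fR2 h v w (\<lambda>_. 0) = 0" "fL4 v w (\<lambda>_. 0) (\<lambda>_. 0) = 0" "fR4 v w (\<lambda>_. 0) = 0"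
  by (simp_all add: fL1_def fR1_def fL2_def fR2_def fL4_def fR4_def set_lebesgue_integral_def)

theorem theorem4p1:
  fixes u0 u0x :: "real \<Rightarrow> real"
  assumes "H1S u0 u0x"
    and "hval u0x \<noteq> 1"
  shows "\<exists>u ux. global_acws u0 u0x u ux"
proof -
  define h where "h = hval u0x"
  define m where "m = (LINT x:{0..1}|lborel. u0 x - u0 x * (u0x x)\<^sup>2)"
  define K where "K = (2 * vel_bound h m)\<^sup>2 + h"
  have h1: "h \<noteq> 1" and gs0: "good_state h m u0 u0x" using assms by (auto simp: h_def m_def good_state_def)
  define sol where "sol a ax r \<longleftrightarrow> (case r of (b, u, ux) \<Rightarrow> time_step h m / 2 \<le> b \<and> b \<le> time_step h m \<and>
     (\<lambda>(t, x). u t x) \<in> borel_measurable (borel \<Otimes>\<^sub>M borel) \<and>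
     (\<lambda>(t, x). ux t x) \<in> borel_measurable (borel \<Otimes>\<^sub>M borel) \<and>
     good_state h m (u b) (ux b) \<and>
     (AE t in lborel. 0 \<le> t \<and> t \<le> b \<longrightarrow> good_state h m (u t) (ux t) \<and>
        (LINT x:{0..1}|lborel. (u t x)\<^sup>2 + (ux t x)\<^sup>2) \<le> K) \<and>
     (\<forall>p pt px pxt pxx. test_triple p pt px \<longrightarrow> test_triple px pxt pxx \<longrightarrow> piece h b u ux a ax p pt px pxt))"
    for a ax :: "real \<Rightarrow> real" and r :: "real \<times> (real \<Rightarrow> real \<Rightarrow> real) \<times> (real \<Rightarrow> real \<Rightarrow> real)"
  have "\<exists>r. sol (fst st) (snd st) r" if "good_state h m (fst st) (snd st)" for st
  proof -
    interpret initial h m "fst st" "snd st" using that h1 by unfold_locales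
    show ?thesis using local_solution unfolding sol_def K_def by auto
  qed
  \<comment> \<open>A short-time solution is chosen for every admissible state; iterating the choice
    from the initial data produces the pieces.\<close>
  then obtain ch where ch: "\<And>st. good_state h m (fst st) (snd st) \<Longrightarrow> sol (fst st) (snd st) (ch st)" by metis
  define nxt where "nxt st = (case ch st of (b, u, ux) \<Rightarrow> (u b, ux b))" for st
  define st where "st = rec_nat (u0, u0x) (\<lambda>_. nxt)"
  have st: "st 0 = (u0, u0x)" "st (Suc k) = nxt (st k)" for k by (simp_all add: st_def)
  have gs: "good_state h m (fst (st k)) (snd (st k))" for k
  proof (induction k)
    case (Suc k)
    show ?case using ch[OF Suc] unfolding st(2) nxt_def by (auto simp: sol_def split: prod.splits)
  qed (use gs0 st in simp)
  define b uu uux where "b k = fst (ch (st k))" and "uu k = fst (snd (ch (st k)))" and "uux k = snd (snd (ch (st k)))" for k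
  have S: "sol (fst (st k)) (snd (st k)) (b k, uu k, uux k)" for k
    using ch[OF gs[of k]] by (simp add: b_def uu_def uux_def)
  have stS: "fst (st (Suc k)) = uu k (b k)" "snd (st (Suc k)) = uux k (b k)" for k
    by (simp_all add: st nxt_def b_def uu_def uux_def split: prod.splits)
  have bk: "time_step h m / 2 \<le> b k" for k using S[of k] by (simp add: sol_def)
  interpret initial h m u0 u0x using gs0 h1 by unfold_locales
  have step0: "0 < time_step h m"
  proof -
    have "1 \<le> vel_bound h m" using h0 by (simp add: vel_bound_def)
    then have "0 < conv_rate h m" unfolding conv_rate_def by (intro add_nonneg_pos mult_nonneg_nonneg add_nonneg_nonneg) auto
    then show ?thesis by (simp add: time_step_def)
  qed
  define T where "T k = (\<Sum>i<k. b i)" for k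
  have Td: "T (Suc k) - T k = b k" for k by (simp add: T_def)
  \<comment> \<open>The common lower bound on the step lengths rules out an accumulation of restart
    times.\<close>
  have Tk: "real k * (time_step h m / 2) \<le> T k" for k
    using sum_mono[of "{..<k}" "\<lambda>_. time_step h m / 2" b] bk by (simp add: T_def)
  interpret partition T
  proof
    show "T 0 = 0" by (simp add: T_def)
    show "T k < T (Suc k)" for k using bk[of k] step0 by (simp add: T_def)
    fix R :: real
    obtain k where "R / (time_step h m / 2) < real k" using reals_Archimedean2 by blast
    then have "R \<le> real k * (time_step h m / 2)" using step0 by (simp add: field_simps)
    then show "\<exists>k. R \<le> T k" using Tk[of k] by (intro exI[of _ k]) linarith
  qed
  define u where "u t x = uu (idx t) (t - T (idx t)) x" for t x
  define ux where "ux t x = uux (idx t) (t - T (idx t)) x" for t x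
  have u_eq: "u t = uu k (t - T k)" "ux t = uux k (t - T k)" if "T k \<le> t" "t < T (Suc k)" for k t
    using idx_eq[OF that] by (auto simp: u_def ux_def fun_eq_iff)
  have meas: "(\<lambda>q. u (fst q) (snd q)) \<in> borel_measurable (borel \<Otimes>\<^sub>M borel)"
    "(\<lambda>q. ux (fst q) (snd q)) \<in> borel_measurable (borel \<Otimes>\<^sub>M borel)"
  proof -
    have mk: "(\<lambda>q. F (fst q - T k) (snd q)) \<in> borel_measurable (borel \<Otimes>\<^sub>M borel)"
      if "(\<lambda>(t, x). F t x) \<in> borel_measurable (borel \<Otimes>\<^sub>M borel)" for F :: "real \<Rightarrow> real \<Rightarrow> real" and k
      using measurable_compose[OF _ that, of "\<lambda>q. (fst q - T k, snd q)" "borel \<Otimes>\<^sub>M borel"] by simp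
    have i: "(\<lambda>q::real\<times>real. idx (fst q)) \<in> measurable (borel \<Otimes>\<^sub>M borel) (count_space UNIV)" by measurable
    have "(\<lambda>(t, x). uu k t x) \<in> borel_measurable (borel \<Otimes>\<^sub>M borel)"
      "(\<lambda>(t, x). uux k t x) \<in> borel_measurable (borel \<Otimes>\<^sub>M borel)" for k
      using S[of k] by (auto simp: sol_def)
    note F = this
    show "(\<lambda>q. u (fst q) (snd q)) \<in> borel_measurable (borel \<Otimes>\<^sub>M borel)"
      unfolding u_def by (rule measurable_compose_countable[OF mk[OF F(1)] i])
    show "(\<lambda>q. ux (fst q) (snd q)) \<in> borel_measurable (borel \<Otimes>\<^sub>M borel)"
      unfolding ux_def by (rule measurable_compose_countable[OF mk[OF F(2)] i])
  qed
  have nondeg: "AE t in lborel. 0 \<le> t \<longrightarrow> good_state h m (u t) (ux t) \<and> (LINT x:{0..1}|lborel. (u t x)\<^sup>2 + (ux t x)\<^sup>2) \<le> K"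
  proof -
    have "AE t in lborel. 0 \<le> t - T k \<and> t - T k \<le> b k \<longrightarrow> good_state h m (uu k (t - T k)) (uux k (t - T k)) \<and>
        (LINT x:{0..1}|lborel. (uu k (t - T k) x)\<^sup>2 + (uux k (t - T k) x)\<^sup>2) \<le> K" for k
      by (rule AE_shift) (use S[of k] in \<open>simp add: sol_def\<close>)
    then have "AE t in lborel. \<forall>k. 0 \<le> t - T k \<and> t - T k \<le> b k \<longrightarrow> good_state h m (uu k (t - T k)) (uux k (t - T k)) \<and>
        (LINT x:{0..1}|lborel. (uu k (t - T k) x)\<^sup>2 + (uux k (t - T k) x)\<^sup>2) \<le> K"
      by (simp add: AE_all_countable)
    then show ?thesis
    proof eventually_elim
      case (elim t)
      show ?case
      proof
        assume "0 \<le> t"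
        then obtain k where k: "T k \<le> t" "t < T (Suc k)" using idx_exists by blast
        then have "0 \<le> t - T k" "t - T k \<le> b k" using Td[of k] by auto
        then show "good_state h m (u t) (ux t) \<and> (LINT x:{0..1}|lborel. (u t x)\<^sup>2 + (ux t x)\<^sup>2) \<le> K"
          using elim[rule_format, of k] unfolding u_eq[OF k] by blast
      qed
    qed
  qed
  have weak: "(LINT t:{0..}|lborel. fL1 (u t) (ux t) (pdt (pdx \<psi>) t) (pdx \<psi> t)) + (LINT t:{0..}|lborel. - fR1 (u t) (ux t) (\<psi> t))
        = - (- (LINT x:{0..1}|lborel. u0x x * \<psi> 0 x))"
    "(LINT t:{0..}|lborel. fL2 (u t) (pdt \<psi> t) (pdx \<psi> t)) + (LINT t:{0..}|lborel. fR2 h (u t) (ux t) (\<psi> t))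
        = - (LINT x:{0..1}|lborel. u0 x * \<psi> 0 x)"
    "(LINT t:{0..}|lborel. fL4 (u t) (ux t) (pdt \<psi> t) (pdx \<psi> t)) + (LINT t:{0..}|lborel. fR4 (u t) (ux t) (\<psi> t))
        = - (LINT x:{0..1}|lborel. (u0x x)\<^sup>2 * \<psi> 0 x)"
    if \<psi>: "test_fun \<psi>" for \<psi>
  proof -
    obtain R where R: "\<And>t x. R \<le> t \<Longrightarrow> \<psi> t x = 0" using \<psi> by (auto simp: test_fun_def)
    \<comment> \<open>\<open>R + 1\<close> replaces \<open>R\<close> because the time derivatives
      are known to vanish only strictly beyond \<open>R\<close>.\<close>
    have z: "\<psi> t = (\<lambda>_. 0)" "pdt \<psi> t = (\<lambda>_. 0)" "pdx \<psi> t = (\<lambda>_. 0)" "pdt (pdx \<psi>) t = (\<lambda>_. 0)" if "R + 1 \<le> t" for t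
    proof -
      have "R < t" using that by simp
      note v = test_fun_vanish[of R \<psi> t, OF R this]
      show "\<psi> t = (\<lambda>_. 0)" "pdt \<psi> t = (\<lambda>_. 0)" "pdx \<psi> t = (\<lambda>_. 0)" "pdt (pdx \<psi>) t = (\<lambda>_. 0)"
        using R[of t] v \<open>R < t\<close> by (simp_all add: fun_eq_iff)
    qed
    have P: "piece h (b k) (uu k) (uux k) (fst (st k)) (snd (st k)) (\<lambda>t. \<psi> (T k + t)) (\<lambda>t. pdt \<psi> (T k + t))
        (\<lambda>t. pdx \<psi> (T k + t)) (\<lambda>t. pdt (pdx \<psi>) (T k + t))" for k
      using S[of k] test_triple_shift[OF test_fun_TF(1)[OF \<psi>], of "T k"] test_triple_shift[OF test_fun_TF(2)[OF \<psi>], of "T k"]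
      unfolding sol_def by blast
    have Tb: "T k + b k = T (Suc k)" for k using Td[of k] by simp
    \<comment> \<open>The end of piece \<open>k\<close> is rewritten as the state from which piece
      \<open>k + 1\<close> starts, which puts the boundary terms in telescoping form.\<close>
    note P' = P[unfolded piece_def Tb add_0_right stS[symmetric]]
    have neg: "(LINT t:A|lborel. - f t) = - (LINT t:A|lborel. f t)" for A and f :: "real \<Rightarrow> real"
      by (simp add: set_lebesgue_integral_def)
    have i1: "set_integrable lborel {0..T (Suc k) - T k} (\<lambda>t. fL1 (uu k t) (uux k t) (pdt (pdx \<psi>) (T k + t)) (pdx \<psi> (T k + t)))"
      "set_integrable lborel {0..T (Suc k) - T k} (\<lambda>t. - fR1 (uu k t) (uux k t) (\<psi> (T k + t)))" for k
      unfolding Td using P'[of k] by (simp_all add: set_integrable_def)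
    have e1: "(LINT t:{0..T (Suc k) - T k}|lborel. fL1 (uu k t) (uux k t) (pdt (pdx \<psi>) (T k + t)) (pdx \<psi> (T k + t))) + (LINT t:{0..T (Suc k) - T k}|lborel. - fR1 (uu k t) (uux k t) (\<psi> (T k + t)))
        = - (LINT x:{0..1}|lborel. snd (st (Suc k)) x * \<psi> (T (Suc k)) x) - - (LINT x:{0..1}|lborel. snd (st k) x * \<psi> (T k) x)" for k
      unfolding Td neg using P'[of k] by simp
    have i2: "set_integrable lborel {0..T (Suc k) - T k} (\<lambda>t. fL2 (uu k t) (pdt \<psi> (T k + t)) (pdx \<psi> (T k + t)))"
      "set_integrable lborel {0..T (Suc k) - T k} (\<lambda>t. fR2 h (uu k t) (uux k t) (\<psi> (T k + t)))" for k
      unfolding Td using P'[of k] by (simp_all add: set_integrable_def)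
    have e2: "(LINT t:{0..T (Suc k) - T k}|lborel. fL2 (uu k t) (pdt \<psi> (T k + t)) (pdx \<psi> (T k + t))) + (LINT t:{0..T (Suc k) - T k}|lborel. fR2 h (uu k t) (uux k t) (\<psi> (T k + t)))
        = (LINT x:{0..1}|lborel. fst (st (Suc k)) x * \<psi> (T (Suc k)) x) - (LINT x:{0..1}|lborel. fst (st k) x * \<psi> (T k) x)" for k
      unfolding Td neg using P'[of k] by simp
    have i4: "set_integrable lborel {0..T (Suc k) - T k} (\<lambda>t. fL4 (uu k t) (uux k t) (pdt \<psi> (T k + t)) (pdx \<psi> (T k + t)))"
      "set_integrable lborel {0..T (Suc k) - T k} (\<lambda>t. fR4 (uu k t) (uux k t) (\<psi> (T k + t)))" for k
      unfolding Td using P'[of k] by (simp_all add: set_integrable_def)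
    have e4: "(LINT t:{0..T (Suc k) - T k}|lborel. fL4 (uu k t) (uux k t) (pdt \<psi> (T k + t)) (pdx \<psi> (T k + t))) + (LINT t:{0..T (Suc k) - T k}|lborel. fR4 (uu k t) (uux k t) (\<psi> (T k + t)))
        = (LINT x:{0..1}|lborel. (snd (st (Suc k)) x)\<^sup>2 * \<psi> (T (Suc k)) x) - (LINT x:{0..1}|lborel. (snd (st k) x)\<^sup>2 * \<psi> (T k) x)" for k
      unfolding Td neg using P'[of k] by simp
    have z0: "(LINT x:{0..1}|lborel. f x * \<psi> t x) = 0" if "R + 1 \<le> t" for f t
      by (simp add: z[OF that] set_lebesgue_integral_def)
    \<comment> \<open>In (i) the right-hand functional and the boundary terms enter with the
      opposite sign, hence the negated \<open>gk\<close> and \<open>\<beta>\<close>.\<close>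
    show "(LINT t:{0..}|lborel. fL1 (u t) (ux t) (pdt (pdx \<psi>) t) (pdx \<psi> t)) + (LINT t:{0..}|lborel. - fR1 (u t) (ux t) (\<psi> t))
        = - (- (LINT x:{0..1}|lborel. u0x x * \<psi> 0 x))"
    proof (rule glue[where R = "R + 1" and \<beta> = "\<lambda>k. - (LINT x:{0..1}|lborel. snd (st k) x * \<psi> (T k) x)"
        and fk = "\<lambda>k t. fL1 (uu k t) (uux k t) (pdt (pdx \<psi>) (T k + t)) (pdx \<psi> (T k + t))"
        and gk = "\<lambda>k t. - fR1 (uu k t) (uux k t) (\<psi> (T k + t))", unfolded st(1) T0 snd_conv])
      fix t k
      show "fL1 (u t) (ux t) (pdt (pdx \<psi>) t) (pdx \<psi> t) = fL1 (uu k (t - T k)) (uux k (t - T k)) (pdt (pdx \<psi>) (T k + (t - T k))) (pdx \<psi> (T k + (t - T k)))" if "T k \<le> t" "t < T (Suc k)"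
        using u_eq[OF that] by simp
      show "- fR1 (u t) (ux t) (\<psi> t) = - fR1 (uu k (t - T k)) (uux k (t - T k)) (\<psi> (T k + (t - T k)))" if "T k \<le> t" "t < T (Suc k)"
        using u_eq[OF that] by simp
      show "fL1 (u t) (ux t) (pdt (pdx \<psi>) t) (pdx \<psi> t) = 0" "- fR1 (u t) (ux t) (\<psi> t) = 0" if "R + 1 \<le> t" using z[OF that] by (simp_all add: functionals_zero_test)
      show "- (LINT x:{0..1}|lborel. snd (st k) x * \<psi> (T k) x) = 0" if "R + 1 \<le> T k" using z0[OF that] by simp
    qed (rule i1 e1)+
    show "(LINT t:{0..}|lborel. fL2 (u t) (pdt \<psi> t) (pdx \<psi> t)) + (LINT t:{0..}|lborel. fR2 h (u t) (ux t) (\<psi> t))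
        = - (LINT x:{0..1}|lborel. u0 x * \<psi> 0 x)"
    proof (rule glue[where R = "R + 1" and \<beta> = "\<lambda>k. (LINT x:{0..1}|lborel. fst (st k) x * \<psi> (T k) x)"
        and fk = "\<lambda>k t. fL2 (uu k t) (pdt \<psi> (T k + t)) (pdx \<psi> (T k + t))"
        and gk = "\<lambda>k t. fR2 h (uu k t) (uux k t) (\<psi> (T k + t))", unfolded st(1) T0 fst_conv])
      fix t k
      show "fL2 (u t) (pdt \<psi> t) (pdx \<psi> t) = fL2 (uu k (t - T k)) (pdt \<psi> (T k + (t - T k))) (pdx \<psi> (T k + (t - T k)))" if "T k \<le> t" "t < T (Suc k)"
        using u_eq[OF that] by simp
      show "fR2 h (u t) (ux t) (\<psi> t) = fR2 h (uu k (t - T k)) (uux k (t - T k)) (\<psi> (T k + (t - T k)))" if "T k \<le> t" "t < T (Suc k)"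
        using u_eq[OF that] by simp
      show "fL2 (u t) (pdt \<psi> t) (pdx \<psi> t) = 0" "fR2 h (u t) (ux t) (\<psi> t) = 0" if "R + 1 \<le> t" using z[OF that] by (simp_all add: functionals_zero_test)
      show "(LINT x:{0..1}|lborel. fst (st k) x * \<psi> (T k) x) = 0" if "R + 1 \<le> T k" using z0[OF that] by simp
    qed (rule i2 e2)+
    show "(LINT t:{0..}|lborel. fL4 (u t) (ux t) (pdt \<psi> t) (pdx \<psi> t)) + (LINT t:{0..}|lborel. fR4 (u t) (ux t) (\<psi> t))
        = - (LINT x:{0..1}|lborel. (u0x x)\<^sup>2 * \<psi> 0 x)"
    proof (rule glue[where R = "R + 1" and \<beta> = "\<lambda>k. (LINT x:{0..1}|lborel. (snd (st k) x)\<^sup>2 * \<psi> (T k) x)"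
        and fk = "\<lambda>k t. fL4 (uu k t) (uux k t) (pdt \<psi> (T k + t)) (pdx \<psi> (T k + t))"
        and gk = "\<lambda>k t. fR4 (uu k t) (uux k t) (\<psi> (T k + t))", unfolded st(1) T0 snd_conv])
      fix t k
      show "fL4 (u t) (ux t) (pdt \<psi> t) (pdx \<psi> t) = fL4 (uu k (t - T k)) (uux k (t - T k)) (pdt \<psi> (T k + (t - T k))) (pdx \<psi> (T k + (t - T k)))" if "T k \<le> t" "t < T (Suc k)"
        using u_eq[OF that] by simp
      show "fR4 (u t) (ux t) (\<psi> t) = fR4 (uu k (t - T k)) (uux k (t - T k)) (\<psi> (T k + (t - T k)))" if "T k \<le> t" "t < T (Suc k)"
        using u_eq[OF that] by simp
      show "fL4 (u t) (ux t) (pdt \<psi> t) (pdx \<psi> t) = 0" "fR4 (u t) (ux t) (\<psi> t) = 0" if "R + 1 \<le> t" using z[OF that] by (simp_all add: functionals_zero_test)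
      show "(LINT x:{0..1}|lborel. (snd (st k) x)\<^sup>2 * \<psi> (T k) x) = 0" if "R + 1 \<le> T k" using z0[OF that] by simp
    qed (rule i4 e4)+
  qed
  have "global_acws u0 u0x u ux"
    unfolding global_acws_def
  proof (intro conjI allI impI)
    show "Linf_H1 u ux"
      unfolding Linf_H1_def
    proof (intro conjI)
      have "(\<lambda>q. u (fst q) (snd q)) \<in> borel_measurable borel" "(\<lambda>q. ux (fst q) (snd q)) \<in> borel_measurable borel"
        using meas by (simp_all add: borel_prod)
      then show "(\<lambda>p. u (fst p) (snd p)) \<in> borel_measurable lebesgue" "(\<lambda>p. ux (fst p) (snd p)) \<in> borel_measurable lebesgue"
        by (auto intro: measurable_completion)
      show "AE t in lborel. 0 \<le> t \<longrightarrow> H1S (u t) (ux t)"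
        using nondeg by eventually_elim (auto simp: good_state_def)
      show "\<exists>C. AE t in lborel. 0 \<le> t \<longrightarrow> (LINT x:{0..1}|lborel. (u t x)\<^sup>2 + (ux t x)\<^sup>2) \<le> C"
        by (rule exI[of _ K], use nondeg in eventually_elim) auto
    qed
    show "\<exists>c1 c2. AE t in lborel. 0 \<le> t \<longrightarrow> (LINT x:{0..1}|lborel. (ux t x)\<^sup>2) = c1 \<and>
        (LINT x:{0..1}|lborel. u t x - u t x * (ux t x)\<^sup>2) = c2"
      by (rule exI[of _ h], rule exI[of _ m], use nondeg in eventually_elim) (auto simp: good_state_def hval_def)
    fix \<psi> assume \<psi>: "test_fun \<psi>"
    show "(LINT t:{0..}|lborel. LINT x:{0..1}|lborel. u t x * pdt (pdx \<psi>) t x + (u t x)\<^sup>2 * ux t x * pdx \<psi> t x)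
      = (LINT t:{0..}|lborel. LINT x:{0..1}|lborel.
            (u t x - u t x * (ux t x)\<^sup>2 - Smean (\<lambda>z. u t z - u t z * (ux t z)\<^sup>2)) * \<psi> t x)
        + (LINT x:{0..1}|lborel. u0x x * \<psi> 0 x)"
      using weak(1)[OF \<psi>] by (simp add: fL1_def fR1_def set_lebesgue_integral_def)
    show "(LINT t:{0..}|lborel. LINT x:{0..1}|lborel. u t x * pdt \<psi> t x - 1/3 * (u t x)^3 * pdx \<psi> t x)
      = - (LINT t:{0..}|lborel. LINT x:{0..1}|lborel.
            (Sdxinv (\<lambda>z. u t z - u t z * (ux t z)\<^sup>2) x - ffun (hval u0x) u ux t) * \<psi> t x)
        - (LINT x:{0..1}|lborel. u0 x * \<psi> 0 x)"
      using weak(2)[OF \<psi>] unfolding fL2_def fR2_def ffun_def h_def by linarith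
    show "(LINT t:{0..}|lborel. LINT z:{0..1}|lborel. (ux t z)\<^sup>2 * pdt \<psi> t z - (u t z)\<^sup>2 * (ux t z)\<^sup>2 * pdx \<psi> t z)
      = - (LINT t:{0..}|lborel. LINT z:{0..1}|lborel.
            (2 * u t z * ux t z - 2 * ux t z * Smean (\<lambda>y. u t y - u t y * (ux t y)\<^sup>2)) * \<psi> t z)
        - (LINT z:{0..1}|lborel. (u0x z)\<^sup>2 * \<psi> 0 z)"
      using weak(3)[OF \<psi>] unfolding fL4_def fR4_def by linarith
  qed
  then show ?thesis by blast
qed

end
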